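(* Consider the stochastic Lagrange top on $\mathbb R^3\times\mathbb R^3$ with $\mathbb I=\mathrm{diag}(I_1,I_1,I_3)$, $I_1,I_3>0$, $\boldsymbol\chi=(0,0,\chi_3)$, constants $m,g$, $\boldsymbol\Omega=\mathbb I^{-1}\boldsymbol\Pi$, and a single noise with amplitude $\boldsymbol\sigma=\boldsymbol\chi$: $$d\boldsymbol\Pi+(\boldsymbol\Omega\,dt+\boldsymbol\chi\circ dW_t)\times\boldsymbol\Pi-mg\,(\boldsymbol\Gamma\times\boldsymbol\chi)\,dt=0,\qquad d\boldsymbol\Gamma+(\boldsymbol\Omega\,dt+\boldsymbol\chi\circ dW_t)\times\boldsymbol\Gamma=0 .$$ Then both $\boldsymbol\Pi\cdot\boldsymbol\chi$ and the energy $h(\boldsymbol\Pi,\boldsymbol\Gamma)=\tfrac12\boldsymbol\Pi\cdot\mathbb I^{-1}\boldsymbol\Pi+mg\,\boldsymbol\Gamma\cdot\boldsymbol\chi$ are conserved quantities of this stochastic process, in addition to the Casimirs $\|\boldsymbol\Gamma\|^2$ and $\boldsymbol\Pi\cdot\boldsymbol\Gamma$.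
   Context: $W_t$ is a standard Wiener process; $\circ$ denotes Stratonovich integration; $\times$ is the cross product in $\mathbb R^3$. Conserved means constant along solutions almost surely. *)

theory Defs
  imports "HOL-Probability.Probability"
begin

unbundle cross3_syntax

section \<open>Continuous-time processes\<close>

text \<open>
  Processes are functions \<open>X t \<omega>\<close> of which only the times \<open>t \<ge> 0\<close> matter. A filtration on
  $[0,\infty)$ is encoded as a library \<open>filtration\<close> indexed by all reals; this is no restriction,
  since it can be extended by \<open>F t = F 0\<close> for \<open>t < 0\<close>. No usual conditions are imposed.
\<close>

definition filtered_prob_space :: "'a measure \<Rightarrow> (real \<Rightarrow> 'a measure) \<Rightarrow> bool" where
  "filtered_prob_space M F \<longleftrightarrow>
     prob_space M \<and> filtration (space M) F \<and> (\<forall>t. subalgebra M (F t))"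

definition adapted :: "(real \<Rightarrow> 'a measure) \<Rightarrow> (real \<Rightarrow> 'a \<Rightarrow> real) \<Rightarrow> bool" where
  "adapted F X \<longleftrightarrow> (\<forall>t\<ge>0. X t \<in> borel_measurable (F t))"

definition continuous_process ::
    "'a measure \<Rightarrow> (real \<Rightarrow> 'a \<Rightarrow> 'b::topological_space) \<Rightarrow> bool" where
  "continuous_process M X \<longleftrightarrow> (AE \<omega> in M. continuous_on {0..} (\<lambda>t. X t \<omega>))"

definition wiener_process ::
    "'a measure \<Rightarrow> (real \<Rightarrow> 'a measure) \<Rightarrow> (real \<Rightarrow> 'a \<Rightarrow> real) \<Rightarrow> bool" where
  "wiener_process M F W \<longleftrightarrow>
     adapted F W \<and> continuous_process M W \<and> (AE \<omega> in M. W 0 \<omega> = 0) \<and>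
     (\<forall>s t. 0 \<le> s \<and> s < t \<longrightarrow>
        distributed M lborel (\<lambda>\<omega>. W t \<omega> - W s \<omega>) (normal_density 0 (sqrt (t - s))) \<and>
        prob_space.indep_set M (sets (F s))
          {(\<lambda>\<omega>. W t \<omega> - W s \<omega>) -` A \<inter> space M |A. A \<in> sets borel})"

definition martingale ::
    "'a measure \<Rightarrow> (real \<Rightarrow> 'a measure) \<Rightarrow> (real \<Rightarrow> 'a \<Rightarrow> real) \<Rightarrow> bool" where
  "martingale M F X \<longleftrightarrow>
     adapted F X \<and> (\<forall>t\<ge>0. integrable M (X t)) \<and>
     (\<forall>s t. 0 \<le> s \<and> s \<le> t \<longrightarrow> (AE \<omega> in M. real_cond_exp M (F s) (X t) \<omega> = X s \<omega>))"

text \<open>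
  Real-valued localizing times suffice: extended-valued ones can be replaced by their minimum
  with \<open>n\<close>. Subtracting \<open>X 0\<close> means that the initial value need not be integrable.
\<close>

definition continuous_local_martingale ::
    "'a measure \<Rightarrow> (real \<Rightarrow> 'a measure) \<Rightarrow> (real \<Rightarrow> 'a \<Rightarrow> real) \<Rightarrow> bool" where
  "continuous_local_martingale M F X \<longleftrightarrow>
     adapted F X \<and> continuous_process M X \<and>
     (\<exists>\<tau> :: nat \<Rightarrow> 'a \<Rightarrow> real.
        (\<forall>n. stopping_time F (\<tau> n) \<and> (\<forall>\<omega>\<in>space M. 0 \<le> \<tau> n \<omega>) \<and>
             martingale M F (\<lambda>t \<omega>. X (min t (\<tau> n \<omega>)) \<omega> - X 0 \<omega>)) \<and>
        (AE \<omega> in M. incseq (\<lambda>n. \<tau> n \<omega>) \<and> filterlim (\<lambda>n. \<tau> n \<omega>) at_top sequentially))"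

text \<open>The points \<open>p 0, \<dots>, p n\<close> partition the interval from \<open>0\<close> to \<open>t\<close>.\<close>

definition interval_partition :: "real \<Rightarrow> nat \<Rightarrow> (nat \<Rightarrow> real) \<Rightarrow> bool" where
  "interval_partition t n p \<longleftrightarrow> p 0 = 0 \<and> p n = t \<and> (\<forall>i<n. p i \<le> p (Suc i))"

definition finite_variation_path :: "(real \<Rightarrow> real) \<Rightarrow> bool" where
  "finite_variation_path f \<longleftrightarrow>
     (\<forall>t\<ge>0. \<exists>B. \<forall>n p. interval_partition t n p \<longrightarrow> (\<Sum>i<n. \<bar>f (p (Suc i)) - f (p i)\<bar>) \<le> B)"

definition continuous_semimartingale ::
    "'a measure \<Rightarrow> (real \<Rightarrow> 'a measure) \<Rightarrow> (real \<Rightarrow> 'a \<Rightarrow> real) \<Rightarrow> bool" where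
  "continuous_semimartingale M F X \<longleftrightarrow>
     adapted F X \<and> continuous_process M X \<and>
     (\<exists>L A. continuous_local_martingale M F L \<and>
        adapted F A \<and> continuous_process M A \<and>
        (AE \<omega> in M. finite_variation_path (\<lambda>t. A t \<omega>)) \<and>
        (AE \<omega> in M. \<forall>t\<ge>0. X t \<omega> = L t \<omega> + A t \<omega>))"

section \<open>The Stratonovich integral\<close>

definition stratonovich_sum ::
    "(real \<Rightarrow> 'a \<Rightarrow> 'b::real_vector) \<Rightarrow> (real \<Rightarrow> 'a \<Rightarrow> real) \<Rightarrow> nat \<Rightarrow> (nat \<Rightarrow> real) \<Rightarrow> 'a \<Rightarrow> 'b" where
  "stratonovich_sum X Y n p \<omega> =
     (\<Sum>i<n. (Y (p (Suc i)) \<omega> - Y (p i) \<omega>) *\<^sub>R ((1 / 2) *\<^sub>R (X (p i) \<omega> + X (p (Suc i)) \<omega>)))"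

text \<open>
  \<open>J\<close> is (a version of) the integral over $[0,t]$ of \<open>X\<close> against \<open>\<circ> dY\<close>: the limit in probability
  of the symmetric sums as the mesh of the partition tends to 0. The measurability of \<open>J\<close> matters,
  since \<open>measure\<close> is 0 on non-measurable sets.
\<close>

definition has_stratonovich_integral ::
    "'a measure \<Rightarrow> (real \<Rightarrow> 'a \<Rightarrow> 'b::euclidean_space) \<Rightarrow> (real \<Rightarrow> 'a \<Rightarrow> real) \<Rightarrow> real \<Rightarrow> ('a \<Rightarrow> 'b) \<Rightarrow> bool"
  where
  "has_stratonovich_integral M X Y t J \<longleftrightarrow>
     J \<in> borel_measurable M \<and>
     (\<forall>\<epsilon>>0. \<forall>\<eta>>0. \<exists>\<delta>>0. \<forall>n p.
        interval_partition t n p \<and> (\<forall>i<n. p (Suc i) - p i < \<delta>) \<longrightarrow>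
        measure M {\<omega> \<in> space M. norm (stratonovich_sum X Y n p \<omega> - J \<omega>) > \<epsilon>} < \<eta>)"

section \<open>The stochastic heavy top\<close>

text \<open>
  \<open>K\<close> is the inertia matrix, \<open>c\<close> the vector \<open>\<chi>\<close>, \<open>\<sigma>\<close> the noise amplitude, \<open>P\<close> and \<open>G\<close> the
  processes \<open>\<Pi>\<close> and \<open>\<Gamma>\<close>. As usual, the Stratonovich equations
    \<open>d\<Pi> + (\<Omega> dt + \<sigma> \<circ> dW) \<times> \<Pi> - m g (\<Gamma> \<times> \<chi>) dt = 0\<close> and \<open>d\<Gamma> + (\<Omega> dt + \<sigma> \<circ> dW) \<times> \<Gamma> = 0\<close>
  are understood as integral equations for continuous semimartingales.
\<close>

definition angular_velocity :: "real^3^3 \<Rightarrow> real^3 \<Rightarrow> real^3" where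
  "angular_velocity K v = matrix_inv K *v v"

definition stochastic_heavy_top_solution ::
    "'a measure \<Rightarrow> (real \<Rightarrow> 'a measure) \<Rightarrow> (real \<Rightarrow> 'a \<Rightarrow> real) \<Rightarrow>
     real^3^3 \<Rightarrow> real \<Rightarrow> real \<Rightarrow> real^3 \<Rightarrow> real^3 \<Rightarrow>
     (real \<Rightarrow> 'a \<Rightarrow> real^3) \<Rightarrow> (real \<Rightarrow> 'a \<Rightarrow> real^3) \<Rightarrow> bool" where
  "stochastic_heavy_top_solution M F W K m g c \<sigma> P G \<longleftrightarrow>
     (\<forall>i. continuous_semimartingale M F (\<lambda>t \<omega>. P t \<omega> $ i)) \<and>
     (\<forall>i. continuous_semimartingale M F (\<lambda>t \<omega>. G t \<omega> $ i)) \<and>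
     (\<forall>t\<ge>0. \<exists>J. has_stratonovich_integral M (\<lambda>s \<omega>. \<sigma> \<times> P s \<omega>) W t J \<and>
        (AE \<omega> in M.
           P t \<omega> - P 0 \<omega> + integral {0..t} (\<lambda>s. angular_velocity K (P s \<omega>) \<times> P s \<omega>) + J \<omega>
             - integral {0..t} (\<lambda>s. (m * g) *\<^sub>R (G s \<omega> \<times> c)) = 0)) \<and>
     (\<forall>t\<ge>0. \<exists>J. has_stratonovich_integral M (\<lambda>s \<omega>. \<sigma> \<times> G s \<omega>) W t J \<and>
        (AE \<omega> in M.
           G t \<omega> - G 0 \<omega> + integral {0..t} (\<lambda>s. angular_velocity K (P s \<omega>) \<times> G s \<omega>) + J \<omega> = 0))"

definition heavy_top_energy ::
    "real^3^3 \<Rightarrow> real \<Rightarrow> real \<Rightarrow> real^3 \<Rightarrow> real^3 \<Rightarrow> real^3 \<Rightarrow> real" where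
  "heavy_top_energy K m g c p q = 1 / 2 * (p \<bullet> (matrix_inv K *v p)) + m * g * (q \<bullet> c)"

definition lagrange_inertia :: "real \<Rightarrow> real \<Rightarrow> real^3^3" where
  "lagrange_inertia I\<^sub>1 I\<^sub>3 = (\<chi> i j. if i = j then (vector [I\<^sub>1, I\<^sub>1, I\<^sub>3] :: real^3) $ i else 0)"

definition lagrange_axis :: "real \<Rightarrow> real^3" where
  "lagrange_axis c\<^sub>3 = vector [0, 0, c\<^sub>3]"

definition conserved ::
    "'a measure \<Rightarrow> (real \<Rightarrow> 'a \<Rightarrow> real^3) \<Rightarrow> (real \<Rightarrow> 'a \<Rightarrow> real^3) \<Rightarrow> (real^3 \<Rightarrow> real^3 \<Rightarrow> real) \<Rightarrow> bool"
  where
  "conserved M P G f \<longleftrightarrow> (AE \<omega> in M. \<forall>t\<ge>0. f (P t \<omega>) (G t \<omega>) = f (P 0 \<omega>) (G 0 \<omega>))"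

end

theory Submission
  imports Defs
begin

text \<open>
  If \<open>X\<close> and \<open>Y\<close> both have the noise \<open>c \<times> _ \<circ> dW\<close>, then it cancels in \<open>d(X \<bullet> Y)\<close>, because \<open>c \<times>\<close> is
  antisymmetric; the Casimirs, \<open>\<Pi> \<bullet> \<chi>\<close> and the energy are combinations of such inner products
  and of third components, which see no noise at all.

  The product rule is obtained on dyadic grids, without constructing an Ito integral. Over one cell,
  the Stratonovich integral differs from its one-step trapezoidal rule by a defect, and the sum of the
  defects, weighted by the other process, has to vanish in probability. Up to a negligible error,
  the defect is an Ito sum over a finer grid plus a covariation term. Weighted Ito sums are small by
  the isometry. The covariation terms are absolutely summable with a bound that is tight (this is
  where the semimartingale property enters), so the weights may be frozen on macroscopic cells; there
  the unweighted sum of the defects is small by the definition of the integral.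
\<close>

section \<open>Statements outside small exceptional sets\<close>

text \<open>The integral is a limit in probability at each fixed time, without a rate and without
  regularity in time, and the equations hold almost surely at each fixed time only. So a sum of
  \<open>2 ^ n\<close> defects cannot be controlled by the definition alone: the fine level
  \<open>n + m\<close> that approximates \<open>J\<close> is chosen after \<open>n\<close>, so
  precisely that all the cell errors together stay small, and every other estimate has to be uniform
  in \<open>m\<close>. The weights of the exact discrete product rule average both ends of a cell.
  The half that looks ahead is not adapted, so the isometry does not apply to it; Young's inequality
  does, against the small sum of squares of the Ito blocks. For the energy, the equality of the
  first two moments of inertia is decisive: the kinetic part is then a function of
  \<open>P \<bullet> P\<close> and the third component of \<open>P\<close>. The latter is constant,
  and the drift of \<open>P \<bullet> P\<close> is a constant multiple of the drift of the third
  component of \<open>G\<close>, which the potential part compensates.\<close>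

context prob_space begin

text \<open>Exceptional sets spare proofs that the set where \<open>\<Phi>\<close> fails is measurable.\<close>

definition off_small :: "real \<Rightarrow> ('a \<Rightarrow> bool) \<Rightarrow> bool" where
  "off_small \<eta> \<Phi> \<longleftrightarrow> (\<exists>B\<in>sets M. prob B \<le> \<eta> \<and> (\<forall>\<omega>\<in>space M - B. \<Phi> \<omega>))"

lemma off_smallI: "B \<in> sets M \<Longrightarrow> prob B \<le> \<eta> \<Longrightarrow> (\<And>\<omega>. \<omega> \<in> space M \<Longrightarrow> \<omega> \<notin> B \<Longrightarrow> \<Phi> \<omega>) \<Longrightarrow> off_small \<eta> \<Phi>"
  unfolding off_small_def by blast

lemma off_small_mono:
  assumes "off_small a \<Phi>" "a \<le> b" "\<And>\<omega>. \<omega> \<in> space M \<Longrightarrow> \<Phi> \<omega> \<Longrightarrow> \<Psi> \<omega>"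
  shows "off_small b \<Psi>"
proof -
  obtain B where "B \<in> sets M" "prob B \<le> a" "\<And>\<omega>. \<omega> \<in> space M - B \<Longrightarrow> \<Phi> \<omega>"
    using assms(1) unfolding off_small_def by blast
  then show ?thesis
    using assms(2,3) by (intro off_smallI[of B]) auto
qed

lemma off_small_conj:
  assumes "off_small a \<Phi>" "off_small b \<Psi>"
  shows "off_small (a + b) (\<lambda>\<omega>. \<Phi> \<omega> \<and> \<Psi> \<omega>)"
proof -
  obtain A B where *: "A \<in> sets M" "prob A \<le> a" "\<And>\<omega>. \<omega> \<in> space M - A \<Longrightarrow> \<Phi> \<omega>"
     "B \<in> sets M" "prob B \<le> b" "\<And>\<omega>. \<omega> \<in> space M - B \<Longrightarrow> \<Psi> \<omega>"
    using assms unfolding off_small_def by blast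
  have "prob (A \<union> B) \<le> a + b"
    using measure_Un_le[OF *(1,4)] *(2,5) by linarith
  then show ?thesis
    using * by (intro off_smallI[of "A \<union> B"]) auto
qed

lemma off_small_AE:
  assumes "AE \<omega> in M. \<Phi> \<omega>"
  shows "off_small 0 \<Phi>"
proof -
  obtain N where "{\<omega>\<in>space M. \<not> \<Phi> \<omega>} \<subseteq> N" "emeasure M N = 0" "N \<in> sets M"
    using assms by (rule AE_E)
  then show ?thesis
    by (intro off_smallI[of N]) (auto simp: measure_def)
qed

lemma off_small_conj_AE:
  assumes "AE \<omega> in M. \<Phi> \<omega>" "off_small b \<Psi>"
  shows "off_small b (\<lambda>\<omega>. \<Phi> \<omega> \<and> \<Psi> \<omega>)"
  using off_small_conj[OF off_small_AE[OF assms(1)] assms(2)] by simp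

lemma off_small_ball:
  assumes "finite I" "\<And>i. i \<in> I \<Longrightarrow> off_small (\<eta> i) (\<Phi> i)"
  shows "off_small (\<Sum>i\<in>I. \<eta> i) (\<lambda>\<omega>. \<forall>i\<in>I. \<Phi> i \<omega>)"
  using assms
proof (induction I rule: finite_induct)
  case empty
  show ?case by (rule off_smallI[of "{}"]) auto
next
  case (insert i I)
  then have "off_small (\<eta> i + sum \<eta> I) (\<lambda>\<omega>. \<Phi> i \<omega> \<and> (\<forall>i\<in>I. \<Phi> i \<omega>))"
    by (intro off_small_conj) auto
  then show ?case
    using insert by (simp add: conj_commute)
qed

lemma off_small_Markov:
  assumes "integrable M Z" "\<And>\<omega>. \<omega> \<in> space M \<Longrightarrow> 0 \<le> Z \<omega>" "0 < a"
    and le: "expectation Z \<le> a * \<eta>"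
  shows "off_small \<eta> (\<lambda>\<omega>. Z \<omega> \<le> a)"
proof (rule off_smallI[of "{\<omega>\<in>space M. a \<le> Z \<omega>}"])
  have "prob {\<omega>\<in>space M. a \<le> Z \<omega>} \<le> expectation Z / a"
    using integral_Markov_inequality_measure[OF assms(1), where A="{}" and c=a] assms by auto
  also have "\<dots> \<le> \<eta>" using le \<open>0 < a\<close> by (simp add: field_simps)
  finally show "prob {\<omega>\<in>space M. a \<le> Z \<omega>} \<le> \<eta>" .
  show "{\<omega>\<in>space M. a \<le> Z \<omega>} \<in> sets M" using assms(1) by measurable
qed (simp add: not_le less_imp_le)

text \<open>With exceptional sets of probability at most \<open>1 / (n + 1)\<close>, the property
  holds off their intersection, which is null.\<close>

lemma AE_if_off_small:
  assumes "\<And>\<eta>. 0 < \<eta> \<Longrightarrow> off_small \<eta> \<Phi>"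
  shows "AE \<omega> in M. \<Phi> \<omega>"
proof -
  have "\<exists>B. B \<in> sets M \<and> prob B \<le> 1 / real (Suc n) \<and> (\<forall>\<omega>\<in>space M - B. \<Phi> \<omega>)" for n
    using assms[of "1 / real (Suc n)"] unfolding off_small_def by auto
  then obtain B where B: "\<And>n. B n \<in> sets M" "\<And>n. prob (B n) \<le> 1 / real (Suc n)"
     "\<And>n. \<forall>\<omega>\<in>space M - B n. \<Phi> \<omega>" by metis
  have m: "(\<Inter>n. B n) \<in> sets M" using B(1) by blast
  have "prob (\<Inter>n. B n) \<le> 1 / real (Suc n)" for n
    using finite_measure_mono[of "\<Inter>n. B n" "B n"] B(1,2)[of n] by (meson INT_lower UNIV_I order_trans)
  then have "(\<lambda>n. prob (\<Inter>n. B n)) \<longlonglongrightarrow> 0"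
    by (intro tendsto_sandwich[OF _ _ tendsto_const LIMSEQ_inverse_real_of_nat]) (auto simp: field_simps)
  then have "prob (\<Inter>n. B n) = 0" using LIMSEQ_unique tendsto_const by blast
  then have "(\<Inter>n. B n) \<in> null_sets M"
    using m by (auto simp: null_sets_def emeasure_eq_measure)
  then show ?thesis
    by (rule AE_I') (use B(3) in blast)
qed

lemma AE_zero_if_off_small:
  fixes D :: "'a \<Rightarrow> real"
  assumes "\<And>\<epsilon> \<eta>. 0 < \<epsilon> \<Longrightarrow> 0 < \<eta> \<Longrightarrow> off_small \<eta> (\<lambda>\<omega>. \<bar>D \<omega>\<bar> \<le> \<epsilon>)"
  shows "AE \<omega> in M. D \<omega> = 0"
proof -
  have "AE \<omega> in M. \<forall>n. \<bar>D \<omega>\<bar> \<le> inverse (real (Suc n))"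
    unfolding AE_all_countable by (intro allI AE_if_off_small assms) auto
  then show ?thesis
  proof eventually_elim
    case (elim \<omega>)
    then have "\<bar>D \<omega>\<bar> \<le> 0"
      by (intro LIMSEQ_le_const[OF LIMSEQ_inverse_real_of_nat]) auto
    then show ?case by simp
  qed
qed

text \<open>Trades a threshold that depends on \<open>\<omega>\<close> for a deterministic one, at
  the price of a set of probability \<open>\<eta>\<close>: the sets where \<open>\<Phi>\<close>
  fails at some later index decrease to a null set, and the measure is continuous from
  above.\<close>

lemma off_small_eventually:
  assumes ev: "AE \<omega> in M. eventually (\<lambda>n::nat. \<Phi> n \<omega>) sequentially"
    and m: "\<And>n. {\<omega>\<in>space M. \<Phi> n \<omega>} \<in> sets M" and "0 < \<eta>"
  shows "\<exists>n. off_small \<eta> (\<Phi> n)"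
proof -
  define C where "C n = {\<omega>\<in>space M. \<exists>k\<ge>n. \<not> \<Phi> k \<omega>}" for n
  have Cm: "C n \<in> sets M" for n
  proof -
    have "C n = (\<Union>k\<in>{n..}. space M - {\<omega>\<in>space M. \<Phi> k \<omega>})" by (auto simp: C_def)
    then show ?thesis using m by auto
  qed
  have "(\<lambda>n. prob (C n)) \<longlonglongrightarrow> prob (\<Inter>n. C n)"
  proof (rule finite_Lim_measure_decseq)
    show "range C \<subseteq> sets M" using Cm by auto
    show "decseq C" unfolding decseq_def C_def using order_trans by blast
  qed
  moreover have "prob (\<Inter>n. C n) = 0"
  proof -
    have "AE \<omega> in M. \<omega> \<notin> (\<Inter>n. C n)"
      using ev by eventually_elim (auto simp: C_def eventually_sequentially)
    then show ?thesis using Cm by (subst prob_eq_0) auto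
  qed
  ultimately have "eventually (\<lambda>n. prob (C n) < \<eta>) sequentially"
    using \<open>0 < \<eta>\<close> by (auto dest: order_tendstoD(2)[where a=\<eta>])
  then obtain n where n: "prob (C n) < \<eta>" by (auto simp: eventually_sequentially)
  have "off_small \<eta> (\<Phi> n)"
    using n by (intro off_smallI[OF Cm[of n]]) (auto simp: C_def)
  then show ?thesis ..
qed

text \<open>Convergence to 0 in probability, phrased through exceptional sets so that integrals and
  suprema of paths can occur in \<open>Z n\<close> without a proof that they are measurable in
  \<open>\<omega>\<close>.\<close>

definition vanishes :: "(nat \<Rightarrow> 'a \<Rightarrow> real) \<Rightarrow> bool" where
  "vanishes Z \<longleftrightarrow> (\<forall>\<epsilon>>0. \<forall>\<eta>>0. \<exists>n0. \<forall>n\<ge>n0. off_small \<eta> (\<lambda>\<omega>. \<bar>Z n \<omega>\<bar> \<le> \<epsilon>))"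

lemma vanishes_add:
  assumes "vanishes Y" "vanishes Z"
  shows "vanishes (\<lambda>n \<omega>. Y n \<omega> + Z n \<omega>)"
  unfolding vanishes_def
proof (intro allI impI)
  fix \<epsilon> \<eta> :: real assume e: "0 < \<epsilon>" "0 < \<eta>"
  obtain n0 where n0: "\<And>n. n \<ge> n0 \<Longrightarrow> off_small (\<eta>/2) (\<lambda>\<omega>. \<bar>Y n \<omega>\<bar> \<le> \<epsilon>/2)"
    using assms(1) e unfolding vanishes_def by (meson half_gt_zero)
  obtain n1 where n1: "\<And>n. n \<ge> n1 \<Longrightarrow> off_small (\<eta>/2) (\<lambda>\<omega>. \<bar>Z n \<omega>\<bar> \<le> \<epsilon>/2)"
    using assms(2) e unfolding vanishes_def by (meson half_gt_zero)
  show "\<exists>n0. \<forall>n\<ge>n0. off_small \<eta> (\<lambda>\<omega>. \<bar>Y n \<omega> + Z n \<omega>\<bar> \<le> \<epsilon>)"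
  proof (intro exI[of _ "max n0 n1"] allI impI)
    fix n assume "max n0 n1 \<le> n"
    then show "off_small \<eta> (\<lambda>\<omega>. \<bar>Y n \<omega> + Z n \<omega>\<bar> \<le> \<epsilon>)"
      by (intro off_small_mono[OF off_small_conj[OF n0[of n] n1[of n]]]) auto
  qed
qed

lemma vanishes_minus: "vanishes Z \<Longrightarrow> vanishes (\<lambda>n \<omega>. - Z n \<omega>)"
  unfolding vanishes_def abs_minus_cancel .

lemma vanishes_sum:
  assumes "finite I" "\<And>i. i \<in> I \<Longrightarrow> vanishes (Z i)"
  shows "vanishes (\<lambda>n \<omega>. \<Sum>i\<in>I. Z i n \<omega>)"
  using assms
proof (induction I rule: finite_induct)
  case empty
  have "off_small \<eta> (\<lambda>\<omega>. True)" if "0 < \<eta>" for \<eta>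
    using that by (intro off_smallI[of "{}"]) auto
  then show ?case by (auto simp: vanishes_def)
next
  case (insert i I)
  then have "vanishes (\<lambda>n \<omega>. Z i n \<omega> + (\<Sum>i\<in>I. Z i n \<omega>))"
    by (intro vanishes_add) auto
  then show ?case using insert by simp
qed

lemma vanishes_cong_AE:
  assumes "\<And>n. AE \<omega> in M. Y n \<omega> = Z n \<omega>" "vanishes Y"
  shows "vanishes Z"
  unfolding vanishes_def
proof (intro allI impI)
  fix \<epsilon> \<eta> :: real assume "0 < \<epsilon>" "0 < \<eta>"
  then obtain n0 where n0: "\<And>n. n \<ge> n0 \<Longrightarrow> off_small \<eta> (\<lambda>\<omega>. \<bar>Y n \<omega>\<bar> \<le> \<epsilon>)"
    using assms(2) unfolding vanishes_def by meson
  show "\<exists>n0. \<forall>n\<ge>n0. off_small \<eta> (\<lambda>\<omega>. \<bar>Z n \<omega>\<bar> \<le> \<epsilon>)"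
  proof (intro exI[of _ n0] allI impI)
    fix n assume "n0 \<le> n"
    from off_small_conj_AE[OF assms(1)[of n] n0[OF this]]
    show "off_small \<eta> (\<lambda>\<omega>. \<bar>Z n \<omega>\<bar> \<le> \<epsilon>)"
      by (rule off_small_mono) auto
  qed
qed

text \<open>This turns approximations into identities: a fixed random variable that every level of
  the grid represents as an error of that level must be 0.\<close>

lemma vanishes_const:
  assumes "vanishes (\<lambda>n. D)"
  shows "AE \<omega> in M. D \<omega> = 0"
proof (rule AE_zero_if_off_small)
  fix \<epsilon> \<eta> :: real assume "0 < \<epsilon>" "0 < \<eta>"
  then obtain n0 :: nat where "\<And>n. n0 \<le> n \<Longrightarrow> off_small \<eta> (\<lambda>\<omega>. \<bar>D \<omega>\<bar> \<le> \<epsilon>)"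
    using assms unfolding vanishes_def by meson
  then show "off_small \<eta> (\<lambda>\<omega>. \<bar>D \<omega>\<bar> \<le> \<epsilon>)"
    using order_refl .
qed

end

section \<open>Processes on dyadic grids\<close>

text \<open>Dyadic, so that level \<open>n\<close> is contained in level \<open>n + m\<close>.
  Indices beyond \<open>2 ^ n\<close> are meaningful too, which lets statements about Ito sums
  quantify over all indices.\<close>

definition grid :: "real \<Rightarrow> nat \<Rightarrow> nat \<Rightarrow> real" where
  "grid t n i = t * real i / 2 ^ n"

lemma grid_0 [simp]: "grid t n 0 = 0"
  by (simp add: grid_def)

lemma grid_last [simp]: "grid t n (2 ^ n) = t"
  by (simp add: grid_def)

lemma grid_refine: "grid t (n + m) (i * 2 ^ m) = grid t n i"
  by (simp add: grid_def power_add)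

lemma grid_mono: "0 \<le> t \<Longrightarrow> i \<le> j \<Longrightarrow> grid t n i \<le> grid t n j"
  by (simp add: grid_def divide_right_mono mult_left_mono)

lemma grid_nonneg: "0 \<le> t \<Longrightarrow> 0 \<le> grid t n i"
  by (simp add: grid_def)

lemma grid_le: "0 \<le> t \<Longrightarrow> i \<le> 2 ^ n \<Longrightarrow> grid t n i \<le> t"
  using grid_mono[of t i "2 ^ n" n] by simp

lemma grid_in: "0 \<le> t \<Longrightarrow> i \<le> 2 ^ n \<Longrightarrow> grid t n i \<in> {0..t}"
  using grid_nonneg grid_le by simp

lemma grid_Suc_diff: "grid t n (Suc i) - grid t n i = t / 2 ^ n"
  by (simp add: grid_def field_simps)

lemma grid_diff_le:
  assumes "0 \<le> t" "i \<le> j" "j \<le> i + 2 ^ m"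
  shows "\<bar>grid t (n + m) j - grid t (n + m) i\<bar> \<le> t / 2 ^ n"
proof -
  have "grid t (n + m) j \<le> grid t (n + m) (i + 2 ^ m)"
    by (intro grid_mono assms)
  also have "\<dots> - grid t (n + m) i = t / 2 ^ n"
    by (simp add: grid_def field_simps power_add)
  finally show ?thesis using grid_mono[OF assms(1,2), of "n + m"] by simp
qed

lemma sum_grid_blocks:
  "(\<Sum>j<2 ^ (n + m). f j) = (\<Sum>i<2 ^ n. \<Sum>j\<in>{i * 2 ^ m..<Suc i * 2 ^ m}. f j)" for f :: "nat \<Rightarrow> real"
  using sum.nat_group[of f "2 ^ m" "2 ^ n"] by (simp add: power_add add.commute mult.commute[of "2 ^ m" "2 ^ n"])

lemma partition_grid:
  "0 \<le> t \<Longrightarrow> interval_partition (grid t n k) k (grid t n)"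
  by (simp add: interval_partition_def grid_mono)

section \<open>Truncation and the Huber function\<close>

definition truncate :: "real \<Rightarrow> real \<Rightarrow> real" where
  "truncate l x = max (- l) (min l x)"

lemma truncate_eq: "\<bar>x\<bar> \<le> l \<Longrightarrow> truncate l x = x"
  by (auto simp: truncate_def)

lemma abs_truncate: "0 \<le> l \<Longrightarrow> \<bar>truncate l x\<bar> \<le> l"
  by (auto simp: truncate_def)

lemma measurable_truncate [measurable]: "truncate l \<in> borel_measurable borel"
  unfolding truncate_def by measurable

text \<open>The convex, continuously differentiable function with derivative
  \<open>2 * truncate l\<close>: the square near 0, continued by its tangents.\<close>

definition huber :: "real \<Rightarrow> real \<Rightarrow> real" where
  "huber l x = (if \<bar>x\<bar> \<le> l then x\<^sup>2 else 2 * l * \<bar>x\<bar> - l\<^sup>2)"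

lemma measurable_huber [measurable]: "huber l \<in> borel_measurable borel"
  unfolding huber_def by measurable

lemma huber_nonneg:
  assumes "0 \<le> l"
  shows "0 \<le> huber l x"
proof (cases "\<bar>x\<bar> \<le> l")
  case False
  then have "l * l \<le> l * \<bar>x\<bar>" "0 \<le> l * \<bar>x\<bar>" using assms by (auto intro: mult_left_mono)
  then show ?thesis using False by (simp add: huber_def power2_eq_square)
qed (simp add: huber_def)

lemma huber_le: "0 \<le> l \<Longrightarrow> huber l x \<le> 2 * l * \<bar>x\<bar>"
proof (cases "\<bar>x\<bar> \<le> l")
  case True
  assume "0 \<le> l"
  have "\<bar>x\<bar> * \<bar>x\<bar> \<le> l * \<bar>x\<bar>" using True by (intro mult_right_mono) auto
  moreover have "0 \<le> l * \<bar>x\<bar>" using \<open>0 \<le> l\<close> by simp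
  moreover have "\<bar>x\<bar> * \<bar>x\<bar> = x * x" by (simp flip: power2_eq_square)
  ultimately have "x * x \<le> 2 * (l * \<bar>x\<bar>)" by linarith
  then show ?thesis using True by (simp add: huber_def power2_eq_square)
qed (simp add: huber_def)

text \<open>The right side is the gap between a convex function and its tangent at \<open>x\<close>,
  hence nonnegative; where both points lie in the quadratic part it is exactly
  \<open>(y - x)\<^sup>2\<close>. The case \<open>x < - l\<close> follows by reflection, since
  \<open>huber l\<close> is even and \<open>truncate l\<close> is odd.\<close>

lemma huber_increment:
  assumes "0 \<le> l"
  shows "(if \<bar>x\<bar> \<le> l \<and> \<bar>y\<bar> \<le> l then (y - x)\<^sup>2 else 0)
    \<le> huber l y - huber l x - 2 * (truncate l x * (y - x))"
proof -
  have up: "(if \<bar>x\<bar> \<le> l \<and> \<bar>y\<bar> \<le> l then (y - x)\<^sup>2 else 0)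
    \<le> huber l y - huber l x - 2 * (truncate l x * (y - x))" if "- l \<le> x" for x y
  proof -
    consider "\<bar>x\<bar> \<le> l" "\<bar>y\<bar> \<le> l" | "\<bar>x\<bar> \<le> l" "l < y" | "\<bar>x\<bar> \<le> l" "y < - l"
      | "l < x" "\<bar>y\<bar> \<le> l" | "l < x" "l < y" | "l < x" "y < - l"
      using \<open>- l \<le> x\<close> by linarith
    then show "(if \<bar>x\<bar> \<le> l \<and> \<bar>y\<bar> \<le> l then (y - x)\<^sup>2 else 0)
        \<le> huber l y - huber l x - 2 * (truncate l x * (y - x))"
    proof cases
      case 1
      then show ?thesis by (simp add: huber_def truncate_def power2_eq_square algebra_simps)
    next
      case 2
      \<comment> \<open>Up to a positive factor, the product supplied here and in cases 3, 4 and 6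
        is the right side in factored form; the left side is 0 in cases 2, 3 and 6 and also in case
        4, because \<open>l < x\<close>.\<close>
      then have "0 \<le> (l - x) * (2 * y - l - x)" by (intro mult_nonneg_nonneg) auto
      with 2 show ?thesis using assms by (simp add: huber_def truncate_def power2_eq_square algebra_simps)
    next
      case 3
      then have "0 \<le> (l + x) * (- 2 * y - l + x)" by (intro mult_nonneg_nonneg) auto
      with 3 show ?thesis using assms by (simp add: huber_def truncate_def power2_eq_square algebra_simps)
    next
      case 4
      have "0 \<le> (y - l) * (y - l)" by simp
      with 4 show ?thesis using assms by (simp add: huber_def truncate_def power2_eq_square algebra_simps)
    next
      case 5
      with assms show ?thesis by (simp add: huber_def truncate_def power2_eq_square algebra_simps)
    next
      case 6
      have "0 \<le> l * (- y)" using 6 assms by (intro mult_nonneg_nonneg) auto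
      with 6 show ?thesis using assms by (simp add: huber_def truncate_def power2_eq_square algebra_simps)
    qed
  qed
  show ?thesis
  proof (cases "- l \<le> x")
    case True then show ?thesis using up by blast
  next
    case False
    then have "- l \<le> - x" using assms by linarith
    from up[OF this, of "- y"] show ?thesis using False assms
      by (auto simp: huber_def truncate_def power2_eq_square algebra_simps split: if_splits)
  qed
qed

section \<open>Path bounds and moduli of continuity through countably many times\<close>

lemma ex_rational_near:
  fixes s t e :: real
  assumes "s \<in> {0..t}" "0 < e"
  shows "\<exists>q\<in>insert t ({0..t} \<inter> \<rat>). \<bar>q - s\<bar> < e"
\<comment> \<open>A rational just to the right of \<open>s\<close> stays inside the interval only if
  \<open>s < t\<close>; the endpoint is its own approximation, and it is added to the set because it
  may be irrational.\<close>
proof (cases "s = t")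
  case False
  then have "s < min (s + e) t" using assms by auto
  then obtain q where "q \<in> \<rat>" "s < q" "q < min (s + e) t" using Rats_dense_in_real by blast
  then show ?thesis using assms by (intro bexI[of _ q]) auto
qed (use assms in auto)

lemma countable_rational_interval: "countable (insert t ({0..t} \<inter> (\<rat>::real set)))"
  by (intro countable_insert countable_Int2 countable_rat)

lemma bound_from_rationals:
  fixes f :: "real \<Rightarrow> real"
  assumes c: "continuous_on {0..t} f" and b: "\<And>q. q \<in> insert t ({0..t} \<inter> \<rat>) \<Longrightarrow> \<bar>f q\<bar> \<le> b"
    and s: "s \<in> {0..t}"
  shows "\<bar>f s\<bar> \<le> b"
proof (rule ccontr)
  assume "\<not> ?thesis"
  then have "0 < \<bar>f s\<bar> - b" by simp
  then obtain d where "0 < d" and d: "\<And>q. q \<in> {0..t} \<Longrightarrow> dist q s < d \<Longrightarrow> dist (f q) (f s) < \<bar>f s\<bar> - b"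
    using c s unfolding continuous_on_iff by meson
  obtain q where q: "q \<in> insert t ({0..t} \<inter> \<rat>)" "\<bar>q - s\<bar> < d"
    using ex_rational_near[OF s \<open>0 < d\<close>] by blast
  then have "dist (f q) (f s) < \<bar>f s\<bar> - b" using s by (intro d) (auto simp: dist_real_def)
  with b[OF q(1)] show False by (auto simp: dist_real_def)
qed

text \<open>The strict inequality \<open>\<bar>s - u\<bar> < \<delta>\<close> is an open condition:
  points of the countable set within half of the slack of \<open>s\<close> and \<open>u\<close> are
  still closer than \<open>\<delta>\<close> to each other, and continuity carries the bound
  over.\<close>

lemma osc_from_rationals:
  fixes f :: "real \<Rightarrow> real"
  assumes c: "continuous_on {0..t} f"
    and b: "\<And>q r. q \<in> insert t ({0..t} \<inter> \<rat>) \<Longrightarrow> r \<in> insert t ({0..t} \<inter> \<rat>) \<Longrightarrow> \<bar>q - r\<bar> < \<delta> \<Longrightarrow> \<bar>f q - f r\<bar> \<le> b"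
    and s: "s \<in> {0..t}" and u: "u \<in> {0..t}" and "\<bar>s - u\<bar> < \<delta>"
  shows "\<bar>f s - f u\<bar> \<le> b"
proof (rule ccontr)
  assume "\<not> ?thesis"
  then have *: "0 < (\<bar>f s - f u\<bar> - b) / 2" by simp
  then obtain d where "0 < d" and d: "\<And>q. q \<in> {0..t} \<Longrightarrow> dist q s < d \<Longrightarrow> dist (f q) (f s) < (\<bar>f s - f u\<bar> - b) / 2"
    using c s unfolding continuous_on_iff by meson
  obtain e where "0 < e" and e: "\<And>q. q \<in> {0..t} \<Longrightarrow> dist q u < e \<Longrightarrow> dist (f q) (f u) < (\<bar>f s - f u\<bar> - b) / 2"
    using c u * unfolding continuous_on_iff by meson
  have pos: "0 < min (min d e) ((\<delta> - \<bar>s - u\<bar>) / 2)" using \<open>0 < d\<close> \<open>0 < e\<close> assms(5) by simp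
  obtain q where q: "q \<in> insert t ({0..t} \<inter> \<rat>)" "\<bar>q - s\<bar> < min (min d e) ((\<delta> - \<bar>s - u\<bar>) / 2)"
    using ex_rational_near[OF s pos] by blast
  obtain r where r: "r \<in> insert t ({0..t} \<inter> \<rat>)" "\<bar>r - u\<bar> < min (min d e) ((\<delta> - \<bar>s - u\<bar>) / 2)"
    using ex_rational_near[OF u pos] by blast
  have "dist (f q) (f s) < (\<bar>f s - f u\<bar> - b) / 2" "dist (f r) (f u) < (\<bar>f s - f u\<bar> - b) / 2"
    by (rule d, use q r s u in \<open>force simp: dist_real_def\<close>, use q r s u in \<open>force simp: dist_real_def\<close>)
      (rule e, use q r s u in \<open>force simp: dist_real_def\<close>, use q r s u in \<open>force simp: dist_real_def\<close>)
  moreover have "\<bar>q - r\<bar> < \<delta>" 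
  proof -
    have "2 * \<bar>q - s\<bar> < \<delta> - \<bar>s - u\<bar>" "2 * \<bar>r - u\<bar> < \<delta> - \<bar>s - u\<bar>" using q(2) r(2) by simp_all
    then show ?thesis by (auto simp: abs_if split: if_splits)
  qed
  then have "\<bar>f q - f r\<bar> \<le> b" using q r by (intro b) auto
  ultimately show False by (auto simp: dist_real_def abs_if split: if_splits)
qed

context prob_space begin

text \<open>Almost every path is bounded on the compact interval, but by a random constant.
  Restricting to countably many times makes the events measurable, so the constant can be made
  deterministic by \<open>off_small_eventually\<close>.\<close>

lemma off_small_bounded:
  fixes x :: "real \<Rightarrow> 'a \<Rightarrow> real"
  assumes c: "continuous_process M x" and m: "\<And>s. 0 \<le> s \<Longrightarrow> x s \<in> borel_measurable M"
    and "0 \<le> t" "0 < \<eta>"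
  shows "\<exists>b>0. off_small \<eta> (\<lambda>\<omega>. \<forall>s\<in>{0..t}. \<bar>x s \<omega>\<bar> \<le> b)"
proof -
  let ?Q = "insert t ({0..t} \<inter> \<rat>)"
  have cont: "AE \<omega> in M. continuous_on {0..t} (\<lambda>s. x s \<omega>)"
    using c unfolding continuous_process_def by eventually_elim (auto elim: continuous_on_subset)
  have "\<exists>n. off_small \<eta> (\<lambda>\<omega>. \<forall>q\<in>?Q. \<bar>x q \<omega>\<bar> \<le> real n)"
  proof (rule off_small_eventually[OF _ _ \<open>0 < \<eta>\<close>])
    show "AE \<omega> in M. eventually (\<lambda>n. \<forall>q\<in>?Q. \<bar>x q \<omega>\<bar> \<le> real n) sequentially"
      using cont
    proof eventually_elim
      case (elim \<omega>)
      then have "bounded ((\<lambda>s. x s \<omega>) ` {0..t})"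
        by (intro compact_imp_bounded compact_continuous_image) auto
      then obtain B where "\<forall>y\<in>(\<lambda>s. x s \<omega>) ` {0..t}. norm y \<le> B"
        unfolding bounded_iff by blast
      then have B: "\<bar>x s \<omega>\<bar> \<le> B" if "s \<in> {0..t}" for s
        using that by simp
      show ?case
        unfolding eventually_sequentially
      proof (intro exI[of _ "nat \<lceil>B\<rceil>"] allI impI ballI)
        fix n q assume "nat \<lceil>B\<rceil> \<le> n" "q \<in> ?Q"
        moreover from this have "\<bar>x q \<omega>\<bar> \<le> B" using \<open>0 \<le> t\<close> by (intro B) auto
        ultimately show "\<bar>x q \<omega>\<bar> \<le> real n" by linarith
      qed
    qed
    fix n
    show "{\<omega> \<in> space M. \<forall>q\<in>?Q. \<bar>x q \<omega>\<bar> \<le> real n} \<in> sets M"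
    proof (rule sets.sets_Collect_countable_All'[OF _ countable_rational_interval])
      fix q assume "q \<in> ?Q"
      then have [measurable]: "x q \<in> borel_measurable M" using \<open>0 \<le> t\<close> by (intro m) auto
      show "{\<omega> \<in> space M. \<bar>x q \<omega>\<bar> \<le> real n} \<in> sets M" by measurable
    qed
  qed
  then obtain n where "off_small \<eta> (\<lambda>\<omega>. \<forall>q\<in>?Q. \<bar>x q \<omega>\<bar> \<le> real n)" ..
  \<comment> \<open>The natural number \<open>n\<close> may be 0; adding 1 makes the bound
    positive.\<close>
  from off_small_conj_AE[OF cont this]
  have "off_small \<eta> (\<lambda>\<omega>. \<forall>s\<in>{0..t}. \<bar>x s \<omega>\<bar> \<le> real n + 1)"
  proof (rule off_small_mono[OF _ order_refl], elim conjE, intro ballI)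
    fix \<omega> s assume "continuous_on {0..t} (\<lambda>s. x s \<omega>)" "\<forall>q\<in>?Q. \<bar>x q \<omega>\<bar> \<le> real n" "s \<in> {0..t}"
    then have "\<bar>x s \<omega>\<bar> \<le> real n" using bound_from_rationals[of t "\<lambda>s. x s \<omega>" "real n" s] by blast
    then show "\<bar>x s \<omega>\<bar> \<le> real n + 1" by simp
  qed
  then show ?thesis by (intro exI[of _ "real n + 1"]) auto
qed

lemma off_small_osc:
  fixes x :: "real \<Rightarrow> 'a \<Rightarrow> real"
  assumes c: "continuous_process M x" and m: "\<And>s. 0 \<le> s \<Longrightarrow> x s \<in> borel_measurable M"
    and "0 \<le> t" "0 < \<eta>" "0 < \<epsilon>"
  shows "\<exists>k. off_small \<eta> (\<lambda>\<omega>. \<forall>s\<in>{0..t}. \<forall>u\<in>{0..t}. \<bar>s - u\<bar> \<le> t / 2 ^ k \<longrightarrow> \<bar>x s \<omega> - x u \<omega>\<bar> \<le> \<epsilon>)"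
proof -
  let ?Q = "insert t ({0..t} \<inter> \<rat>)"
  \<comment> \<open>With \<open>t + 1\<close> in place of \<open>t\<close>, the condition
    \<open>\<bar>s - u\<bar> \<le> t / 2 ^ n\<close> of the conclusion implies the strict one that
    \<open>osc_from_rationals\<close> needs, also when \<open>t = 0\<close>.\<close>
  let ?d = "\<lambda>n. (t + 1) / 2 ^ n"
  have cont: "AE \<omega> in M. continuous_on {0..t} (\<lambda>s. x s \<omega>)"
    using c unfolding continuous_process_def by eventually_elim (auto elim: continuous_on_subset)
  have "\<exists>n. off_small \<eta> (\<lambda>\<omega>. \<forall>q\<in>?Q. \<forall>r\<in>?Q. \<bar>q - r\<bar> < ?d n \<longrightarrow> \<bar>x q \<omega> - x r \<omega>\<bar> \<le> \<epsilon>)"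
  proof (rule off_small_eventually[OF _ _ \<open>0 < \<eta>\<close>])
    show "AE \<omega> in M. eventually (\<lambda>n. \<forall>q\<in>?Q. \<forall>r\<in>?Q. \<bar>q - r\<bar> < ?d n \<longrightarrow> \<bar>x q \<omega> - x r \<omega>\<bar> \<le> \<epsilon>) sequentially"
      using cont
    proof eventually_elim
      case (elim \<omega>)
      then have "uniformly_continuous_on {0..t} (\<lambda>s. x s \<omega>)"
        by (intro compact_uniformly_continuous) auto
      then obtain d where "0 < d" and d: "\<And>s u. s \<in> {0..t} \<Longrightarrow> u \<in> {0..t} \<Longrightarrow> \<bar>s - u\<bar> < d \<Longrightarrow> \<bar>x s \<omega> - x u \<omega>\<bar> < \<epsilon>"
        unfolding uniformly_continuous_on_def dist_real_def using \<open>0 < \<epsilon>\<close> by meson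
      have "(\<lambda>n. (t + 1) * (1 / 2) ^ n) \<longlonglongrightarrow> (t + 1) * 0"
        by (intro tendsto_mult_left LIMSEQ_power_zero) auto
      then have "(\<lambda>n. ?d n) \<longlonglongrightarrow> 0" by (simp add: power_divide)
      then have "eventually (\<lambda>n. ?d n < d) sequentially"
        using \<open>0 < d\<close> by (auto dest: order_tendstoD(2))
      then show ?case
      proof eventually_elim
        case (elim n)
        show ?case
        proof (intro ballI impI)
          fix q r assume "q \<in> ?Q" "r \<in> ?Q" "\<bar>q - r\<bar> < ?d n"
          then have "\<bar>x q \<omega> - x r \<omega>\<bar> < \<epsilon>" using elim \<open>0 \<le> t\<close> by (intro d) auto
          then show "\<bar>x q \<omega> - x r \<omega>\<bar> \<le> \<epsilon>" by simp
        qed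
      qed
    qed
    fix n
    show "{\<omega> \<in> space M. \<forall>q\<in>?Q. \<forall>r\<in>?Q. \<bar>q - r\<bar> < ?d n \<longrightarrow> \<bar>x q \<omega> - x r \<omega>\<bar> \<le> \<epsilon>} \<in> sets M"
    proof (intro sets.sets_Collect_countable_All'[OF _ countable_rational_interval])
      fix q r assume "q \<in> ?Q" "r \<in> ?Q"
      then have [measurable]: "x q \<in> borel_measurable M" "x r \<in> borel_measurable M"
        using \<open>0 \<le> t\<close> by (auto intro: m)
      show "{\<omega> \<in> space M. \<bar>q - r\<bar> < ?d n \<longrightarrow> \<bar>x q \<omega> - x r \<omega>\<bar> \<le> \<epsilon>} \<in> sets M" by measurable
    qed
  qed
  then obtain n where "off_small \<eta> (\<lambda>\<omega>. \<forall>q\<in>?Q. \<forall>r\<in>?Q. \<bar>q - r\<bar> < ?d n \<longrightarrow> \<bar>x q \<omega> - x r \<omega>\<bar> \<le> \<epsilon>)" ..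
  from off_small_conj_AE[OF cont this]
  have "off_small \<eta> (\<lambda>\<omega>. \<forall>s\<in>{0..t}. \<forall>u\<in>{0..t}. \<bar>s - u\<bar> \<le> t / 2 ^ n \<longrightarrow> \<bar>x s \<omega> - x u \<omega>\<bar> \<le> \<epsilon>)"
  proof (rule off_small_mono[OF _ order_refl], elim conjE, intro ballI impI)
    fix \<omega> s u assume *: "continuous_on {0..t} (\<lambda>s. x s \<omega>)"
        "\<forall>q\<in>?Q. \<forall>r\<in>?Q. \<bar>q - r\<bar> < ?d n \<longrightarrow> \<bar>x q \<omega> - x r \<omega>\<bar> \<le> \<epsilon>" "s \<in> {0..t}" "u \<in> {0..t}"
        "\<bar>s - u\<bar> \<le> t / 2 ^ n"
    have "t / 2 ^ n < ?d n" by (simp add: divide_strict_right_mono)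
    then have "\<bar>s - u\<bar> < ?d n" using *(5) by linarith
    then show "\<bar>x s \<omega> - x u \<omega>\<bar> \<le> \<epsilon>"
      using osc_from_rationals[of t "\<lambda>s. x s \<omega>" "?d n" \<epsilon> s u] * by blast
  qed
  then show ?thesis by blast
qed

end

section \<open>Tightness of the quadratic variation\<close>

context prob_space begin

text \<open>Boundedness in probability of the dyadic sums of squares: \<open>B\<close> is chosen
  before the level \<open>n\<close>. Convergence to a quadratic variation is not part of it.\<close>

definition qv_tight :: "real \<Rightarrow> (real \<Rightarrow> 'a \<Rightarrow> real) \<Rightarrow> bool" where
  "qv_tight t x \<longleftrightarrow> (\<forall>\<eta>>0. \<exists>B>0. \<forall>n. off_small \<eta>
     (\<lambda>\<omega>. (\<Sum>j<2 ^ n. (x (grid t n (Suc j)) \<omega> - x (grid t n j) \<omega>)\<^sup>2) \<le> B))"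

lemma qv_tightI_weak:
  assumes "\<And>\<eta>. 0 < \<eta> \<Longrightarrow> \<exists>B. \<forall>n. off_small \<eta>
     (\<lambda>\<omega>. (\<Sum>j<2 ^ n. (x (grid t n (Suc j)) \<omega> - x (grid t n j) \<omega>)\<^sup>2) \<le> B)"
  shows "qv_tight t x"
  unfolding qv_tight_def
proof (intro allI impI)
  fix \<eta> :: real assume "0 < \<eta>"
  then obtain B where B: "\<And>n. off_small \<eta>
     (\<lambda>\<omega>. (\<Sum>j<2 ^ n. (x (grid t n (Suc j)) \<omega> - x (grid t n j) \<omega>)\<^sup>2) \<le> B)"
    using assms by meson
  show "\<exists>B>0. \<forall>n. off_small \<eta>
     (\<lambda>\<omega>. (\<Sum>j<2 ^ n. (x (grid t n (Suc j)) \<omega> - x (grid t n j) \<omega>)\<^sup>2) \<le> B)"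
  proof (intro exI[of _ "max B 1"] conjI allI)
    fix n show "off_small \<eta> (\<lambda>\<omega>. (\<Sum>j<2 ^ n. (x (grid t n (Suc j)) \<omega> - x (grid t n j) \<omega>)\<^sup>2) \<le> max B 1)"
      by (rule off_small_mono[OF B[of n] order_refl]) auto
  qed simp
qed

lemma qv_tight_add:
  assumes "qv_tight t x" "qv_tight t y"
  shows "qv_tight t (\<lambda>s \<omega>. x s \<omega> + y s \<omega>)"
proof (rule qv_tightI_weak)
  fix \<eta> :: real assume "0 < \<eta>"
  obtain B where B: "\<And>n. off_small (\<eta>/2)
     (\<lambda>\<omega>. (\<Sum>j<2 ^ n. (x (grid t n (Suc j)) \<omega> - x (grid t n j) \<omega>)\<^sup>2) \<le> B)"
    using assms(1) \<open>0 < \<eta>\<close> unfolding qv_tight_def by (meson half_gt_zero)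
  obtain C where C: "\<And>n. off_small (\<eta>/2)
     (\<lambda>\<omega>. (\<Sum>j<2 ^ n. (y (grid t n (Suc j)) \<omega> - y (grid t n j) \<omega>)\<^sup>2) \<le> C)"
    using assms(2) \<open>0 < \<eta>\<close> unfolding qv_tight_def by (meson half_gt_zero)
  show "\<exists>B. \<forall>n. off_small \<eta> (\<lambda>\<omega>. (\<Sum>j<2 ^ n. (x (grid t n (Suc j)) \<omega> + y (grid t n (Suc j)) \<omega>
      - (x (grid t n j) \<omega> + y (grid t n j) \<omega>))\<^sup>2) \<le> B)"
  proof (intro exI[of _ "2 * B + 2 * C"] allI, rule off_small_mono[OF off_small_conj[OF B C]])
    fix n \<omega>
    let ?dx = "\<lambda>j. x (grid t n (Suc j)) \<omega> - x (grid t n j) \<omega>"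
    let ?dy = "\<lambda>j. y (grid t n (Suc j)) \<omega> - y (grid t n j) \<omega>"
    assume *: "(\<Sum>j<2 ^ n. (?dx j)\<^sup>2) \<le> B \<and> (\<Sum>j<2 ^ n. (?dy j)\<^sup>2) \<le> C"
    have "(a + b)\<^sup>2 \<le> 2 * a\<^sup>2 + 2 * b\<^sup>2" for a b :: real
      using sum_squares_bound[of a b] by (simp add: power2_sum)
    then have "(\<Sum>j<2 ^ n. (?dx j + ?dy j)\<^sup>2) \<le> (\<Sum>j<2 ^ n. 2 * (?dx j)\<^sup>2 + 2 * (?dy j)\<^sup>2)"
      by (intro sum_mono)
    also have "\<dots> = 2 * (\<Sum>j<2 ^ n. (?dx j)\<^sup>2) + 2 * (\<Sum>j<2 ^ n. (?dy j)\<^sup>2)"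
      by (simp add: sum.distrib sum_distrib_left)
    also have "\<dots> \<le> 2 * B + 2 * C" using * by linarith
    finally show "(\<Sum>j<2 ^ n. (x (grid t n (Suc j)) \<omega> + y (grid t n (Suc j)) \<omega>
      - (x (grid t n j) \<omega> + y (grid t n j) \<omega>))\<^sup>2) \<le> 2 * B + 2 * C"
      by (simp add: algebra_simps)
  qed (use \<open>0 < \<eta>\<close> in auto)
qed

lemma qv_tight_scale:
  assumes "qv_tight t x"
  shows "qv_tight t (\<lambda>s \<omega>. c * x s \<omega>)"
proof (rule qv_tightI_weak)
  fix \<eta> :: real assume "0 < \<eta>"
  then obtain B where B: "\<And>n. off_small \<eta>
     (\<lambda>\<omega>. (\<Sum>j<2 ^ n. (x (grid t n (Suc j)) \<omega> - x (grid t n j) \<omega>)\<^sup>2) \<le> B)"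
    using assms(1) unfolding qv_tight_def by meson
  show "\<exists>B. \<forall>n. off_small \<eta> (\<lambda>\<omega>. (\<Sum>j<2 ^ n. (c * x (grid t n (Suc j)) \<omega> - c * x (grid t n j) \<omega>)\<^sup>2) \<le> B)"
  proof (intro exI[of _ "c\<^sup>2 * B"] allI, rule off_small_mono[OF B order_refl])
    fix n \<omega>
    assume "(\<Sum>j<2 ^ n. (x (grid t n (Suc j)) \<omega> - x (grid t n j) \<omega>)\<^sup>2) \<le> B"
    then have "c\<^sup>2 * (\<Sum>j<2 ^ n. (x (grid t n (Suc j)) \<omega> - x (grid t n j) \<omega>)\<^sup>2) \<le> c\<^sup>2 * B"
      by (rule mult_left_mono) simp
    then show "(\<Sum>j<2 ^ n. (c * x (grid t n (Suc j)) \<omega> - c * x (grid t n j) \<omega>)\<^sup>2) \<le> c\<^sup>2 * B"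
      by (simp add: sum_distrib_left power_mult_distrib flip: right_diff_distrib)
  qed
qed

lemma qv_tight_cong_AE:
  assumes "qv_tight t x" "AE \<omega> in M. \<forall>s\<ge>0. x s \<omega> = y s \<omega>" "0 \<le> t"
  shows "qv_tight t y"
proof (rule qv_tightI_weak)
  fix \<eta> :: real assume "0 < \<eta>"
  then obtain B where B: "\<And>n. off_small \<eta>
     (\<lambda>\<omega>. (\<Sum>j<2 ^ n. (x (grid t n (Suc j)) \<omega> - x (grid t n j) \<omega>)\<^sup>2) \<le> B)"
    using assms(1) unfolding qv_tight_def by meson
  show "\<exists>B. \<forall>n. off_small \<eta> (\<lambda>\<omega>. (\<Sum>j<2 ^ n. (y (grid t n (Suc j)) \<omega> - y (grid t n j) \<omega>)\<^sup>2) \<le> B)"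
  proof (intro exI[of _ B] allI)
    fix n show "off_small \<eta> (\<lambda>\<omega>. (\<Sum>j<2 ^ n. (y (grid t n (Suc j)) \<omega> - y (grid t n j) \<omega>)\<^sup>2) \<le> B)"
      by (rule off_small_mono[OF off_small_conj_AE[OF assms(2) B[of n]] order_refl])
        (use assms(3) in \<open>auto simp: grid_nonneg\<close>)
  qed
qed

lemma integrable_bounded_mult:
  fixes X :: "'a \<Rightarrow> real"
  assumes "integrable M X" "f \<in> borel_measurable M" "\<And>\<omega>. \<bar>f \<omega>\<bar> \<le> b"
  shows "integrable M (\<lambda>\<omega>. f \<omega> * X \<omega>)"
proof (rule Bochner_Integration.integrable_bound[OF integrable_mult_right[OF assms(1), of b]])
  show "(\<lambda>\<omega>. f \<omega> * X \<omega>) \<in> borel_measurable M" using assms by measurable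
  have "0 \<le> b" using assms(3) abs_ge_zero order_trans by blast
  then show "AE \<omega> in M. norm (f \<omega> * X \<omega>) \<le> norm (b * X \<omega>)"
    using assms(3) by (auto simp: abs_mult intro!: mult_right_mono)
qed

text \<open>
  The Huber function is convex, and quadratic near 0. So its increments dominate the squared increments
  of a martingale until it becomes large, while its expectation is bounded by the first moment.
  No stopping of the discretized process is needed.
\<close>

lemma off_small_Huber:
  assumes int: "\<And>j. j \<le> n \<Longrightarrow> integrable M (x j)" and "0 < l"
    and mart: "\<And>j. j < n \<Longrightarrow> expectation (\<lambda>\<omega>. truncate l (x j \<omega>) * (x (Suc j) \<omega> - x j \<omega>)) = 0"
    and "0 < a" "2 * l * expectation (\<lambda>\<omega>. \<bar>x n \<omega>\<bar>) \<le> a * \<eta>"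
  shows "off_small \<eta> (\<lambda>\<omega>. (\<Sum>j<n. if \<bar>x j \<omega>\<bar> \<le> l \<and> \<bar>x (Suc j) \<omega>\<bar> \<le> l then (x (Suc j) \<omega> - x j \<omega>)\<^sup>2 else 0) \<le> a)"
proof -
  have hub_int: "integrable M (\<lambda>\<omega>. huber l (x j \<omega>))" if "j \<le> n" for j
  proof (rule Bochner_Integration.integrable_bound[OF integrable_mult_right[OF int[OF that], of "2 * l"]])
    have [measurable]: "x j \<in> borel_measurable M" using int[OF that] by simp
    show "(\<lambda>\<omega>. huber l (x j \<omega>)) \<in> borel_measurable M" by measurable
    show "AE \<omega> in M. norm (huber l (x j \<omega>)) \<le> norm (2 * l * x j \<omega>)"
      using huber_nonneg[of l] huber_le[of l] \<open>0 < l\<close> by (auto simp: abs_mult)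
  qed
  have cl_int: "integrable M (\<lambda>\<omega>. truncate l (x j \<omega>) * (x (Suc j) \<omega> - x j \<omega>))" if "j < n" for j
  proof (rule integrable_bounded_mult)
    have "x j \<in> borel_measurable M" using int[of j] that by simp
    then show "(\<lambda>\<omega>. truncate l (x j \<omega>)) \<in> borel_measurable M" by measurable
  qed (use that int \<open>0 < l\<close> in \<open>auto intro: abs_truncate\<close>)
  \<comment> \<open>The convexity gap of the Huber function. Its cross term has mean 0, so the
    expectations of the gaps telescope to the two end values, of which the initial one has a
    favourable sign.\<close>
  define R where "R j \<omega> = huber l (x (Suc j) \<omega>) - huber l (x j \<omega>) - 2 * (truncate l (x j \<omega>) * (x (Suc j) \<omega> - x j \<omega>))"
    for j \<omega>
  have R_int: "integrable M (R j)" if "j < n" for j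
    unfolding R_def using that hub_int cl_int
    by (intro Bochner_Integration.integrable_diff integrable_mult_right) auto
  have R_exp: "expectation (R j) = expectation (\<lambda>\<omega>. huber l (x (Suc j) \<omega>)) - expectation (\<lambda>\<omega>. huber l (x j \<omega>))"
    if "j < n" for j
    unfolding R_def using that hub_int[of j] hub_int[of "Suc j"] cl_int[OF that] mart[OF that] by simp
  have R_ge: "(if \<bar>x j \<omega>\<bar> \<le> l \<and> \<bar>x (Suc j) \<omega>\<bar> \<le> l then (x (Suc j) \<omega> - x j \<omega>)\<^sup>2 else 0) \<le> R j \<omega>" for j \<omega>
    unfolding R_def using huber_increment[of l] \<open>0 < l\<close> by (simp only: less_imp_le)
  then have R_nonneg: "0 \<le> R j \<omega>" for j \<omega>
    by (rule order_trans[rotated]) auto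
  have "off_small \<eta> (\<lambda>\<omega>. (\<Sum>j<n. R j \<omega>) \<le> a)"
  proof (rule off_small_Markov[OF _ _ \<open>0 < a\<close>])
    show "integrable M (\<lambda>\<omega>. \<Sum>j<n. R j \<omega>)" by (intro Bochner_Integration.integrable_sum R_int) auto
    have "expectation (\<lambda>\<omega>. \<Sum>j<n. R j \<omega>) = (\<Sum>j<n. expectation (R j))"
      by (intro Bochner_Integration.integral_sum R_int) auto
    also have "\<dots> = (\<Sum>j<n. expectation (\<lambda>\<omega>. huber l (x (Suc j) \<omega>)) - expectation (\<lambda>\<omega>. huber l (x j \<omega>)))"
      by (intro sum.cong R_exp) auto
    also have "\<dots> = expectation (\<lambda>\<omega>. huber l (x n \<omega>)) - expectation (\<lambda>\<omega>. huber l (x 0 \<omega>))"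
      by (rule sum_lessThan_telescope)
    also have "\<dots> \<le> expectation (\<lambda>\<omega>. huber l (x n \<omega>))"
      using huber_nonneg[of l] \<open>0 < l\<close> by simp
    also have "\<dots> \<le> expectation (\<lambda>\<omega>. 2 * l * \<bar>x n \<omega>\<bar>)"
      using hub_int int huber_le[of l] \<open>0 < l\<close> by (intro integral_mono) auto
    finally show "expectation (\<lambda>\<omega>. \<Sum>j<n. R j \<omega>) \<le> a * \<eta>" using assms(5) by simp
  qed (simp add: sum_nonneg R_nonneg)
  then show ?thesis
    by (rule off_small_mono[OF _ order_refl]) (meson R_ge order_trans sum_mono)
qed

end

section \<open>Quadratic variation of martingales and semimartingales\<close>

locale filtered_space = prob_space M for M :: "'a measure" +
  fixes F :: "real \<Rightarrow> 'a measure"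
  assumes filtered: "filtered_prob_space M F"
begin

lemma subalgebra_F: "subalgebra M (F t)"
  using filtered by (simp add: filtered_prob_space_def)

lemma measurable_F_mono: "f \<in> borel_measurable (F s) \<Longrightarrow> s \<le> t \<Longrightarrow> f \<in> borel_measurable (F t)"
proof (rule measurable_from_subalg)
  assume "s \<le> t"
  interpret filtration "space M" F using filtered by (simp add: filtered_prob_space_def)
  show "subalgebra (F t) (F s)"
    using sets_F_mono[OF \<open>s \<le> t\<close>] space_F by (simp add: subalgebra_def)
qed

lemma measurable_F_M: "f \<in> borel_measurable (F s) \<Longrightarrow> f \<in> borel_measurable M"
  using measurable_from_subalg[OF subalgebra_F] .

lemma adapted_measurable: "adapted F x \<Longrightarrow> 0 \<le> s \<Longrightarrow> x s \<in> borel_measurable M"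
  by (auto simp: adapted_def intro: measurable_F_M)

text \<open>Conditioning on \<open>F s\<close> replaces \<open>X t\<close> by \<open>X s\<close>
  under the known factor \<open>f\<close>; boundedness of \<open>f\<close> makes the products
  integrable.\<close>

lemma martingale_increment:
  assumes "martingale M F X" "0 \<le> s" "s \<le> t" "f \<in> borel_measurable (F s)" "\<And>\<omega>. \<bar>f \<omega>\<bar> \<le> b"
  shows "expectation (\<lambda>\<omega>. f \<omega> * (X t \<omega> - X s \<omega>)) = 0"
proof -
  interpret S: sigma_finite_subalgebra M "F s"
    using subalgebra_F by (intro finite_measure_subalgebra_is_sigma_finite finite_measure_subalgebra.intro
      finite_measure_subalgebra_axioms.intro) unfold_locales
  have int: "integrable M (X t)" "integrable M (X s)" and ce: "AE \<omega> in M. real_cond_exp M (F s) (X t) \<omega> = X s \<omega>"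
    using assms(1,2,3) by (auto simp: martingale_def)
  have fm: "f \<in> borel_measurable M" using assms(4) by (rule measurable_F_M)
  have i: "integrable M (\<lambda>\<omega>. f \<omega> * X t \<omega>)" "integrable M (\<lambda>\<omega>. f \<omega> * X s \<omega>)"
    using int assms(5) fm by (auto intro: integrable_bounded_mult)
  have "expectation (\<lambda>\<omega>. f \<omega> * X t \<omega>) = expectation (\<lambda>\<omega>. f \<omega> * real_cond_exp M (F s) (X t) \<omega>)"
    by (rule S.real_cond_exp_intg(2)[symmetric, OF i(1) assms(4)]) (use int in simp)
  also have "\<dots> = expectation (\<lambda>\<omega>. f \<omega> * X s \<omega>)"
    by (rule integral_cong_AE) (use ce fm int in auto)
  finally show ?thesis
    using i by (simp add: right_diff_distrib)
qed

text \<open>The Huber bound involves only the first moment of the last grid value, which is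
  \<open>X t\<close> at every level; hence \<open>a\<close> serves all \<open>n\<close>. On paths
  that stay within \<open>l\<close>, no summand is discarded.\<close>

lemma martingale_off_small_qv:
  assumes X: "martingale M F X" and "0 \<le> t" "0 < l" "0 < \<eta>"
  shows "\<exists>a. \<forall>n. off_small \<eta> (\<lambda>\<omega>. (\<forall>s\<in>{0..t}. \<bar>X s \<omega>\<bar> \<le> l) \<longrightarrow>
    (\<Sum>j<2 ^ n. (X (grid t n (Suc j)) \<omega> - X (grid t n j) \<omega>)\<^sup>2) \<le> a)"
proof -
  \<comment> \<open>What Markov's inequality requires in view of
    \<open>huber l x \<le> 2 * l * \<bar>x\<bar>\<close>; the summand 1 ensures positivity.\<close>
  define a where "a = 2 * l * expectation (\<lambda>\<omega>. \<bar>X t \<omega>\<bar>) / \<eta> + 1"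
  have "0 < a" unfolding a_def using \<open>0 < l\<close> \<open>0 < \<eta>\<close>
    by (intro add_nonneg_pos divide_nonneg_pos mult_nonneg_nonneg integral_nonneg_AE) auto
  have a: "2 * l * expectation (\<lambda>\<omega>. \<bar>X t \<omega>\<bar>) \<le> a * \<eta>"
    unfolding a_def using \<open>0 < \<eta>\<close> by (simp add: field_simps)
  show ?thesis
  proof (intro exI[of _ a] allI)
    fix n
    let ?x = "\<lambda>j. X (grid t n j)"
    have "off_small \<eta> (\<lambda>\<omega>. (\<Sum>j<2 ^ n. if \<bar>?x j \<omega>\<bar> \<le> l \<and> \<bar>?x (Suc j) \<omega>\<bar> \<le> l then (?x (Suc j) \<omega> - ?x j \<omega>)\<^sup>2 else 0) \<le> a)"
    proof (rule off_small_Huber[OF _ \<open>0 < l\<close> _ \<open>0 < a\<close>])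
      fix j
      have g: "0 \<le> grid t n j" "grid t n j \<le> grid t n (Suc j)"
        using \<open>0 \<le> t\<close> by (auto intro: grid_nonneg grid_mono)
      show "integrable M (?x j)" using X g by (auto simp: martingale_def)
      have "?x j \<in> borel_measurable (F (grid t n j))" using X g by (auto simp: martingale_def adapted_def)
      then show "expectation (\<lambda>\<omega>. truncate l (?x j \<omega>) * (?x (Suc j) \<omega> - ?x j \<omega>)) = 0"
        using \<open>0 < l\<close> by (intro martingale_increment[OF X g, where b=l]) (auto intro: abs_truncate)
    qed (use a in simp)
    then show "off_small \<eta> (\<lambda>\<omega>. (\<forall>s\<in>{0..t}. \<bar>X s \<omega>\<bar> \<le> l) \<longrightarrow>
      (\<Sum>j<2 ^ n. (?x (Suc j) \<omega> - ?x j \<omega>)\<^sup>2) \<le> a)"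
    proof (rule off_small_mono[OF _ order_refl], intro impI)
      fix \<omega> assume *: "(\<Sum>j<2 ^ n. if \<bar>?x j \<omega>\<bar> \<le> l \<and> \<bar>?x (Suc j) \<omega>\<bar> \<le> l then (?x (Suc j) \<omega> - ?x j \<omega>)\<^sup>2 else 0) \<le> a"
        "\<forall>s\<in>{0..t}. \<bar>X s \<omega>\<bar> \<le> l"
      have "\<bar>?x j \<omega>\<bar> \<le> l" if "j \<le> 2 ^ n" for j
        using *(2) grid_in[OF \<open>0 \<le> t\<close> that] by blast
      then have "(\<Sum>j<2 ^ n. if \<bar>?x j \<omega>\<bar> \<le> l \<and> \<bar>?x (Suc j) \<omega>\<bar> \<le> l then (?x (Suc j) \<omega> - ?x j \<omega>)\<^sup>2 else 0)
          = (\<Sum>j<2 ^ n. (?x (Suc j) \<omega> - ?x j \<omega>)\<^sup>2)"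
        by (intro sum.cong) auto
      with *(1) show "(\<Sum>j<2 ^ n. (?x (Suc j) \<omega> - ?x j \<omega>)\<^sup>2) \<le> a" by simp
    qed
  qed
qed

text \<open>Three exceptional sets of probability \<open>\<eta> / 3\<close>: outside them a
  localizing time exceeds \<open>t\<close>, the path of \<open>L\<close> is bounded by
  \<open>b\<close>, and the martingale bound holds. Then the stopped process equals
  \<open>L - L 0\<close> on the whole interval, so it is bounded by \<open>2 * b\<close> and has the
  same increments.\<close>

lemma local_martingale_qv_tight:
  assumes L: "continuous_local_martingale M F L" and "0 \<le> t"
  shows "qv_tight t L"
proof (rule qv_tightI_weak)
  fix \<eta> :: real assume "0 < \<eta>"
  have ad: "adapted F L" and cont: "continuous_process M L"
    using L by (auto simp: continuous_local_martingale_def)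
  obtain \<tau> :: "nat \<Rightarrow> 'a \<Rightarrow> real" where
      st: "\<And>n. stopping_time F (\<tau> n)" and mart: "\<And>n. martingale M F (\<lambda>t \<omega>. L (min t (\<tau> n \<omega>)) \<omega> - L 0 \<omega>)"
      and lim: "AE \<omega> in M. incseq (\<lambda>n. \<tau> n \<omega>) \<and> filterlim (\<lambda>n. \<tau> n \<omega>) at_top sequentially"
    using L unfolding continuous_local_martingale_def by auto
  have "\<exists>n. off_small (\<eta>/3) (\<lambda>\<omega>. t < \<tau> n \<omega>)"
  proof (rule off_small_eventually)
    show "AE \<omega> in M. eventually (\<lambda>n. t < \<tau> n \<omega>) sequentially"
      using lim by eventually_elim (auto simp: filterlim_at_top_dense)
    fix n
    have "Measurable.pred (F t) (\<lambda>\<omega>. \<tau> n \<omega> \<le> t)" using st[of n] by (simp add: stopping_time_def)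
    then have [measurable]: "Measurable.pred M (\<lambda>\<omega>. \<tau> n \<omega> \<le> t)"
      by (rule measurable_from_subalg[OF subalgebra_F])
    have "{\<omega> \<in> space M. \<not> \<tau> n \<omega> \<le> t} \<in> sets M" by measurable
    then show "{\<omega> \<in> space M. t < \<tau> n \<omega>} \<in> sets M" by (simp add: not_le)
  qed (use \<open>0 < \<eta>\<close> in simp)
  then obtain n where n: "off_small (\<eta>/3) (\<lambda>\<omega>. t < \<tau> n \<omega>)" ..
  obtain b where b: "0 < b" "off_small (\<eta>/3) (\<lambda>\<omega>. \<forall>s\<in>{0..t}. \<bar>L s \<omega>\<bar> \<le> b)"
    using off_small_bounded[OF cont adapted_measurable[OF ad] \<open>0 \<le> t\<close>, of "\<eta>/3"] \<open>0 < \<eta>\<close> by auto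
  define X where "X s \<omega> = L (min s (\<tau> n \<omega>)) \<omega> - L 0 \<omega>" for s \<omega>
  obtain a where a: "\<And>m. off_small (\<eta>/3) (\<lambda>\<omega>. (\<forall>s\<in>{0..t}. \<bar>X s \<omega>\<bar> \<le> 2 * b) \<longrightarrow>
      (\<Sum>j<2 ^ m. (X (grid t m (Suc j)) \<omega> - X (grid t m j) \<omega>)\<^sup>2) \<le> a)"
    using martingale_off_small_qv[OF mart[of n] \<open>0 \<le> t\<close>, of "2 * b" "\<eta>/3"] \<open>0 < \<eta>\<close> \<open>0 < b\<close>
    unfolding X_def by auto
  show "\<exists>a. \<forall>m. off_small \<eta> (\<lambda>\<omega>. (\<Sum>j<2 ^ m. (L (grid t m (Suc j)) \<omega> - L (grid t m j) \<omega>)\<^sup>2) \<le> a)"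
  proof (intro exI[of _ a] allI, rule off_small_mono[OF off_small_conj[OF off_small_conj[OF n b(2)] a]])
    fix m \<omega>
    assume *: "(t < \<tau> n \<omega> \<and> (\<forall>s\<in>{0..t}. \<bar>L s \<omega>\<bar> \<le> b)) \<and> ((\<forall>s\<in>{0..t}. \<bar>X s \<omega>\<bar> \<le> 2 * b) \<longrightarrow>
      (\<Sum>j<2 ^ m. (X (grid t m (Suc j)) \<omega> - X (grid t m j) \<omega>)\<^sup>2) \<le> a)"
    have X: "X s \<omega> = L s \<omega> - L 0 \<omega>" if "s \<in> {0..t}" for s
      using * that by (simp add: X_def min_def)
    have "\<bar>X s \<omega>\<bar> \<le> 2 * b" if "s \<in> {0..t}" for s
    proof -
      have "\<bar>L s \<omega>\<bar> \<le> b" "\<bar>L 0 \<omega>\<bar> \<le> b" using * that \<open>0 \<le> t\<close> by auto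
      then show ?thesis unfolding X[OF that] by linarith
    qed
    with * have "(\<Sum>j<2 ^ m. (X (grid t m (Suc j)) \<omega> - X (grid t m j) \<omega>)\<^sup>2) \<le> a" by blast
    also have "(\<Sum>j<2 ^ m. (X (grid t m (Suc j)) \<omega> - X (grid t m j) \<omega>)\<^sup>2)
        = (\<Sum>j<2 ^ m. (L (grid t m (Suc j)) \<omega> - L (grid t m j) \<omega>)\<^sup>2)"
    proof (intro sum.cong refl)
      fix j :: nat assume "j \<in> {..<2 ^ m}"
      then have "grid t m j \<in> {0..t}" "grid t m (Suc j) \<in> {0..t}"
        by (intro grid_in[OF \<open>0 \<le> t\<close>]; simp)+
      then show "(X (grid t m (Suc j)) \<omega> - X (grid t m j) \<omega>)\<^sup>2 = (L (grid t m (Suc j)) \<omega> - L (grid t m j) \<omega>)\<^sup>2"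
        by (simp add: X)
    qed
    finally show "(\<Sum>j<2 ^ m. (L (grid t m (Suc j)) \<omega> - L (grid t m j) \<omega>)\<^sup>2) \<le> a" .
  qed simp
qed

text \<open>A sum of squares is at most the square of the sum of absolute values, hence at most the
  squared variation bound. That bound is random but the same for all levels, so
  \<open>off_small_eventually\<close> applies to all levels at once.\<close>

lemma finite_variation_qv_tight:
  assumes ad: "adapted F A" and fv: "AE \<omega> in M. finite_variation_path (\<lambda>t. A t \<omega>)" and "0 \<le> t"
  shows "qv_tight t A"
proof (rule qv_tightI_weak)
  fix \<eta> :: real assume "0 < \<eta>"
  let ?Q = "\<lambda>n \<omega>. \<Sum>j<2 ^ n. (A (grid t n (Suc j)) \<omega> - A (grid t n j) \<omega>)\<^sup>2"
  have "\<exists>k. off_small \<eta> (\<lambda>\<omega>. \<forall>n. ?Q n \<omega> \<le> real k)"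
  proof (rule off_small_eventually[OF _ _ \<open>0 < \<eta>\<close>])
    show "AE \<omega> in M. eventually (\<lambda>k. \<forall>n. ?Q n \<omega> \<le> real k) sequentially"
      using fv
    proof eventually_elim
      case (elim \<omega>)
      then obtain B where B: "\<And>n p. interval_partition t n p \<Longrightarrow> (\<Sum>i<n. \<bar>A (p (Suc i)) \<omega> - A (p i) \<omega>\<bar>) \<le> B"
        unfolding finite_variation_path_def using \<open>0 \<le> t\<close> by blast
      have Q: "?Q n \<omega> \<le> B\<^sup>2" for n
      proof -
        let ?a = "\<lambda>i. \<bar>A (grid t n (Suc i)) \<omega> - A (grid t n i) \<omega>\<bar>"
        have le: "(\<Sum>i<2 ^ n. ?a i) \<le> B" using B[of "2 ^ n" "grid t n"] partition_grid[OF \<open>0 \<le> t\<close>, of n "2 ^ n"] by simp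
        have "?Q n \<omega> = (\<Sum>i<2 ^ n. ?a i * ?a i)" by (simp add: power2_eq_square flip: abs_mult)
        also have "\<dots> \<le> (\<Sum>i<2 ^ n. ?a i * (\<Sum>i<2 ^ n. ?a i))"
          by (intro sum_mono mult_left_mono) (auto intro: member_le_sum)
        also have "\<dots> = (\<Sum>i<2 ^ n. ?a i)\<^sup>2"
          by (simp add: power2_eq_square flip: sum_distrib_right)
        also have "\<dots> \<le> B\<^sup>2" using le by (intro power_mono sum_nonneg) auto
        finally show ?thesis .
      qed
      show ?case
        unfolding eventually_sequentially
      proof (intro exI[of _ "nat \<lceil>B\<^sup>2\<rceil>"] allI impI)
        fix k n assume "nat \<lceil>B\<^sup>2\<rceil> \<le> k"
        then have "B\<^sup>2 \<le> real k" by linarith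
        then show "?Q n \<omega> \<le> real k" using Q[of n] by linarith
      qed
    qed
    fix k
    have [measurable]: "A (grid t n j) \<in> borel_measurable M" for n j
      by (intro adapted_measurable[OF ad] grid_nonneg \<open>0 \<le> t\<close>)
    show "{\<omega> \<in> space M. \<forall>n. ?Q n \<omega> \<le> real k} \<in> sets M" by measurable
  qed
  then obtain k where "off_small \<eta> (\<lambda>\<omega>. \<forall>n. ?Q n \<omega> \<le> real k)" ..
  then show "\<exists>B. \<forall>n. off_small \<eta> (\<lambda>\<omega>. ?Q n \<omega> \<le> B)"
    by (intro exI[of _ "real k"] allI) (erule off_small_mono, auto)
qed

text \<open>What the later arguments extract from a continuous semimartingale, in a form that is
  visibly stable under the linear combinations making up a cross product with a constant
  vector.\<close>

definition tame :: "(real \<Rightarrow> 'a \<Rightarrow> real) \<Rightarrow> bool" where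
  "tame x \<longleftrightarrow> adapted F x \<and> continuous_process M x \<and> (\<forall>t\<ge>0. qv_tight t x)"

lemma tame_semimartingale: "continuous_semimartingale M F x \<Longrightarrow> tame x"
proof -
  assume x: "continuous_semimartingale M F x"
  then obtain L A where L: "continuous_local_martingale M F L" and A: "adapted F A"
     "AE \<omega> in M. finite_variation_path (\<lambda>t. A t \<omega>)" and eq: "AE \<omega> in M. \<forall>t\<ge>0. x t \<omega> = L t \<omega> + A t \<omega>"
    unfolding continuous_semimartingale_def by auto
  have "qv_tight t x" if "0 \<le> t" for t
  proof (rule qv_tight_cong_AE[OF _ _ that])
    show "qv_tight t (\<lambda>s \<omega>. L s \<omega> + A s \<omega>)"
      by (intro qv_tight_add local_martingale_qv_tight[OF L] finite_variation_qv_tight[OF A] that)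
  qed (use eq in auto)
  then show ?thesis using x by (auto simp: tame_def continuous_semimartingale_def)
qed

lemma tame_scale: "tame x \<Longrightarrow> tame (\<lambda>s \<omega>. c * x s \<omega>)"
  unfolding tame_def adapted_def continuous_process_def
  by (auto intro!: qv_tight_scale borel_measurable_times elim!: eventually_mono intro: continuous_intros)

lemma tame_add: "tame x \<Longrightarrow> tame y \<Longrightarrow> tame (\<lambda>s \<omega>. x s \<omega> + y s \<omega>)"
  unfolding tame_def adapted_def continuous_process_def
  by (auto intro!: qv_tight_add borel_measurable_add elim!: eventually_elim2 intro: continuous_on_add)

lemma tame_measurable: "tame x \<Longrightarrow> 0 \<le> s \<Longrightarrow> x s \<in> borel_measurable M"
  by (simp add: tame_def adapted_measurable)

end

section \<open>Ito sums\<close>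

locale wiener_space = filtered_space M F for M :: "'a measure" and F +
  fixes W :: "real \<Rightarrow> 'a \<Rightarrow> real"
  assumes wiener: "wiener_process M F W"
begin

lemma W_measurable: "0 \<le> s \<Longrightarrow> W s \<in> borel_measurable (F s)"
  using wiener by (simp add: wiener_process_def adapted_def)

lemma W_increment_measurable:
  assumes "0 \<le> s" "s \<le> t"
  shows "(\<lambda>\<omega>. W t \<omega> - W s \<omega>) \<in> borel_measurable (F t)"
  using W_measurable[of t] measurable_F_mono[OF W_measurable[of s]] assms
  by (intro borel_measurable_diff) auto

lemma W_moments:
  assumes "0 \<le> s" "s < t"
  shows "integrable M (\<lambda>\<omega>. W t \<omega> - W s \<omega>)" "expectation (\<lambda>\<omega>. W t \<omega> - W s \<omega>) = 0"
    "integrable M (\<lambda>\<omega>. (W t \<omega> - W s \<omega>)\<^sup>2)" "expectation (\<lambda>\<omega>. (W t \<omega> - W s \<omega>)\<^sup>2) = t - s"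
proof -
  let ?D = "\<lambda>\<omega>. W t \<omega> - W s \<omega>"
  let ?\<sigma> = "sqrt (t - s)"
  have \<sigma>: "0 < ?\<sigma>" using assms by simp
  have d: "distributed M lborel ?D (normal_density 0 ?\<sigma>)"
    using wiener assms by (simp add: wiener_process_def)
  have i: "integrable M (\<lambda>\<omega>. (?D \<omega>) ^ k)" for k
    using distributed_integrable[OF d, of "\<lambda>x. x ^ k"] integrable_normal_moment[OF \<sigma>, of 0 k] by simp
  have e: "expectation (\<lambda>\<omega>. (?D \<omega>) ^ k) = (\<integral>x. normal_density 0 ?\<sigma> x * x ^ k \<partial>lborel)" for k
    using distributed_integral[OF d, of "\<lambda>x. x ^ k"] by simp
  show "integrable M ?D" using i[of 1] by simp
  show "integrable M (\<lambda>\<omega>. (?D \<omega>)\<^sup>2)" by (rule i)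
  show "expectation ?D = 0"
    using e[of 1] integral_normal_moment_odd[OF \<sigma>, of 0 0] by simp
  show "expectation (\<lambda>\<omega>. (?D \<omega>)\<^sup>2) = t - s"
    using e[of 2] integral_normal_moment_even[OF \<sigma>, of 0 1] assms by (simp add: field_simps power2_eq_square)
qed

text \<open>\<open>indep_var\<close> concerns generated sigma-algebras. Both families in the Wiener
  property are stable under intersection, so independence extends to what they generate, and then
  restricts to the events of \<open>f\<close>.\<close>

lemma W_independent:
  assumes "0 \<le> s" "s < t" "f \<in> borel_measurable (F s)"
  shows "indep_var borel f borel (\<lambda>\<omega>. W t \<omega> - W s \<omega>)"
proof -
  let ?D = "\<lambda>\<omega>. W t \<omega> - W s \<omega>"
  let ?B = "{?D -` A \<inter> space M |A. A \<in> sets borel}"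
  have Dm: "?D \<in> borel_measurable M"
    using W_increment_measurable[of s t] assms by (auto intro: measurable_F_M)
  have ind: "indep_set (sets (F s)) ?B" using wiener assms by (simp add: wiener_process_def)
  have "Int_stable ?B"
  proof (rule Int_stableI)
    fix a b assume "a \<in> ?B" "b \<in> ?B"
    then obtain A1 A2 where A: "A1 \<in> sets borel" "A2 \<in> sets borel" "a = ?D -` A1 \<inter> space M" "b = ?D -` A2 \<inter> space M"
      by blast
    then have "a \<inter> b = ?D -` (A1 \<inter> A2) \<inter> space M" "A1 \<inter> A2 \<in> sets borel" by auto
    then show "a \<inter> b \<in> ?B" by blast
  qed
  then have "indep_set (sigma_sets (space M) (sets (F s))) (sigma_sets (space M) ?B)"
    by (intro indep_set_sigma_sets[OF ind] sets.Int_stable)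
  moreover have "sigma_sets (space M) {f -` A \<inter> space M |A. A \<in> sets borel} \<subseteq> sigma_sets (space M) (sets (F s))"
  proof (rule sigma_sets_mono')
    have "space (F s) = space M" using subalgebra_F[of s] by (simp add: subalgebra_def)
    then show "{f -` A \<inter> space M |A. A \<in> sets borel} \<subseteq> sets (F s)"
      using measurable_sets[OF assms(3)] by auto
  qed
  ultimately have "indep_set (sigma_sets (space M) {f -` A \<inter> space M |A. A \<in> sets borel}) (sigma_sets (space M) ?B)"
    unfolding indep_set_def by (elim indep_sets_mono_sets) (auto split: bool.split)
  then show ?thesis
    unfolding indep_var_eq using Dm measurable_F_M[OF assms(3)] by simp
qed

lemma W_product:
  assumes "0 \<le> s" "s < t" "f \<in> borel_measurable (F s)" "integrable M f"
  shows "integrable M (\<lambda>\<omega>. f \<omega> * (W t \<omega> - W s \<omega>))" "expectation (\<lambda>\<omega>. f \<omega> * (W t \<omega> - W s \<omega>)) = 0"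
    "integrable M (\<lambda>\<omega>. f \<omega> * (W t \<omega> - W s \<omega>)\<^sup>2)"
    "expectation (\<lambda>\<omega>. f \<omega> * (W t \<omega> - W s \<omega>)\<^sup>2) = expectation f * (t - s)"
proof -
  note m = W_moments[OF assms(1,2)] and ind = W_independent[OF assms(1-3)]
  show "integrable M (\<lambda>\<omega>. f \<omega> * (W t \<omega> - W s \<omega>))"
    by (rule indep_var_integrable[OF ind assms(4) m(1)])
  show "expectation (\<lambda>\<omega>. f \<omega> * (W t \<omega> - W s \<omega>)) = 0"
    using indep_var_lebesgue_integral[OF ind assms(4) m(1)] m(2) by simp
  have ind2: "indep_var borel f borel (\<lambda>\<omega>. (W t \<omega> - W s \<omega>)\<^sup>2)"
    using indep_var_compose[OF ind, of "\<lambda>x. x" borel "\<lambda>x. x\<^sup>2" borel] by (simp add: comp_def)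
  show "integrable M (\<lambda>\<omega>. f \<omega> * (W t \<omega> - W s \<omega>)\<^sup>2)"
    by (rule indep_var_integrable[OF ind2 assms(4) m(3)])
  show "expectation (\<lambda>\<omega>. f \<omega> * (W t \<omega> - W s \<omega>)\<^sup>2) = expectation f * (t - s)"
    using indep_var_lebesgue_integral[OF ind2 assms(4) m(3)] m(4) by simp
qed

text \<open>The Ito isometry as an inequality, for bounded adapted integrands. Measurability of the
  partial sum is carried through the induction because the next increment must be independent of it.
  The start index is free so that single cells can be treated.\<close>

lemma ito_sum:
  assumes p: "\<And>j. 0 \<le> p j" "\<And>j. p j < p (Suc j)"
    and K: "\<And>j. K j \<in> borel_measurable (F (p j))" "\<And>j \<omega>. \<bar>K j \<omega>\<bar> \<le> b"
    and "a \<le> c"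
  shows "(\<lambda>\<omega>. \<Sum>j\<in>{a..<c}. K j \<omega> * (W (p (Suc j)) \<omega> - W (p j) \<omega>)) \<in> borel_measurable (F (p c)) \<and>
    integrable M (\<lambda>\<omega>. (\<Sum>j\<in>{a..<c}. K j \<omega> * (W (p (Suc j)) \<omega> - W (p j) \<omega>))\<^sup>2) \<and>
    expectation (\<lambda>\<omega>. (\<Sum>j\<in>{a..<c}. K j \<omega> * (W (p (Suc j)) \<omega> - W (p j) \<omega>))\<^sup>2) \<le> b\<^sup>2 * (p c - p a)"
  using \<open>a \<le> c\<close>
proof (induction c rule: dec_induct)
  case base
  show ?case by simp
next
  case (step c)
  let ?D = "\<lambda>\<omega>. W (p (Suc c)) \<omega> - W (p c) \<omega>"
  define S where "S \<omega> = (\<Sum>j\<in>{a..<c}. K j \<omega> * (W (p (Suc j)) \<omega> - W (p j) \<omega>))" for \<omega>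
  have S: "S \<in> borel_measurable (F (p c))" "integrable M (\<lambda>\<omega>. (S \<omega>)\<^sup>2)"
      "expectation (\<lambda>\<omega>. (S \<omega>)\<^sup>2) \<le> b\<^sup>2 * (p c - p a)"
    using step.IH unfolding S_def by auto
  have S_int: "integrable M S"
    using square_integrable_imp_integrable[OF measurable_F_M[OF S(1)]] S(2) by simp
  have eq: "(\<Sum>j\<in>{a..<Suc c}. K j \<omega> * (W (p (Suc j)) \<omega> - W (p j) \<omega>)) = S \<omega> + K c \<omega> * ?D \<omega>" for \<omega>
    using step.hyps by (simp add: S_def)
  have "0 \<le> b" using K(2)[of 0] abs_ge_zero order_trans by blast
  have K2: "(K c \<omega>)\<^sup>2 \<le> b\<^sup>2" for \<omega> using K(2)[of c \<omega>] \<open>0 \<le> b\<close> by (simp add: abs_le_square_iff[symmetric])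
  have K2m: "(\<lambda>\<omega>. (K c \<omega>)\<^sup>2) \<in> borel_measurable (F (p c))" using K(1)[of c] by measurable
  have K2i: "integrable M (\<lambda>\<omega>. (K c \<omega>)\<^sup>2)"
    using K2 by (intro integrable_const_bound[where B="b\<^sup>2"] measurable_F_M[OF K2m]) auto
  have SKm: "(\<lambda>\<omega>. K c \<omega> * S \<omega>) \<in> borel_measurable (F (p c))" using K(1)[of c] S(1) by measurable
  have SKi: "integrable M (\<lambda>\<omega>. K c \<omega> * S \<omega>)"
    using measurable_F_M[OF K(1)] K(2) by (intro integrable_bounded_mult[OF S_int])
  note A = W_product[OF p(1) p(2)[of c] SKm SKi] and B = W_product[OF p(1) p(2)[of c] K2m K2i]
  \<comment> \<open>The middle term has mean 0, being an \<open>F (p c)\<close>-measurable factor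
    times the next increment; in the last one the mean factors, and the squared increment
    contributes the length of the cell.\<close>
  have sq: "(S \<omega> + K c \<omega> * ?D \<omega>)\<^sup>2 = ((S \<omega>)\<^sup>2 + 2 * (K c \<omega> * S \<omega> * ?D \<omega>)) + (K c \<omega>)\<^sup>2 * (?D \<omega>)\<^sup>2" for \<omega>
    by (simp add: power2_sum power_mult_distrib mult_ac)
  have i2: "integrable M (\<lambda>\<omega>. 2 * (K c \<omega> * S \<omega> * ?D \<omega>))" using A(1) by (rule integrable_mult_right)
  have "expectation (\<lambda>\<omega>. (S \<omega> + K c \<omega> * ?D \<omega>)\<^sup>2) =
      expectation (\<lambda>\<omega>. (S \<omega>)\<^sup>2) + expectation (\<lambda>\<omega>. 2 * (K c \<omega> * S \<omega> * ?D \<omega>)) + expectation (\<lambda>\<omega>. (K c \<omega>)\<^sup>2 * (?D \<omega>)\<^sup>2)"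
    unfolding sq using S(2) i2 B(3)
    by (subst Bochner_Integration.integral_add[OF Bochner_Integration.integrable_add[OF S(2) i2] B(3)])
      (subst Bochner_Integration.integral_add[OF S(2) i2], rule refl)
  also have "\<dots> = expectation (\<lambda>\<omega>. (S \<omega>)\<^sup>2) + expectation (\<lambda>\<omega>. (K c \<omega>)\<^sup>2) * (p (Suc c) - p c)"
    using A(2) B(4) by simp
  also have "\<dots> \<le> b\<^sup>2 * (p c - p a) + b\<^sup>2 * (p (Suc c) - p c)"
  proof (intro add_mono S(3) mult_right_mono)
    show "expectation (\<lambda>\<omega>. (K c \<omega>)\<^sup>2) \<le> b\<^sup>2"
      using K2 integral_le_const[OF K2i] by simp
    show "0 \<le> p (Suc c) - p c" using p(2)[of c] by simp
  qed
  finally have "expectation (\<lambda>\<omega>. (S \<omega> + K c \<omega> * ?D \<omega>)\<^sup>2) \<le> b\<^sup>2 * (p (Suc c) - p a)"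
    by (simp add: algebra_simps)
  moreover have "integrable M (\<lambda>\<omega>. (S \<omega> + K c \<omega> * ?D \<omega>)\<^sup>2)"
    unfolding sq by (intro Bochner_Integration.integrable_add S(2) i2 B(3))
  moreover have "(\<lambda>\<omega>. S \<omega> + K c \<omega> * ?D \<omega>) \<in> borel_measurable (F (p (Suc c)))"
  proof (intro borel_measurable_add borel_measurable_times W_increment_measurable)
    show "S \<in> borel_measurable (F (p (Suc c)))" "K c \<in> borel_measurable (F (p (Suc c)))"
      using p(2)[of c] S(1) K(1)[of c] by (auto elim: measurable_F_mono)
  qed (use p in \<open>auto intro: less_imp_le\<close>)
  ultimately show ?case unfolding eq by blast
qed

lemma grid_strict: "0 < t \<Longrightarrow> grid t n j < grid t n (Suc j)"
  using grid_Suc_diff[of t n j] by (smt (verit) divide_pos_pos zero_less_power)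

lemma ito_sum_grid:
  assumes "0 < t" and K: "\<And>j. K j \<in> borel_measurable (F (grid t n j))" "\<And>j \<omega>. \<bar>K j \<omega>\<bar> \<le> b" and "a \<le> c"
  shows "integrable M (\<lambda>\<omega>. (\<Sum>j\<in>{a..<c}. K j \<omega> * (W (grid t n (Suc j)) \<omega> - W (grid t n j) \<omega>))\<^sup>2)"
    "expectation (\<lambda>\<omega>. (\<Sum>j\<in>{a..<c}. K j \<omega> * (W (grid t n (Suc j)) \<omega> - W (grid t n j) \<omega>))\<^sup>2) \<le> b\<^sup>2 * (grid t n c - grid t n a)"
proof -
  have *: "0 \<le> grid t n j" "grid t n j < grid t n (Suc j)" for j
    using assms(1) by (auto intro: grid_nonneg grid_strict)
  note I = ito_sum[of "grid t n", OF * K \<open>a \<le> c\<close>]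
  show "integrable M (\<lambda>\<omega>. (\<Sum>j\<in>{a..<c}. K j \<omega> * (W (grid t n (Suc j)) \<omega> - W (grid t n j) \<omega>))\<^sup>2)"
    using I by blast
  show "expectation (\<lambda>\<omega>. (\<Sum>j\<in>{a..<c}. K j \<omega> * (W (grid t n (Suc j)) \<omega> - W (grid t n j) \<omega>))\<^sup>2) \<le> b\<^sup>2 * (grid t n c - grid t n a)"
    using I by blast
qed

text \<open>The expected sum of squares is exactly \<open>t\<close> at every level, so Markov's
  inequality with bound \<open>t / \<eta>\<close> settles it.\<close>

lemma W_qv_tight:
  assumes "0 < t"
  shows "qv_tight t W"
proof (rule qv_tightI_weak)
  fix \<eta> :: real assume "0 < \<eta>"
  show "\<exists>B. \<forall>n. off_small \<eta> (\<lambda>\<omega>. (\<Sum>j<2 ^ n. (W (grid t n (Suc j)) \<omega> - W (grid t n j) \<omega>)\<^sup>2) \<le> B)"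
  proof (intro exI[of _ "t / \<eta>"] allI)
    fix n
    note m = W_moments[OF grid_nonneg[OF less_imp_le[OF assms]] grid_strict[OF assms]]
    show "off_small \<eta> (\<lambda>\<omega>. (\<Sum>j<2 ^ n. (W (grid t n (Suc j)) \<omega> - W (grid t n j) \<omega>)\<^sup>2) \<le> t / \<eta>)"
    proof (rule off_small_Markov)
      show "integrable M (\<lambda>\<omega>. \<Sum>j<2 ^ n. (W (grid t n (Suc j)) \<omega> - W (grid t n j) \<omega>)\<^sup>2)"
        by (intro Bochner_Integration.integrable_sum m)
      have "expectation (\<lambda>\<omega>. \<Sum>j<2 ^ n. (W (grid t n (Suc j)) \<omega> - W (grid t n j) \<omega>)\<^sup>2)
          = (\<Sum>j<2 ^ n. grid t n (Suc j) - grid t n j)"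
        by (subst Bochner_Integration.integral_sum) (auto simp: m)
      also have "\<dots> = t" by (simp add: sum_lessThan_telescope)
      finally show "expectation (\<lambda>\<omega>. \<Sum>j<2 ^ n. (W (grid t n (Suc j)) \<omega> - W (grid t n j) \<omega>)\<^sup>2) \<le> t / \<eta> * \<eta>"
        using \<open>0 < \<eta>\<close> by simp
    qed (use \<open>0 < \<eta>\<close> assms in \<open>auto intro: sum_nonneg\<close>)
  qed
qed

end

section \<open>The defect of the trapezoidal rule\<close>

definition trapezoid_sum :: "real \<Rightarrow> (real \<Rightarrow> real) \<Rightarrow> (real \<Rightarrow> real) \<Rightarrow> nat \<Rightarrow> nat \<Rightarrow> real" where
  "trapezoid_sum t x y n k =
     (\<Sum>j<k. (y (grid t n (Suc j)) - y (grid t n j)) * ((x (grid t n j) + x (grid t n (Suc j))) / 2))"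

lemma stratonovich_sum_grid:
  "stratonovich_sum x y k (grid t n) \<omega> = trapezoid_sum t (\<lambda>s. x s \<omega>) (\<lambda>s. y s \<omega>) n k"
  for x :: "real \<Rightarrow> 'a \<Rightarrow> real"
  by (simp add: stratonovich_sum_def trapezoid_sum_def)

text \<open>A left-point sum for the iterated integral of \<open>dx\<close> followed by
  \<open>dy\<close> over one cell of level \<open>n\<close>. The integrand is recentred at the left
  end of the cell, so it is as small as the oscillation of \<open>x\<close> at that scale.\<close>

definition ito_block :: "real \<Rightarrow> (real \<Rightarrow> real) \<Rightarrow> (real \<Rightarrow> real) \<Rightarrow> nat \<Rightarrow> nat \<Rightarrow> nat \<Rightarrow> real" where
  "ito_block t x y n m i = (\<Sum>j\<in>{i * 2 ^ m..<Suc i * 2 ^ m}.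
     (x (grid t (n + m) j) - x (grid t n i)) * (y (grid t (n + m) (Suc j)) - y (grid t (n + m) j)))"

definition block_covariation :: "real \<Rightarrow> (real \<Rightarrow> real) \<Rightarrow> (real \<Rightarrow> real) \<Rightarrow> nat \<Rightarrow> nat \<Rightarrow> nat \<Rightarrow> real" where
  "block_covariation t x y n m i = (\<Sum>j\<in>{i * 2 ^ m..<Suc i * 2 ^ m}.
     (x (grid t (n + m) (Suc j)) - x (grid t (n + m) j)) * (y (grid t (n + m) (Suc j)) - y (grid t (n + m) j)))"

lemma trapezoid_sum_diff:
  "a \<le> b \<Longrightarrow> trapezoid_sum t x y n b - trapezoid_sum t x y n a =
     (\<Sum>j\<in>{a..<b}. (y (grid t n (Suc j)) - y (grid t n j)) * ((x (grid t n j) + x (grid t n (Suc j))) / 2))"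
  unfolding trapezoid_sum_def lessThan_atLeast0 by (simp add: sum_diff_nat_ivl)

text \<open>Each mean of \<open>x\<close> over a fine cell is split as the deviation of its left
  value from the left end of the coarse cell, plus the value at that end, plus half of the increment
  of \<open>x\<close>.\<close>

lemma trapezoid_block:
  "trapezoid_sum t x y (n + m) (Suc i * 2 ^ m) - trapezoid_sum t x y (n + m) (i * 2 ^ m) =
     ito_block t x y n m i + x (grid t n i) * (y (grid t n (Suc i)) - y (grid t n i))
       + block_covariation t x y n m i / 2"
proof -
  let ?I = "{i * 2 ^ m..<Suc i * 2 ^ m}"
  let ?x = "\<lambda>j. x (grid t (n + m) j)" and ?y = "\<lambda>j. y (grid t (n + m) j)"
  have "y (grid t n (Suc i)) - y (grid t n i) = ?y (Suc i * 2 ^ m) - ?y (i * 2 ^ m)"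
    by (simp only: grid_refine)
  also have "\<dots> = (\<Sum>j\<in>?I. ?y (Suc j) - ?y j)"
    by (rule sum_Suc_diff'[symmetric]) simp
  finally have tel: "y (grid t n (Suc i)) - y (grid t n i) = (\<Sum>j\<in>?I. ?y (Suc j) - ?y j)" .
  have "trapezoid_sum t x y (n + m) (Suc i * 2 ^ m) - trapezoid_sum t x y (n + m) (i * 2 ^ m)
      = (\<Sum>j\<in>?I. (?y (Suc j) - ?y j) * ((?x j + ?x (Suc j)) / 2))"
    by (rule trapezoid_sum_diff) simp
  also have "\<dots> = (\<Sum>j\<in>?I. (?x j - x (grid t n i)) * (?y (Suc j) - ?y j) + x (grid t n i) * (?y (Suc j) - ?y j)
      + (?x (Suc j) - ?x j) * (?y (Suc j) - ?y j) / 2)"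
    by (intro sum.cong refl) (simp add: field_simps)
  finally show ?thesis
    unfolding tel ito_block_def block_covariation_def
    by (simp only: sum.distrib sum_distrib_left sum_divide_distrib)
qed

lemma abs_mult_le_squares: "\<bar>a * b\<bar> \<le> (a\<^sup>2 + b\<^sup>2) / 2" for a b :: real
  using sum_squares_bound[of a b] sum_squares_bound[of a "- b"] by (simp add: abs_le_iff)

text \<open>Young's inequality, term by term. The absolute values stay inside the sum over coarse
  cells, so weights that vary from cell to cell can be inserted later.\<close>

lemma sum_block_covariation:
  "(\<Sum>i<2 ^ n. \<bar>block_covariation t x y n m i\<bar>) \<le>
    ((\<Sum>j<2 ^ (n + m). (x (grid t (n + m) (Suc j)) - x (grid t (n + m) j))\<^sup>2)
      + (\<Sum>j<2 ^ (n + m). (y (grid t (n + m) (Suc j)) - y (grid t (n + m) j))\<^sup>2)) / 2"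
proof -
  let ?dx = "\<lambda>j. x (grid t (n + m) (Suc j)) - x (grid t (n + m) j)"
  let ?dy = "\<lambda>j. y (grid t (n + m) (Suc j)) - y (grid t (n + m) j)"
  have "(\<Sum>i<2 ^ n. \<bar>block_covariation t x y n m i\<bar>) \<le>
      (\<Sum>i<2 ^ n. \<Sum>j\<in>{i * 2 ^ m..<Suc i * 2 ^ m}. ((?dx j)\<^sup>2 + (?dy j)\<^sup>2) / 2)"
    unfolding block_covariation_def
    by (intro sum_mono order_trans[OF sum_abs] abs_mult_le_squares)
  also have "\<dots> = (\<Sum>j<2 ^ (n + m). ((?dx j)\<^sup>2 + (?dy j)\<^sup>2) / 2)"
    by (rule sum_grid_blocks[symmetric])
  finally show ?thesis
    by (simp add: sum.distrib add_divide_distrib flip: sum_divide_distrib)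
qed

definition stratonovich_defect ::
    "real \<Rightarrow> (real \<Rightarrow> real) \<Rightarrow> (real \<Rightarrow> real) \<Rightarrow> (real \<Rightarrow> real) \<Rightarrow> nat \<Rightarrow> nat \<Rightarrow> real" where
  "stratonovich_defect t x y J n i = J (grid t n (Suc i)) - J (grid t n i)
     - (y (grid t n (Suc i)) - y (grid t n i)) * ((x (grid t n i) + x (grid t n (Suc i))) / 2)"

text \<open>Averaged weights make the discrete product rule exact: \<open>x' y' - x y = (y + y') / 2
  * (x' - x) + (x + x') / 2 * (y' - y)\<close>.\<close>

definition weighted_defect ::
    "real \<Rightarrow> (real \<Rightarrow> real) \<Rightarrow> (real \<Rightarrow> real) \<Rightarrow> (real \<Rightarrow> real) \<Rightarrow> (real \<Rightarrow> real) \<Rightarrow> nat \<Rightarrow> real" where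
  "weighted_defect t w x y J n =
     (\<Sum>i<2 ^ n. (w (grid t n i) + w (grid t n (Suc i))) / 2 * stratonovich_defect t x y J n i)"

lemma sum_defect:
  "a \<le> b \<Longrightarrow> (\<Sum>i\<in>{a..<b}. stratonovich_defect t x y J n i) =
    (J (grid t n b) - trapezoid_sum t x y n b) - (J (grid t n a) - trapezoid_sum t x y n a)"
proof -
  assume "a \<le> b"
  have "(\<Sum>i\<in>{a..<b}. stratonovich_defect t x y J n i) = (\<Sum>i\<in>{a..<b}. J (grid t n (Suc i)) - J (grid t n i))
      - (trapezoid_sum t x y n b - trapezoid_sum t x y n a)"
    unfolding stratonovich_defect_def trapezoid_sum_diff[OF \<open>a \<le> b\<close>] by (rule sum_subtractf)
  also have "(\<Sum>i\<in>{a..<b}. J (grid t n (Suc i)) - J (grid t n i)) = J (grid t n b) - J (grid t n a)"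
    using sum_Suc_diff'[OF \<open>a \<le> b\<close>, of "\<lambda>i. J (grid t n i)"] by simp
  finally show ?thesis by simp
qed

text \<open>
  Levels: \<open>k\<close> (macroscopic cells, on which \<open>w\<close> is frozen), \<open>n\<close> (cells of the defect) and \<open>n + m\<close>
  (grid that approximates \<open>J\<close>).
\<close>

lemma weighted_defect_le:
  fixes w x y J :: "real \<Rightarrow> real" and t :: real
  defines "qv \<equiv> \<lambda>z n. \<Sum>j<2 ^ n. (z (grid t n (Suc j)) - z (grid t n j))\<^sup>2"
  assumes n: "n = k + m'" and t: "0 \<le> t" and "0 < d" and e: "0 \<le> e1"
    and b: "\<forall>s\<in>{0..t}. \<bar>w s\<bar> \<le> b"
    and osc: "\<forall>s\<in>{0..t}. \<forall>u\<in>{0..t}. \<bar>s - u\<bar> \<le> t / 2 ^ k \<longrightarrow> \<bar>w s - w u\<bar> \<le> e1"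
    and macro: "\<forall>\<kappa>\<le>2 ^ k. \<bar>trapezoid_sum t x y (k + m') (\<kappa> * 2 ^ m') - J (grid t k \<kappa>)\<bar> \<le> e2"
    and fine: "\<forall>i\<le>2 ^ n. \<bar>trapezoid_sum t x y (n + m) (i * 2 ^ m) - J (grid t n i)\<bar> \<le> e4"
    and ito: "\<bar>\<Sum>i<2 ^ n. (w (grid t n i) - w (grid t k (i div 2 ^ m'))) * ito_block t x y n m i\<bar> \<le> e5"
    and ito2: "(\<Sum>i<2 ^ n. (ito_block t x y n m i)\<^sup>2) \<le> a"
    and qv: "qv w n \<le> Bw" "qv x n \<le> Bx" "qv x (n + m) \<le> Bx" "qv y n \<le> By" "qv y (n + m) \<le> By"
  shows "\<bar>weighted_defect t w x y J n\<bar> \<le> 2 ^ k * (b * (2 * e2)) + e5 + (d * Bw + a / d) / 4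
      + e1 * ((Bx + By) / 2) + 2 ^ n * (2 * b * (2 * e4))"
proof -
  define wi where "wi i = w (grid t n i)" for i
  define wk where "wk i = w (grid t k (i div 2 ^ m'))" for i
  define r where "r i = stratonovich_defect t x y J n i" for i
  define U where "U i = ito_block t x y n m i" for i
  \<comment> \<open>The fine covariation comes from the fine trapezoidal sum; the product that is
    subtracted comes from the one-step rule in the defect itself. \<open>th\<close> below is the
    error of replacing \<open>J\<close> by the fine sum.\<close>
  define q where "q i = block_covariation t x y n m i / 2
    - (x (grid t n (Suc i)) - x (grid t n i)) * (y (grid t n (Suc i)) - y (grid t n i)) / 2" for i
  define th where "th i = (J (grid t n (Suc i)) - trapezoid_sum t x y (n + m) (Suc i * 2 ^ m))
    - (J (grid t n i) - trapezoid_sum t x y (n + m) (i * 2 ^ m))" for i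
  have r: "r i = U i + q i + th i" for i
  proof -
    have "r i - th i = (trapezoid_sum t x y (n + m) (Suc i * 2 ^ m) - trapezoid_sum t x y (n + m) (i * 2 ^ m))
       - (y (grid t n (Suc i)) - y (grid t n i)) * ((x (grid t n i) + x (grid t n (Suc i))) / 2)"
      unfolding r_def th_def stratonovich_defect_def by simp
    also have "\<dots> = U i + q i"
      unfolding trapezoid_block U_def q_def by (simp add: field_simps)
    finally show ?thesis by simp
  qed
  \<comment> \<open>Only the first sum contains the full defect, with frozen weights. The weight of
    \<open>U\<close> is further split: \<open>wi i - wk i\<close> is known at the left end of the
    cell, hence a legitimate Ito integrand, whereas the look-ahead \<open>wi (Suc i) - wi i\<close>
    is not.\<close>
  have split: "weighted_defect t w x y J n = (\<Sum>i<2 ^ n. wk i * r i) + (\<Sum>i<2 ^ n. (wi i - wk i) * U i)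
      + (\<Sum>i<2 ^ n. (wi (Suc i) - wi i) * U i / 2)
      + (\<Sum>i<2 ^ n. ((wi i + wi (Suc i)) / 2 - wk i) * q i) + (\<Sum>i<2 ^ n. ((wi i + wi (Suc i)) / 2 - wk i) * th i)"
    unfolding weighted_defect_def r_def[symmetric] wi_def[symmetric] sum.distrib[symmetric]
    by (intro sum.cong refl) (simp add: r field_simps)
  have "0 \<le> b" using b t by (meson abs_ge_zero atLeastAtMost_iff order_refl order_trans)
  have wi_b: "\<bar>wi i\<bar> \<le> b" if "i \<le> 2 ^ n" for i
    using b grid_in[OF t that] by (auto simp: wi_def)
  have div_le: "i div 2 ^ m' \<le> 2 ^ k" if "i < 2 ^ n" for i :: nat
    using that unfolding n by (simp add: less_mult_imp_div_less less_imp_le power_add)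
  have wk_b: "\<bar>wk i\<bar> \<le> b" if "i < 2 ^ n" for i
    using b grid_in[OF t div_le[OF that]] by (auto simp: wk_def)
  \<comment> \<open>Cell \<open>i\<close> lies in the macroscopic cell \<open>i div 2 ^ m'\<close>,
    so both of its ends are within \<open>t / 2 ^ k\<close> of the point where the weight is
    frozen.\<close>
  have osc': "\<bar>wi j - wk i\<bar> \<le> e1" if "i < 2 ^ n" "j = i \<or> j = Suc i" for i j
  proof -
    have 1: "i div 2 ^ m' * 2 ^ m' \<le> j" using that(2) by (auto intro: le_SucI)
    have "i mod 2 ^ m' < 2 ^ m'" by simp
    then have "i < i div 2 ^ m' * 2 ^ m' + 2 ^ m'"
      using div_mult_mod_eq[of i "2 ^ m'"] by linarith
    then have 2: "j \<le> i div 2 ^ m' * 2 ^ m' + 2 ^ m'" using that(2) by auto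
    have "\<bar>grid t n j - grid t k (i div 2 ^ m')\<bar> \<le> t / 2 ^ k"
      using grid_diff_le[OF t 1 2, of k] unfolding n grid_refine .
    moreover have "grid t n j \<in> {0..t}" using that by (intro grid_in t) auto
    moreover have "grid t k (i div 2 ^ m') \<in> {0..t}" by (intro grid_in t div_le that)
    ultimately show ?thesis using osc unfolding wi_def wk_def by blast
  qed
  have wbar: "\<bar>(wi i + wi (Suc i)) / 2 - wk i\<bar> \<le> e1" "\<bar>(wi i + wi (Suc i)) / 2 - wk i\<bar> \<le> 2 * b"
    if "i < 2 ^ n" for i
    using osc'[OF that, of i] osc'[OF that, of "Suc i"] wi_b[of i] wi_b[of "Suc i"] wk_b[of i] that
    by (auto simp: abs_le_iff field_simps)
  have "(\<Sum>i<2 ^ n. wk i * r i) = (\<Sum>\<kappa><2 ^ k. \<Sum>i\<in>{\<kappa> * 2 ^ m'..<Suc \<kappa> * 2 ^ m'}. wk i * r i)"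
    unfolding n by (rule sum_grid_blocks)
  also have "\<dots> = (\<Sum>\<kappa><2 ^ k. w (grid t k \<kappa>) * (\<Sum>i\<in>{\<kappa> * 2 ^ m'..<Suc \<kappa> * 2 ^ m'}. r i))"
    unfolding sum_distrib_left
  proof (intro sum.cong refl)
    fix \<kappa> i :: nat assume "i \<in> {\<kappa> * 2 ^ m'..<Suc \<kappa> * 2 ^ m'}"
    then have "i div 2 ^ m' = \<kappa>" by (intro div_nat_eqI) (auto simp: mult.commute)
    then show "wk i * r i = w (grid t k \<kappa>) * r i" by (simp add: wk_def)
  qed
  finally have "\<bar>\<Sum>i<2 ^ n. wk i * r i\<bar> \<le> (\<Sum>\<kappa><2 ^ k. \<bar>w (grid t k \<kappa>) * (\<Sum>i\<in>{\<kappa> * 2 ^ m'..<Suc \<kappa> * 2 ^ m'}. r i)\<bar>)"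
    by simp
  also have "\<dots> \<le> (\<Sum>\<kappa><(2::nat) ^ k. b * (2 * e2))"
  proof (intro sum_mono)
    fix \<kappa> :: nat assume \<kappa>: "\<kappa> \<in> {..<2 ^ k}"
    have "(\<Sum>i\<in>{\<kappa> * 2 ^ m'..<Suc \<kappa> * 2 ^ m'}. r i) =
       (J (grid t k (Suc \<kappa>)) - trapezoid_sum t x y (k + m') (Suc \<kappa> * 2 ^ m'))
       - (J (grid t k \<kappa>) - trapezoid_sum t x y (k + m') (\<kappa> * 2 ^ m'))"
      unfolding r_def n by (subst sum_defect) (simp_all only: grid_refine, simp)
    moreover have "\<bar>trapezoid_sum t x y (k + m') (\<kappa> * 2 ^ m') - J (grid t k \<kappa>)\<bar> \<le> e2"
        "\<bar>trapezoid_sum t x y (k + m') (Suc \<kappa> * 2 ^ m') - J (grid t k (Suc \<kappa>))\<bar> \<le> e2"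
      using macro \<kappa> by (simp_all only: lessThan_iff Suc_le_eq less_imp_le)
    ultimately have "\<bar>\<Sum>i\<in>{\<kappa> * 2 ^ m'..<Suc \<kappa> * 2 ^ m'}. r i\<bar> \<le> 2 * e2" by linarith
    moreover have "\<bar>w (grid t k \<kappa>)\<bar> \<le> b" using b grid_in[OF t, of \<kappa> k] \<kappa> by auto
    ultimately show "\<bar>w (grid t k \<kappa>) * (\<Sum>i\<in>{\<kappa> * 2 ^ m'..<Suc \<kappa> * 2 ^ m'}. r i)\<bar> \<le> b * (2 * e2)"
      using \<open>0 \<le> b\<close> unfolding abs_mult by (intro mult_mono) auto
  qed
  finally have T1: "\<bar>\<Sum>i<2 ^ n. wk i * r i\<bar> \<le> 2 ^ k * (b * (2 * e2))" by simp
  have T2: "\<bar>\<Sum>i<2 ^ n. (wi i - wk i) * U i\<bar> \<le> e5" using ito unfolding wi_def wk_def U_def .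
  \<comment> \<open>Young's inequality with parameter \<open>d\<close>: the squared increments of
    \<open>w\<close> are only bounded, so \<open>d\<close> has to be small, while the blocks are
    small enough to absorb the factor \<open>1 / d\<close>.\<close>
  have "\<bar>\<Sum>i<2 ^ n. (wi (Suc i) - wi i) * U i / 2\<bar> \<le> (\<Sum>i<2 ^ n. (d * (wi (Suc i) - wi i)\<^sup>2 + (U i)\<^sup>2 / d) / 4)"
  proof (intro order_trans[OF sum_abs] sum_mono)
    fix i
    have "\<bar>(sqrt d * (wi (Suc i) - wi i)) * (U i / sqrt d)\<bar> \<le> ((sqrt d * (wi (Suc i) - wi i))\<^sup>2 + (U i / sqrt d)\<^sup>2) / 2"
      by (rule abs_mult_le_squares)
    then show "\<bar>(wi (Suc i) - wi i) * U i / 2\<bar> \<le> (d * (wi (Suc i) - wi i)\<^sup>2 + (U i)\<^sup>2 / d) / 4"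
      using \<open>0 < d\<close> by (simp add: power_mult_distrib power_divide abs_mult mult.commute mult.left_commute)
  qed
  also have "\<dots> = (d * qv w n + (\<Sum>i<2 ^ n. (U i)\<^sup>2) / d) / 4"
    unfolding assms(1) wi_def by (simp only: sum.distrib flip: sum_divide_distrib sum_distrib_left)
  also have "\<dots> \<le> (d * Bw + a / d) / 4"
    using qv(1) ito2 \<open>0 < d\<close> unfolding U_def by (intro divide_right_mono add_mono mult_left_mono) auto
  finally have T3: "\<bar>\<Sum>i<2 ^ n. (wi (Suc i) - wi i) * U i / 2\<bar> \<le> (d * Bw + a / d) / 4" .
  have qsum: "(\<Sum>i<2 ^ n. \<bar>q i\<bar>) \<le> (Bx + By) / 2"
  proof -
    let ?dx = "\<lambda>i. x (grid t n (Suc i)) - x (grid t n i)" and ?dy = "\<lambda>i. y (grid t n (Suc i)) - y (grid t n i)"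
    have "(\<Sum>i<2 ^ n. \<bar>q i\<bar>) \<le> (\<Sum>i<2 ^ n. \<bar>block_covariation t x y n m i\<bar> / 2 + ((?dx i)\<^sup>2 + (?dy i)\<^sup>2) / 4)"
    proof (intro sum_mono)
      fix i
      show "\<bar>q i\<bar> \<le> \<bar>block_covariation t x y n m i\<bar> / 2 + ((?dx i)\<^sup>2 + (?dy i)\<^sup>2) / 4"
        using abs_mult_le_squares[of "?dx i" "?dy i"] unfolding q_def by linarith
    qed
    also have "\<dots> = (\<Sum>i<2 ^ n. \<bar>block_covariation t x y n m i\<bar>) / 2 + (qv x n + qv y n) / 4"
      unfolding assms(1) by (simp only: sum.distrib flip: sum_divide_distrib)
    also have "\<dots> \<le> ((qv x (n + m) + qv y (n + m)) / 2) / 2 + (qv x n + qv y n) / 4"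
      using sum_block_covariation[of t x y n m] unfolding assms(1) by (intro add_mono divide_right_mono) auto
    also have "\<dots> \<le> (Bx + By) / 2" using qv(2-5) by (simp add: field_simps)
    finally show ?thesis .
  qed
  have "\<bar>\<Sum>i<2 ^ n. ((wi i + wi (Suc i)) / 2 - wk i) * q i\<bar> \<le> (\<Sum>i<2 ^ n. e1 * \<bar>q i\<bar>)"
    using wbar(1) by (intro order_trans[OF sum_abs] sum_mono) (auto simp: abs_mult intro: mult_right_mono)
  also have "\<dots> \<le> e1 * ((Bx + By) / 2)"
    using qsum e by (simp only: sum_distrib_left[symmetric] mult_left_mono)
  finally have T4: "\<bar>\<Sum>i<2 ^ n. ((wi i + wi (Suc i)) / 2 - wk i) * q i\<bar> \<le> e1 * ((Bx + By) / 2)" .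
  \<comment> \<open>A crude bound with the full factor \<open>2 ^ n\<close>; it is affordable
    because \<open>e4\<close> will be chosen after \<open>n\<close>.\<close>
  have "\<bar>\<Sum>i<2 ^ n. ((wi i + wi (Suc i)) / 2 - wk i) * th i\<bar> \<le> (\<Sum>i<(2::nat) ^ n. 2 * b * (2 * e4))"
  proof (intro order_trans[OF sum_abs] sum_mono)
    fix i :: nat assume i: "i \<in> {..<2 ^ n}"
    have "\<bar>trapezoid_sum t x y (n + m) (i * 2 ^ m) - J (grid t n i)\<bar> \<le> e4"
        "\<bar>trapezoid_sum t x y (n + m) (Suc i * 2 ^ m) - J (grid t n (Suc i))\<bar> \<le> e4"
      using fine i by (simp_all only: lessThan_iff Suc_le_eq less_imp_le)
    then have "\<bar>th i\<bar> \<le> 2 * e4" unfolding th_def by linarith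
    then show "\<bar>((wi i + wi (Suc i)) / 2 - wk i) * th i\<bar> \<le> 2 * b * (2 * e4)"
      using wbar(2)[of i] i \<open>0 \<le> b\<close> unfolding abs_mult by (intro mult_mono) auto
  qed
  then have T5: "\<bar>\<Sum>i<2 ^ n. ((wi i + wi (Suc i)) / 2 - wk i) * th i\<bar> \<le> 2 ^ n * (2 * b * (2 * e4))" by simp
  show ?thesis using T1 T2 T3 T4 T5 unfolding split by linarith
qed

lemma grid_level_mono: "0 \<le> t \<Longrightarrow> k \<le> n \<Longrightarrow> t / 2 ^ n \<le> t / (2::real) ^ k"
  by (intro divide_left_mono power_increasing) auto

lemma grid_div_le: "0 \<le> t \<Longrightarrow> grid t n (j div 2 ^ m) \<le> grid t (n + m) j"
  using grid_mono[of t "j div 2 ^ m * 2 ^ m" j "n + m"] by (simp add: grid_refine)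

text \<open>The isometry needs an integrand bounded for every \<open>\<omega>\<close>; on paths
  whose oscillation is at most \<open>c\<close> the truncation changes nothing. Writing the coarse
  index as \<open>j div 2 ^ m\<close> makes the integrand depend on \<open>j\<close> alone, so that
  neighbouring blocks join into one sum.\<close>

lemma ito_block_clamp:
  assumes t: "0 \<le> t" and i: "i < 2 ^ n"
    and osc: "\<forall>s\<in>{0..t}. \<forall>u\<in>{0..t}. \<bar>s - u\<bar> \<le> t / 2 ^ n \<longrightarrow> \<bar>x s - x u\<bar> \<le> c"
  shows "ito_block t x y n m i = (\<Sum>j\<in>{i * 2 ^ m..<Suc i * 2 ^ m}.
     truncate c (x (grid t (n + m) j) - x (grid t n (j div 2 ^ m))) * (y (grid t (n + m) (Suc j)) - y (grid t (n + m) j)))"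
  unfolding ito_block_def
proof (intro sum.cong refl)
  fix j assume j: "j \<in> {i * 2 ^ m..<Suc i * 2 ^ m}"
  then have d: "j div 2 ^ m = i" by (intro div_nat_eqI) (auto simp: mult.commute)
  have "\<bar>grid t (n + m) j - grid t (n + m) (i * 2 ^ m)\<bar> \<le> t / 2 ^ n"
    using j by (intro grid_diff_le t) auto
  moreover have "j \<le> 2 ^ (n + m)"
  proof -
    have "Suc i * 2 ^ m \<le> 2 ^ n * 2 ^ m" using i by (intro mult_le_mono1) simp
    then show ?thesis using j by (simp add: power_add)
  qed
  moreover have "grid t n i \<in> {0..t}" using i by (intro grid_in t) simp
  ultimately have "\<bar>x (grid t (n + m) j) - x (grid t n i)\<bar> \<le> c"
    using osc grid_in[OF t, of j "n + m"] unfolding grid_refine by blast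
  then show "(x (grid t (n + m) j) - x (grid t n i)) * (y (grid t (n + m) (Suc j)) - y (grid t (n + m) j)) =
     truncate c (x (grid t (n + m) j) - x (grid t n (j div 2 ^ m))) * (y (grid t (n + m) (Suc j)) - y (grid t (n + m) j))"
    by (simp add: truncate_eq d)
qed

section \<open>Stratonovich limits along dyadic grids\<close>

context prob_space begin

text \<open>The scalar form of \<open>has_stratonovich_integral\<close>, with the limit in
  probability restated through exceptional sets.\<close>

definition stratonovich_limit ::
    "(real \<Rightarrow> 'a \<Rightarrow> real) \<Rightarrow> (real \<Rightarrow> 'a \<Rightarrow> real) \<Rightarrow> real \<Rightarrow> ('a \<Rightarrow> real) \<Rightarrow> bool" where
  "stratonovich_limit x y s J \<longleftrightarrow> (\<forall>\<epsilon>>0. \<forall>\<eta>>0. \<exists>\<delta>>0. \<forall>n p.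
     interval_partition s n p \<and> (\<forall>i<n. p (Suc i) - p i < \<delta>) \<longrightarrow>
       off_small \<eta> (\<lambda>\<omega>. \<bar>stratonovich_sum x y n p \<omega> - J \<omega>\<bar> \<le> \<epsilon>))"

text \<open>At a fixed level \<open>k\<close> only finitely many times occur, so limits chosen
  separately for each time can be approximated simultaneously. The threshold \<open>m0\<close>
  depends on \<open>k\<close> in an unknown way.\<close>

lemma stratonovich_limit_grid:
  assumes J: "\<And>s. 0 \<le> s \<Longrightarrow> stratonovich_limit x y s (J s)" and t: "0 \<le> t" and "0 < \<epsilon>" "0 < \<eta>"
  shows "\<exists>m0. \<forall>m\<ge>m0. off_small \<eta> (\<lambda>\<omega>. \<forall>\<kappa>\<le>2 ^ k.
    \<bar>trapezoid_sum t (\<lambda>s. x s \<omega>) (\<lambda>s. y s \<omega>) (k + m) (\<kappa> * 2 ^ m) - J (grid t k \<kappa>) \<omega>\<bar> \<le> \<epsilon>)"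
proof -
  \<comment> \<open>There are \<open>2 ^ k + 1\<close> grid points, with both ends counted.\<close>
  define \<eta>' where "\<eta>' = \<eta> / (2 ^ k + 1)"
  have "0 < \<eta>'" using \<open>0 < \<eta>\<close> by (simp add: \<eta>'_def add_pos_pos)
  have "\<exists>m0. \<forall>m\<ge>m0. off_small \<eta>' (\<lambda>\<omega>.
    \<bar>trapezoid_sum t (\<lambda>s. x s \<omega>) (\<lambda>s. y s \<omega>) (k + m) (\<kappa> * 2 ^ m) - J (grid t k \<kappa>) \<omega>\<bar> \<le> \<epsilon>)" for \<kappa>
  proof -
    obtain \<delta> where "0 < \<delta>" and \<delta>: "\<And>n p. interval_partition (grid t k \<kappa>) n p \<Longrightarrow> (\<forall>i<n. p (Suc i) - p i < \<delta>) \<Longrightarrow>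
       off_small \<eta>' (\<lambda>\<omega>. \<bar>stratonovich_sum x y n p \<omega> - J (grid t k \<kappa>) \<omega>\<bar> \<le> \<epsilon>)"
      using J[OF grid_nonneg[OF t, of k \<kappa>]] \<open>0 < \<epsilon>\<close> \<open>0 < \<eta>'\<close> unfolding stratonovich_limit_def by meson
    have "(\<lambda>m. t * (1 / 2) ^ m) \<longlonglongrightarrow> t * 0"
      by (intro tendsto_mult_left LIMSEQ_power_zero) auto
    then have "eventually (\<lambda>m. t * (1 / 2) ^ m < \<delta>) sequentially"
      using \<open>0 < \<delta>\<close> by (auto dest: order_tendstoD(2))
    then obtain m0 where m0: "\<And>m. m \<ge> m0 \<Longrightarrow> t * (1 / 2) ^ m < \<delta>" by (auto simp: eventually_sequentially)
    show ?thesis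
    proof (intro exI[of _ m0] allI impI)
      fix m assume "m0 \<le> m"
      have "t / 2 ^ (k + m) \<le> t / 2 ^ m" by (rule grid_level_mono[OF t]) simp
      also have "\<dots> < \<delta>" using m0[OF \<open>m0 \<le> m\<close>] by (simp add: power_divide)
      finally have "\<forall>i<\<kappa> * 2 ^ m. grid t (k + m) (Suc i) - grid t (k + m) i < \<delta>" by (simp add: grid_Suc_diff)
      moreover have "interval_partition (grid t k \<kappa>) (\<kappa> * 2 ^ m) (grid t (k + m))"
        using partition_grid[OF t, of "k + m" "\<kappa> * 2 ^ m"] by (simp only: grid_refine)
      ultimately show "off_small \<eta>' (\<lambda>\<omega>.
        \<bar>trapezoid_sum t (\<lambda>s. x s \<omega>) (\<lambda>s. y s \<omega>) (k + m) (\<kappa> * 2 ^ m) - J (grid t k \<kappa>) \<omega>\<bar> \<le> \<epsilon>)"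
        using \<delta>[of "\<kappa> * 2 ^ m" "grid t (k + m)"] by (simp only: stratonovich_sum_grid)
    qed
  qed
  then have ex: "\<forall>\<kappa>. \<exists>m0. \<forall>m\<ge>m0. off_small \<eta>' (\<lambda>\<omega>.
    \<bar>trapezoid_sum t (\<lambda>s. x s \<omega>) (\<lambda>s. y s \<omega>) (k + m) (\<kappa> * 2 ^ m) - J (grid t k \<kappa>) \<omega>\<bar> \<le> \<epsilon>)" ..
  obtain m0 where m0: "\<And>\<kappa> m. m0 \<kappa> \<le> m \<Longrightarrow> off_small \<eta>' (\<lambda>\<omega>.
    \<bar>trapezoid_sum t (\<lambda>s. x s \<omega>) (\<lambda>s. y s \<omega>) (k + m) (\<kappa> * 2 ^ m) - J (grid t k \<kappa>) \<omega>\<bar> \<le> \<epsilon>)"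
    using choice[OF ex] by blast
  show ?thesis
  proof (intro exI[of _ "Max (m0 ` {..2 ^ k})"] allI impI)
    fix m assume m: "Max (m0 ` {..2 ^ k}) \<le> m"
    have "off_small (\<Sum>\<kappa>\<in>{..(2::nat) ^ k}. \<eta>') (\<lambda>\<omega>. \<forall>\<kappa>\<in>{..2 ^ k}.
      \<bar>trapezoid_sum t (\<lambda>s. x s \<omega>) (\<lambda>s. y s \<omega>) (k + m) (\<kappa> * 2 ^ m) - J (grid t k \<kappa>) \<omega>\<bar> \<le> \<epsilon>)"
      using m by (intro off_small_ball m0) auto
    moreover have "(\<Sum>\<kappa>\<in>{..(2::nat) ^ k}. \<eta>') = \<eta>"
    proof -
      have "(2::real) ^ k + 1 > 0" by (intro add_pos_pos) auto
      then show ?thesis by (simp add: \<eta>'_def field_simps)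
    qed
    ultimately show "off_small \<eta> (\<lambda>\<omega>. \<forall>\<kappa>\<le>2 ^ k.
      \<bar>trapezoid_sum t (\<lambda>s. x s \<omega>) (\<lambda>s. y s \<omega>) (k + m) (\<kappa> * 2 ^ m) - J (grid t k \<kappa>) \<omega>\<bar> \<le> \<epsilon>)"
      by (simp add: Ball_def)
  qed
qed

end

section \<open>The weighted defects vanish in probability\<close>

context wiener_space begin

lemma tame_off_small_osc:
  assumes "tame x" "0 \<le> t" "0 < \<eta>" "0 < \<epsilon>"
  shows "\<exists>k. off_small \<eta> (\<lambda>\<omega>. \<forall>s\<in>{0..t}. \<forall>u\<in>{0..t}. \<bar>s - u\<bar> \<le> t / 2 ^ k \<longrightarrow> \<bar>x s \<omega> - x u \<omega>\<bar> \<le> \<epsilon>)"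
  using assms off_small_osc[of x t \<eta> \<epsilon>] tame_measurable[of x] by (auto simp: tame_def)

lemma clamped_increment_measurable:
  assumes "tame x" "0 \<le> t"
  shows "(\<lambda>\<omega>. truncate c (x (grid t (n + m) j) \<omega> - x (grid t n (j div 2 ^ m)) \<omega>)) \<in> borel_measurable (F (grid t (n + m) j))"
proof -
  have "x (grid t (n + m) j) \<in> borel_measurable (F (grid t (n + m) j))"
    using assms grid_nonneg by (auto simp: tame_def adapted_def)
  moreover have "x (grid t n (j div 2 ^ m)) \<in> borel_measurable (F (grid t n (j div 2 ^ m)))"
    using assms grid_nonneg by (auto simp: tame_def adapted_def)
  then have "x (grid t n (j div 2 ^ m)) \<in> borel_measurable (F (grid t (n + m) j))"
    by (rule measurable_F_mono) (rule grid_div_le[OF assms(2)])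
  ultimately show ?thesis by measurable
qed

text \<open>By the isometry a block with integrand bounded by \<open>c\<close> has second moment at
  most \<open>c\<^sup>2\<close> times the length of its cell, so the expected sum is at most
  \<open>c\<^sup>2 * t\<close>. Since \<open>c\<close> only has to dominate the oscillation of
  \<open>x\<close> at level \<open>n\<close>, the estimate is uniform in \<open>m\<close>.\<close>

lemma ito_block_squares_small:
  assumes x: "tame x" and t: "0 < t" and "0 < \<epsilon>" "0 < \<eta>"
  shows "\<exists>n0. \<forall>n\<ge>n0. \<forall>m. off_small \<eta>
    (\<lambda>\<omega>. (\<Sum>i<2 ^ n. (ito_block t (\<lambda>s. x s \<omega>) (\<lambda>s. W s \<omega>) n m i)\<^sup>2) \<le> \<epsilon>)"
proof -
  \<comment> \<open>Makes \<open>c\<^sup>2 * t\<close> equal to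
    \<open>\<epsilon> * (\<eta> / 2)\<close>, as Markov's inequality requires; the other
    \<open>\<eta> / 2\<close> pays for the oscillation bound.\<close>
  define c where "c = sqrt (\<epsilon> * \<eta> / (2 * t))"
  have "0 < c" using assms by (simp add: c_def)
  have c: "c\<^sup>2 * t = \<epsilon> * (\<eta> / 2)" using assms by (simp add: c_def field_simps)
  obtain k where k: "off_small (\<eta>/2) (\<lambda>\<omega>. \<forall>s\<in>{0..t}. \<forall>u\<in>{0..t}. \<bar>s - u\<bar> \<le> t / 2 ^ k \<longrightarrow> \<bar>x s \<omega> - x u \<omega>\<bar> \<le> c)"
    using tame_off_small_osc[OF x, of t "\<eta>/2" c] t \<open>0 < \<eta>\<close> \<open>0 < c\<close> by auto
  show ?thesis
  proof (intro exI[of _ k] allI impI)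
    fix n m assume "k \<le> n"
    let ?DW = "\<lambda>j \<omega>. W (grid t (n + m) (Suc j)) \<omega> - W (grid t (n + m) j) \<omega>"
    define K where "K j \<omega> = truncate c (x (grid t (n + m) j) \<omega> - x (grid t n (j div 2 ^ m)) \<omega>)" for j \<omega>
    define V where "V i \<omega> = (\<Sum>j\<in>{i * 2 ^ m..<Suc i * 2 ^ m}. K j \<omega> * ?DW j \<omega>)" for i \<omega>
    have K: "K j \<in> borel_measurable (F (grid t (n + m) j))" "\<bar>K j \<omega>\<bar> \<le> c" for j \<omega>
      unfolding K_def using clamped_increment_measurable[OF x] t \<open>0 < c\<close> by (auto intro: abs_truncate)
    have V: "integrable M (\<lambda>\<omega>. (V i \<omega>)\<^sup>2)" "expectation (\<lambda>\<omega>. (V i \<omega>)\<^sup>2) \<le> c\<^sup>2 * (grid t n (Suc i) - grid t n i)" for i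
      unfolding V_def using ito_sum_grid[OF t K, of "i * 2 ^ m" "Suc i * 2 ^ m"] by (simp_all only: grid_refine) auto
    have "off_small (\<eta>/2) (\<lambda>\<omega>. (\<Sum>i<2 ^ n. (V i \<omega>)\<^sup>2) \<le> \<epsilon>)"
    proof (rule off_small_Markov[OF _ _ \<open>0 < \<epsilon>\<close>])
      show "integrable M (\<lambda>\<omega>. \<Sum>i<2 ^ n. (V i \<omega>)\<^sup>2)" by (intro Bochner_Integration.integrable_sum V)
      have "expectation (\<lambda>\<omega>. \<Sum>i<2 ^ n. (V i \<omega>)\<^sup>2) = (\<Sum>i<2 ^ n. expectation (\<lambda>\<omega>. (V i \<omega>)\<^sup>2))"
        by (intro Bochner_Integration.integral_sum V)
      also have "\<dots> \<le> (\<Sum>i<2 ^ n. c\<^sup>2 * (grid t n (Suc i) - grid t n i))"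
        by (intro sum_mono V)
      also have "\<dots> = c\<^sup>2 * t"
        by (simp add: sum_lessThan_telescope flip: sum_distrib_left)
      finally show "expectation (\<lambda>\<omega>. \<Sum>i<2 ^ n. (V i \<omega>)\<^sup>2) \<le> \<epsilon> * (\<eta> / 2)" using c by simp
    qed (simp add: sum_nonneg)
    from off_small_conj[OF k this]
    show "off_small \<eta> (\<lambda>\<omega>. (\<Sum>i<2 ^ n. (ito_block t (\<lambda>s. x s \<omega>) (\<lambda>s. W s \<omega>) n m i)\<^sup>2) \<le> \<epsilon>)"
    proof (rule off_small_mono)
      fix \<omega>
      assume *: "(\<forall>s\<in>{0..t}. \<forall>u\<in>{0..t}. \<bar>s - u\<bar> \<le> t / 2 ^ k \<longrightarrow> \<bar>x s \<omega> - x u \<omega>\<bar> \<le> c) \<and> (\<Sum>i<2 ^ n. (V i \<omega>)\<^sup>2) \<le> \<epsilon>"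
      then have osc: "\<forall>s\<in>{0..t}. \<forall>u\<in>{0..t}. \<bar>s - u\<bar> \<le> t / 2 ^ n \<longrightarrow> \<bar>x s \<omega> - x u \<omega>\<bar> \<le> c"
        using grid_level_mono[of t k n] \<open>k \<le> n\<close> t by fastforce
      have "ito_block t (\<lambda>s. x s \<omega>) (\<lambda>s. W s \<omega>) n m i = V i \<omega>" if "i < 2 ^ n" for i
        unfolding V_def K_def using ito_block_clamp[OF less_imp_le[OF t] that, of "\<lambda>s. x s \<omega>"] osc by simp
      then show "(\<Sum>i<2 ^ n. (ito_block t (\<lambda>s. x s \<omega>) (\<lambda>s. W s \<omega>) n m i)\<^sup>2) \<le> \<epsilon>"
        using * by simp
    qed simp
  qed
qed

text \<open>A weight known at the left end of its cell may be moved into the integrand, so the whole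
  weighted sum becomes a single Ito sum at level \<open>n + m\<close>. Its second moment is at most
  \<open>(b * c)\<^sup>2 * t\<close>, with no factor for the number of cells.\<close>

lemma ito_block_weighted_small:
  assumes x: "tame x" and t: "0 < t" and "0 < \<epsilon>" "0 < \<eta>" "0 < b"
    and v: "\<And>n i. k0 \<le> n \<Longrightarrow> v n i \<in> borel_measurable (F (grid t n i))" "\<And>n i \<omega>. \<bar>v n i \<omega>\<bar> \<le> b"
  shows "\<exists>n0. \<forall>n\<ge>n0. \<forall>m. off_small \<eta>
    (\<lambda>\<omega>. \<bar>\<Sum>i<2 ^ n. v n i \<omega> * ito_block t (\<lambda>s. x s \<omega>) (\<lambda>s. W s \<omega>) n m i\<bar> \<le> \<epsilon>)"
proof -
  define c where "c = \<epsilon> * sqrt (\<eta> / (2 * t)) / b"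
  have "0 < c" using assms by (simp add: c_def)
  have c: "(b * c)\<^sup>2 * t = \<epsilon>\<^sup>2 * (\<eta> / 2)" using assms by (simp add: c_def field_simps)
  obtain k where k: "off_small (\<eta>/2) (\<lambda>\<omega>. \<forall>s\<in>{0..t}. \<forall>u\<in>{0..t}. \<bar>s - u\<bar> \<le> t / 2 ^ k \<longrightarrow> \<bar>x s \<omega> - x u \<omega>\<bar> \<le> c)"
    using tame_off_small_osc[OF x, of t "\<eta>/2" c] t \<open>0 < \<eta>\<close> \<open>0 < c\<close> by auto
  show ?thesis
  proof (intro exI[of _ "max k k0"] allI impI)
    fix n m assume "max k k0 \<le> n"
    then have "k \<le> n" "k0 \<le> n" by auto
    let ?DW = "\<lambda>j \<omega>. W (grid t (n + m) (Suc j)) \<omega> - W (grid t (n + m) j) \<omega>"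
    define K where "K j \<omega> = v n (j div 2 ^ m) \<omega> * truncate c (x (grid t (n + m) j) \<omega> - x (grid t n (j div 2 ^ m)) \<omega>)" for j \<omega>
    have K1: "K j \<in> borel_measurable (F (grid t (n + m) j))" for j
    proof -
      have "v n (j div 2 ^ m) \<in> borel_measurable (F (grid t (n + m) j))"
        using v(1)[OF \<open>k0 \<le> n\<close>] by (rule measurable_F_mono) (rule grid_div_le[OF less_imp_le[OF t]])
      then show ?thesis
        unfolding K_def using clamped_increment_measurable[OF x less_imp_le[OF t]] by (intro borel_measurable_times)
    qed
    have K2: "\<bar>K j \<omega>\<bar> \<le> b * c" for j \<omega>
      unfolding K_def abs_mult using v(2) \<open>0 < c\<close> \<open>0 < b\<close> by (intro mult_mono abs_truncate) auto
    have "off_small (\<eta>/2) (\<lambda>\<omega>. (\<Sum>j\<in>{0..<2 ^ (n + m)}. K j \<omega> * ?DW j \<omega>)\<^sup>2 \<le> \<epsilon>\<^sup>2)"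
    proof (rule off_small_Markov)
      show "integrable M (\<lambda>\<omega>. (\<Sum>j\<in>{0..<2 ^ (n + m)}. K j \<omega> * ?DW j \<omega>)\<^sup>2)"
        by (rule ito_sum_grid(1)[OF t K1 K2]) simp
      show "expectation (\<lambda>\<omega>. (\<Sum>j\<in>{0..<2 ^ (n + m)}. K j \<omega> * ?DW j \<omega>)\<^sup>2) \<le> \<epsilon>\<^sup>2 * (\<eta> / 2)"
        using ito_sum_grid(2)[OF t K1 K2, where a=0 and c="2 ^ (n + m)"] c by simp
    qed (use \<open>0 < \<epsilon>\<close> in auto)
    from off_small_conj[OF k this]
    show "off_small \<eta> (\<lambda>\<omega>. \<bar>\<Sum>i<2 ^ n. v n i \<omega> * ito_block t (\<lambda>s. x s \<omega>) (\<lambda>s. W s \<omega>) n m i\<bar> \<le> \<epsilon>)"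
    proof (rule off_small_mono)
      fix \<omega>
      assume *: "(\<forall>s\<in>{0..t}. \<forall>u\<in>{0..t}. \<bar>s - u\<bar> \<le> t / 2 ^ k \<longrightarrow> \<bar>x s \<omega> - x u \<omega>\<bar> \<le> c) \<and>
        (\<Sum>j\<in>{0..<2 ^ (n + m)}. K j \<omega> * ?DW j \<omega>)\<^sup>2 \<le> \<epsilon>\<^sup>2"
      then have osc: "\<forall>s\<in>{0..t}. \<forall>u\<in>{0..t}. \<bar>s - u\<bar> \<le> t / 2 ^ n \<longrightarrow> \<bar>x s \<omega> - x u \<omega>\<bar> \<le> c"
        using grid_level_mono[of t k n] \<open>k \<le> n\<close> t by fastforce
      have "(\<Sum>i<2 ^ n. v n i \<omega> * ito_block t (\<lambda>s. x s \<omega>) (\<lambda>s. W s \<omega>) n m i) =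
          (\<Sum>i<2 ^ n. \<Sum>j\<in>{i * 2 ^ m..<Suc i * 2 ^ m}. K j \<omega> * ?DW j \<omega>)"
      proof (intro sum.cong refl)
        fix i :: nat assume "i \<in> {..<2 ^ n}"
        then have i: "i < 2 ^ n" by simp
        have "K j \<omega> = v n i \<omega> * truncate c (x (grid t (n + m) j) \<omega> - x (grid t n (j div 2 ^ m)) \<omega>)"
          if "j \<in> {i * 2 ^ m..<Suc i * 2 ^ m}" for j
        proof -
          have "j div 2 ^ m = i" using that by (intro div_nat_eqI) (auto simp: mult.commute)
          then show ?thesis by (simp add: K_def)
        qed
        then have "(\<Sum>j\<in>{i * 2 ^ m..<Suc i * 2 ^ m}. K j \<omega> * ?DW j \<omega>) = (\<Sum>j\<in>{i * 2 ^ m..<Suc i * 2 ^ m}.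
            v n i \<omega> * (truncate c (x (grid t (n + m) j) \<omega> - x (grid t n (j div 2 ^ m)) \<omega>) * ?DW j \<omega>))"
          by (intro sum.cong refl) (simp add: mult.assoc)
        then show "v n i \<omega> * ito_block t (\<lambda>s. x s \<omega>) (\<lambda>s. W s \<omega>) n m i =
            (\<Sum>j\<in>{i * 2 ^ m..<Suc i * 2 ^ m}. K j \<omega> * ?DW j \<omega>)"
          unfolding ito_block_clamp[OF less_imp_le[OF t] i osc] by (simp only: sum_distrib_left)
      qed
      also have "\<dots> = (\<Sum>j\<in>{0..<2 ^ (n + m)}. K j \<omega> * ?DW j \<omega>)"
        unfolding atLeast0LessThan by (rule sum_grid_blocks[symmetric])
      finally show "\<bar>\<Sum>i<2 ^ n. v n i \<omega> * ito_block t (\<lambda>s. x s \<omega>) (\<lambda>s. W s \<omega>) n m i\<bar> \<le> \<epsilon>"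
        using * \<open>0 < \<epsilon>\<close> by (simp only: abs_le_square_iff[symmetric]) auto
    qed simp
  qed
qed

lemma qv_tightD:
  assumes "tame x" "0 \<le> t" "0 < \<eta>"
  shows "\<exists>B>0. \<forall>n. off_small \<eta> (\<lambda>\<omega>. (\<Sum>j<2 ^ n. (x (grid t n (Suc j)) \<omega> - x (grid t n j) \<omega>)\<^sup>2) \<le> B)"
  using assms unfolding tame_def qv_tight_def by blast

text \<open>The order of choices is what matters: the bounds \<open>b\<close>, \<open>Bw\<close>,
  \<open>Bx\<close>, \<open>By\<close> depend on \<open>\<eta>\<close> alone; then \<open>d\<close>,
  \<open>a\<close> and \<open>e1\<close>; then the macroscopic level \<open>k\<close> from the
  oscillation of \<open>w\<close>; then \<open>e2\<close> and the threshold for \<open>n\<close>;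
  and for each such \<open>n\<close> finally \<open>e4\<close> and \<open>m\<close>.\<close>

lemma weighted_defect_vanishes:
  assumes w: "tame w" and x: "tame x" and t: "0 < t"
    and J: "\<And>s. 0 \<le> s \<Longrightarrow> stratonovich_limit x W s (J s)"
  shows "vanishes (\<lambda>n \<omega>. weighted_defect t (\<lambda>s. w s \<omega>) (\<lambda>s. x s \<omega>) (\<lambda>s. W s \<omega>) (\<lambda>s. J s \<omega>) n)"
  unfolding vanishes_def
proof (intro allI impI)
  fix \<epsilon> \<eta> :: real assume "0 < \<epsilon>" "0 < \<eta>"
  have t0: "0 \<le> t" using t by simp
  \<comment> \<open>Eleven events are intersected at the end; the bounds for \<open>x\<close> and
    \<open>W\<close> count twice, at the levels \<open>n\<close> and \<open>n + m\<close>.\<close>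
  define h where "h = \<eta> / 11"
  have h: "0 < h" using \<open>0 < \<eta>\<close> by (simp add: h_def)
  have wc: "continuous_process M w" using w by (simp add: tame_def)
  let ?qv = "\<lambda>z n \<omega>. \<Sum>j<2 ^ n. (z (grid t n (Suc j)) \<omega> - z (grid t n j) \<omega>)\<^sup>2"
  obtain b where b: "0 < b" "off_small h (\<lambda>\<omega>. \<forall>s\<in>{0..t}. \<bar>w s \<omega>\<bar> \<le> b)"
    using off_small_bounded[OF wc tame_measurable[OF w] t0 h] by blast
  obtain Bw where Bw: "0 < Bw" "\<And>n. off_small h (\<lambda>\<omega>. ?qv w n \<omega> \<le> Bw)" using qv_tightD[OF w t0 h] by blast
  obtain Bx where Bx: "0 < Bx" "\<And>n. off_small h (\<lambda>\<omega>. ?qv x n \<omega> \<le> Bx)" using qv_tightD[OF x t0 h] by blast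
  obtain By where By: "0 < By" "\<And>n. off_small h (\<lambda>\<omega>. ?qv W n \<omega> \<le> By)"
    using W_qv_tight[OF t] h unfolding qv_tight_def by blast
  \<comment> \<open>Each constant is solved for so that its term in
    \<open>weighted_defect_le\<close> is \<open>\<epsilon> / 5\<close>, or
    \<open>\<epsilon> / 10\<close> for the covariation term.\<close>
  define d where "d = 2 * \<epsilon> / (5 * Bw)"
  have d: "0 < d" using \<open>0 < \<epsilon>\<close> Bw(1) by (simp add: d_def)
  define a where "a = 2 * d * \<epsilon> / 5"
  have a: "0 < a" using d \<open>0 < \<epsilon>\<close> by (simp add: a_def)
  define e1 where "e1 = \<epsilon> / (5 * (Bx + By))"
  have e1: "0 < e1" using \<open>0 < \<epsilon>\<close> Bx(1) By(1) by (simp add: e1_def)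
  obtain k where k: "off_small h (\<lambda>\<omega>. \<forall>s\<in>{0..t}. \<forall>u\<in>{0..t}. \<bar>s - u\<bar> \<le> t / 2 ^ k \<longrightarrow> \<bar>w s \<omega> - w u \<omega>\<bar> \<le> e1)"
    using tame_off_small_osc[OF w t0 h e1] by blast
  define e2 where "e2 = \<epsilon> / (10 * b * 2 ^ k)"
  have e2: "0 < e2" using \<open>0 < \<epsilon>\<close> b(1) by (simp add: e2_def)
  obtain m0 where m0: "\<And>m. m0 \<le> m \<Longrightarrow> off_small h (\<lambda>\<omega>. \<forall>\<kappa>\<le>2 ^ k.
    \<bar>trapezoid_sum t (\<lambda>s. x s \<omega>) (\<lambda>s. W s \<omega>) (k + m) (\<kappa> * 2 ^ m) - J (grid t k \<kappa>) \<omega>\<bar> \<le> e2)"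
    using stratonovich_limit_grid[of x W J, OF J t0 e2 h] by blast
  \<comment> \<open>The truncation at \<open>2 * b\<close> makes the weights bounded for every
    \<open>\<omega>\<close> and is invisible where \<open>w\<close> is bounded by \<open>b\<close>.
    The natural subtraction \<open>n - k\<close> has its intended meaning only for
    \<open>k \<le> n\<close>, the range in which measurability is claimed.\<close>
  define v where "v n i \<omega> = truncate (2 * b) (w (grid t n i) \<omega> - w (grid t k (i div 2 ^ (n - k))) \<omega>)" for n i \<omega>
  have v1: "v n i \<in> borel_measurable (F (grid t n i))" if "k \<le> n" for n i
    using clamped_increment_measurable[OF w t0, of "2 * b" k "n - k" i] that unfolding v_def by simp
  have v2: "\<bar>v n i \<omega>\<bar> \<le> 2 * b" for n i \<omega>
    unfolding v_def using b(1) by (intro abs_truncate) simp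
  obtain n1 where n1: "\<And>n m. n1 \<le> n \<Longrightarrow> off_small h
      (\<lambda>\<omega>. \<bar>\<Sum>i<2 ^ n. v n i \<omega> * ito_block t (\<lambda>s. x s \<omega>) (\<lambda>s. W s \<omega>) n m i\<bar> \<le> \<epsilon> / 5)"
  proof -
    have "0 < \<epsilon> / 5" "0 < 2 * b" using \<open>0 < \<epsilon>\<close> b(1) by auto
    then show ?thesis
      using that ito_block_weighted_small[OF x t _ h _ v1 v2, of "\<epsilon> / 5" k] by blast
  qed
  obtain n2 where n2: "\<And>n m. n2 \<le> n \<Longrightarrow> off_small h
      (\<lambda>\<omega>. (\<Sum>i<2 ^ n. (ito_block t (\<lambda>s. x s \<omega>) (\<lambda>s. W s \<omega>) n m i)\<^sup>2) \<le> a)"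
    using ito_block_squares_small[OF x t a h] by blast
  show "\<exists>n0. \<forall>n\<ge>n0. off_small \<eta> (\<lambda>\<omega>. \<bar>weighted_defect t (\<lambda>s. w s \<omega>) (\<lambda>s. x s \<omega>) (\<lambda>s. W s \<omega>) (\<lambda>s. J s \<omega>) n\<bar> \<le> \<epsilon>)"
  proof (intro exI[of _ "Max {k + m0, n1, n2}"] allI impI)
    fix n assume n: "Max {k + m0, n1, n2} \<le> n"
    define m' where "m' = n - k"
    have m': "n = k + m'" "m0 \<le> m'" "n1 \<le> n" "n2 \<le> n" using n by (auto simp: m'_def)
    \<comment> \<open>This may shrink with \<open>n\<close>: the resulting \<open>m\<close> is
      unrestricted, because the estimates behind \<open>n1\<close>, \<open>n2\<close> and the bounds
      on squares hold for every \<open>m\<close>.\<close>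
    define e4 where "e4 = \<epsilon> / (20 * b * 2 ^ n)"
    have e4: "0 < e4" using \<open>0 < \<epsilon>\<close> b(1) by (simp add: e4_def)
    obtain m where m: "off_small h (\<lambda>\<omega>. \<forall>i\<le>2 ^ n.
      \<bar>trapezoid_sum t (\<lambda>s. x s \<omega>) (\<lambda>s. W s \<omega>) (n + m) (i * 2 ^ m) - J (grid t n i) \<omega>\<bar> \<le> e4)"
      using stratonovich_limit_grid[of x W J, OF J t0 e4 h, of n] by blast
    show "off_small \<eta> (\<lambda>\<omega>. \<bar>weighted_defect t (\<lambda>s. w s \<omega>) (\<lambda>s. x s \<omega>) (\<lambda>s. W s \<omega>) (\<lambda>s. J s \<omega>) n\<bar> \<le> \<epsilon>)"
    proof (rule off_small_mono[OF off_small_conj[OF b(2) off_small_conj[OF k off_small_conj[OF m0[OF m'(2)]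
          off_small_conj[OF m off_small_conj[OF n1[OF m'(3), of m] off_small_conj[OF n2[OF m'(4), of m]
          off_small_conj[OF Bw(2)[of n] off_small_conj[OF Bx(2)[of n] off_small_conj[OF Bx(2)[of "n + m"]
          off_small_conj[OF By(2)[of n] By(2)[of "n + m"]]]]]]]]]]]], goal_cases)
      case 1
      show ?case by (simp add: h_def)
    next
      case (2 \<omega>)
      then have bd: "\<forall>s\<in>{0..t}. \<bar>w s \<omega>\<bar> \<le> b" and i1: "\<bar>\<Sum>i<2 ^ n. v n i \<omega> * ito_block t (\<lambda>s. x s \<omega>) (\<lambda>s. W s \<omega>) n m i\<bar> \<le> \<epsilon> / 5"
        by blast+
      have "v n i \<omega> = w (grid t n i) \<omega> - w (grid t k (i div 2 ^ m')) \<omega>" if "i < 2 ^ n" for i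
      proof -
        have "i div 2 ^ m' \<le> 2 ^ k"
          using that unfolding m'(1) by (simp add: less_mult_imp_div_less less_imp_le power_add)
        then have "\<bar>w (grid t n i) \<omega>\<bar> \<le> b" "\<bar>w (grid t k (i div 2 ^ m')) \<omega>\<bar> \<le> b"
          using bd grid_in[OF t0, of i n] grid_in[OF t0, of "i div 2 ^ m'" k] that by auto
        then have "\<bar>w (grid t n i) \<omega> - w (grid t k (i div 2 ^ m')) \<omega>\<bar> \<le> 2 * b" by linarith
        then show ?thesis unfolding v_def m'_def by (rule truncate_eq)
      qed
      then have "\<bar>\<Sum>i<2 ^ n. (w (grid t n i) \<omega> - w (grid t k (i div 2 ^ m')) \<omega>) * ito_block t (\<lambda>s. x s \<omega>) (\<lambda>s. W s \<omega>) n m i\<bar> \<le> \<epsilon> / 5"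
        using i1 by simp
      then have "\<bar>weighted_defect t (\<lambda>s. w s \<omega>) (\<lambda>s. x s \<omega>) (\<lambda>s. W s \<omega>) (\<lambda>s. J s \<omega>) n\<bar>
          \<le> 2 ^ k * (b * (2 * e2)) + \<epsilon> / 5 + (d * Bw + a / d) / 4 + e1 * ((Bx + By) / 2) + 2 ^ n * (2 * b * (2 * e4))"
        using 2 m'(1) by (intro weighted_defect_le[where m = m and k = k and m' = m']) (use t0 d e1 in \<open>auto\<close>)
      also have "2 ^ k * (b * (2 * e2)) = \<epsilon> / 5" using b(1) by (simp add: e2_def)
      also have "(d * Bw + a / d) / 4 = \<epsilon> / 5" using d Bw(1) unfolding a_def by (simp add: d_def field_simps)
      also have "e1 * ((Bx + By) / 2) = \<epsilon> / 10" using Bx(1) By(1) by (simp add: e1_def field_simps)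
      also have "2 ^ n * (2 * b * (2 * e4)) = \<epsilon> / 5" using b(1) by (simp add: e4_def)
      finally show ?case using \<open>0 < \<epsilon>\<close> by simp
    qed
  qed
qed

end

section \<open>The product rule\<close>

lemma integral_grid:
  fixes f :: "real \<Rightarrow> real"
  assumes t: "0 \<le> t" and f: "continuous_on {0..t} f" and "i < 2 ^ n"
  shows "integral {0..grid t n (Suc i)} f - integral {0..grid t n i} f = integral {grid t n i..grid t n (Suc i)} f"
proof -
  have i: "0 \<le> grid t n i" "grid t n i \<le> grid t n (Suc i)" "grid t n (Suc i) \<le> t"
    using assms by (auto intro!: grid_nonneg grid_mono grid_le)
  have "f integrable_on {0..grid t n (Suc i)}"
    using i by (intro integrable_continuous_interval continuous_on_subset[OF f]) auto
  from Henstock_Kurzweil_Integration.integral_combine[OF i(1,2) this] show ?thesis by simp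
qed

text \<open>Replacing the mean of the two end values of \<open>y\<close> by \<open>y s\<close> costs
  at most \<open>e\<close> on each cell, hence at most \<open>e * b\<close> per unit of time in the
  integral.\<close>

lemma weighted_increments_integral:
  fixes y a :: "real \<Rightarrow> real"
  assumes t: "0 \<le> t" and y: "continuous_on {0..t} y" and a: "continuous_on {0..t} a" and "0 \<le> e"
    and b: "\<forall>s\<in>{0..t}. \<bar>a s\<bar> \<le> b"
    and osc: "\<forall>s\<in>{0..t}. \<forall>u\<in>{0..t}. \<bar>s - u\<bar> \<le> t / 2 ^ n \<longrightarrow> \<bar>y s - y u\<bar> \<le> e"
  shows "\<bar>(\<Sum>i<2 ^ n. (y (grid t n i) + y (grid t n (Suc i))) / 2 *
      (integral {0..grid t n (Suc i)} a - integral {0..grid t n i} a)) - integral {0..t} (\<lambda>s. y s * a s)\<bar> \<le> e * b * t"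
proof -
  let ?g = "grid t n"
  let ?ya = "\<lambda>s. y s * a s"
  have ya: "continuous_on {0..t} ?ya" by (intro continuous_on_mult y a)
  have "integral {0..t} ?ya = (\<Sum>i<2 ^ n. integral {0..?g (Suc i)} ?ya - integral {0..?g i} ?ya)"
    by (subst sum_lessThan_telescope) simp
  then have eq: "(\<Sum>i<2 ^ n. (y (?g i) + y (?g (Suc i))) / 2 * (integral {0..?g (Suc i)} a - integral {0..?g i} a)) - integral {0..t} ?ya
      = (\<Sum>i<2 ^ n. (y (?g i) + y (?g (Suc i))) / 2 * (integral {0..?g (Suc i)} a - integral {0..?g i} a)
          - (integral {0..?g (Suc i)} ?ya - integral {0..?g i} ?ya))"
    by (simp add: sum_subtractf)
  have "\<bar>\<Sum>i<2 ^ n. (y (?g i) + y (?g (Suc i))) / 2 * (integral {0..?g (Suc i)} a - integral {0..?g i} a)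
          - (integral {0..?g (Suc i)} ?ya - integral {0..?g i} ?ya)\<bar> \<le> (\<Sum>i<(2::nat) ^ n. e * b * (t / 2 ^ n))"
  proof (intro order_trans[OF sum_abs] sum_mono)
    fix i :: nat assume "i \<in> {..<2 ^ n}"
    then have i: "i < 2 ^ n" by simp
    let ?I = "{?g i..?g (Suc i)}"
    let ?m = "(y (?g i) + y (?g (Suc i))) / 2"
    have gi: "?g i \<in> {0..t}" "?g (Suc i) \<in> {0..t}" using i by (auto intro!: grid_in[OF t] simp del: atLeastAtMost_iff)
    then have sub: "?I \<subseteq> {0..t}" by auto
    note cont = continuous_on_subset[OF a sub] continuous_on_subset[OF y sub]
    have "?m * (integral {0..?g (Suc i)} a - integral {0..?g i} a) - (integral {0..?g (Suc i)} ?ya - integral {0..?g i} ?ya)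
        = ?m * integral ?I a - integral ?I ?ya" (is "?L = _")
      unfolding integral_grid[OF t a i] integral_grid[OF t ya i] ..
    also have "\<dots> = integral ?I (\<lambda>s. ?m * a s - ?ya s)"
      using cont by (subst Henstock_Kurzweil_Integration.integral_diff)
        (auto intro!: integrable_continuous_interval continuous_intros)
    finally have L: "?L = integral ?I (\<lambda>s. ?m * a s - ?ya s)" .
    have "\<bar>integral ?I (\<lambda>s. ?m * a s - ?ya s)\<bar> \<le> (e * b) * (?g (Suc i) - ?g i)"
    proof -
      have "norm (integral ?I (\<lambda>s. ?m * a s - ?ya s)) \<le> (e * b) * (?g (Suc i) - ?g i)"
      proof (rule integral_bound)
        show "?g i \<le> ?g (Suc i)" by (rule grid_mono[OF t]) simp
        show "continuous_on ?I (\<lambda>s. ?m * a s - ?ya s)" using cont by (intro continuous_intros)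
        fix s assume s: "s \<in> ?I"
        then have st: "s \<in> {0..t}" using sub by blast
        have "\<bar>?g i - s\<bar> \<le> t / 2 ^ n" "\<bar>?g (Suc i) - s\<bar> \<le> t / 2 ^ n"
          using s grid_Suc_diff[of t n i] by auto
        then have "\<bar>y (?g i) - y s\<bar> \<le> e" "\<bar>y (?g (Suc i)) - y s\<bar> \<le> e" using osc gi st by blast+
        then have "\<bar>?m - y s\<bar> \<le> e" by (simp add: abs_le_iff field_simps)
        then have "\<bar>?m - y s\<bar> * \<bar>a s\<bar> \<le> e * b" using b st \<open>0 \<le> e\<close> by (intro mult_mono) auto
        then show "norm (?m * a s - ?ya s) \<le> e * b" by (simp only: real_norm_def flip: abs_mult left_diff_distrib)
      qed
      then show ?thesis by simp
    qed
    then show "\<bar>?m * (integral {0..?g (Suc i)} a - integral {0..?g i} a) - (integral {0..?g (Suc i)} ?ya - integral {0..?g i} ?ya)\<bar>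
       \<le> e * b * (t / 2 ^ n)"
      unfolding L grid_Suc_diff .
  qed
  also have "\<dots> = e * b * t" by simp
  finally show ?thesis unfolding eq .
qed

lemma stratonovich_sum_component:
  fixes X :: "real \<Rightarrow> 'a \<Rightarrow> real^'n"
  shows "stratonovich_sum X Y n p \<omega> $ i = stratonovich_sum (\<lambda>s \<omega>. X s \<omega> $ i) Y n p \<omega>"
  by (simp add: stratonovich_sum_def sum_component)

lemma interval_partition_nonneg:
  assumes "interval_partition t n p" "i \<le> n"
  shows "0 \<le> p i"
  using assms(2)
proof (induction i)
  case (Suc i)
  then have "p i \<le> p (Suc i)" using assms(1) by (auto simp: interval_partition_def)
  with Suc show ?case by simp
qed (use assms(1) in \<open>simp add: interval_partition_def\<close>)

lemma borel_measurable_cart: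
  fixes f :: "'a \<Rightarrow> real^'n"
  assumes "\<And>i. (\<lambda>\<omega>. f \<omega> $ i) \<in> borel_measurable M"
  shows "f \<in> borel_measurable M"
proof (rule borel_measurable_euclidean_space[THEN iffD2], intro ballI)
  fix b :: "real^'n" assume "b \<in> Basis"
  then obtain i where "b = axis i 1" by (auto simp: Basis_vec_def)
  then show "(\<lambda>\<omega>. f \<omega> \<bullet> b) \<in> borel_measurable M" by (simp add: inner_axis assms)
qed

section \<open>Drift sums and the components of the stochastic integral\<close>

context prob_space begin

lemma weighted_increments_integral_vanishes:
  assumes y: "continuous_process M y" "\<And>s. 0 \<le> s \<Longrightarrow> y s \<in> borel_measurable M"
    and a: "continuous_process M a" "\<And>s. 0 \<le> s \<Longrightarrow> a s \<in> borel_measurable M"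
    and t: "0 < t"
  shows "vanishes (\<lambda>n \<omega>. (\<Sum>i<2 ^ n. (y (grid t n i) \<omega> + y (grid t n (Suc i)) \<omega>) / 2 *
      (integral {0..grid t n (Suc i)} (\<lambda>s. a s \<omega>) - integral {0..grid t n i} (\<lambda>s. a s \<omega>)))
      - integral {0..t} (\<lambda>s. y s \<omega> * a s \<omega>))"
  unfolding vanishes_def
proof (intro allI impI)
  fix \<epsilon> \<eta> :: real assume "0 < \<epsilon>" "0 < \<eta>"
  have t0: "0 \<le> t" using t by simp
  obtain b where b: "0 < b" "off_small (\<eta>/2) (\<lambda>\<omega>. \<forall>s\<in>{0..t}. \<bar>a s \<omega>\<bar> \<le> b)"
    using off_small_bounded[OF a t0, of "\<eta>/2"] \<open>0 < \<eta>\<close> by auto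
  define e where "e = \<epsilon> / (b * t)"
  have e: "0 < e" using \<open>0 < \<epsilon>\<close> b(1) t by (simp add: e_def)
  obtain k where k: "off_small (\<eta>/2) (\<lambda>\<omega>. \<forall>s\<in>{0..t}. \<forall>u\<in>{0..t}. \<bar>s - u\<bar> \<le> t / 2 ^ k \<longrightarrow> \<bar>y s \<omega> - y u \<omega>\<bar> \<le> e)"
    using off_small_osc[OF y t0, of "\<eta>/2" e] \<open>0 < \<eta>\<close> e by auto
  have cont: "AE \<omega> in M. continuous_on {0..t} (\<lambda>s. y s \<omega>) \<and> continuous_on {0..t} (\<lambda>s. a s \<omega>)"
    using y(1) a(1) unfolding continuous_process_def
    by eventually_elim (auto elim: continuous_on_subset)
  note ev = off_small_conj_AE[OF cont off_small_conj[OF b(2) k]]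
  show "\<exists>n0. \<forall>n\<ge>n0. off_small \<eta> (\<lambda>\<omega>. \<bar>(\<Sum>i<2 ^ n. (y (grid t n i) \<omega> + y (grid t n (Suc i)) \<omega>) / 2 *
      (integral {0..grid t n (Suc i)} (\<lambda>s. a s \<omega>) - integral {0..grid t n i} (\<lambda>s. a s \<omega>)))
      - integral {0..t} (\<lambda>s. y s \<omega> * a s \<omega>)\<bar> \<le> \<epsilon>)"
  proof (intro exI[of _ k] allI impI, rule off_small_mono[OF ev])
    fix n \<omega> assume "k \<le> n"
      and *: "(continuous_on {0..t} (\<lambda>s. y s \<omega>) \<and> continuous_on {0..t} (\<lambda>s. a s \<omega>)) \<and> (\<forall>s\<in>{0..t}. \<bar>a s \<omega>\<bar> \<le> b) \<and>
        (\<forall>s\<in>{0..t}. \<forall>u\<in>{0..t}. \<bar>s - u\<bar> \<le> t / 2 ^ k \<longrightarrow> \<bar>y s \<omega> - y u \<omega>\<bar> \<le> e)"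
    then have "\<forall>s\<in>{0..t}. \<forall>u\<in>{0..t}. \<bar>s - u\<bar> \<le> t / 2 ^ n \<longrightarrow> \<bar>y s \<omega> - y u \<omega>\<bar> \<le> e"
      using grid_level_mono[OF t0 \<open>k \<le> n\<close>] by fastforce
    then have "\<bar>(\<Sum>i<2 ^ n. (y (grid t n i) \<omega> + y (grid t n (Suc i)) \<omega>) / 2 *
      (integral {0..grid t n (Suc i)} (\<lambda>s. a s \<omega>) - integral {0..grid t n i} (\<lambda>s. a s \<omega>)))
      - integral {0..t} (\<lambda>s. y s \<omega> * a s \<omega>)\<bar> \<le> e * b * t"
      using * e t0 by (intro weighted_increments_integral) auto
    also have "\<dots> = \<epsilon>" using b(1) t by (simp add: e_def)
    finally show "\<bar>(\<Sum>i<2 ^ n. (y (grid t n i) \<omega> + y (grid t n (Suc i)) \<omega>) / 2 *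
      (integral {0..grid t n (Suc i)} (\<lambda>s. a s \<omega>) - integral {0..grid t n i} (\<lambda>s. a s \<omega>)))
      - integral {0..t} (\<lambda>s. y s \<omega> * a s \<omega>)\<bar> \<le> \<epsilon>" .
  qed simp
qed

text \<open>A component is bounded by the norm, so the exceptional set of the vector integral
  serves. Measurability of the processes enters because \<open>measure\<close> is 0 on
  non-measurable sets: only for measurable sums does the definition give a true exceptional
  set.\<close>

lemma stratonovich_limit_component:
  fixes X :: "real \<Rightarrow> 'a \<Rightarrow> real^'n"
  assumes J: "has_stratonovich_integral M X Y s J"
    and X: "\<And>s i. 0 \<le> s \<Longrightarrow> (\<lambda>\<omega>. X s \<omega> $ i) \<in> borel_measurable M"
    and Y: "\<And>s. 0 \<le> s \<Longrightarrow> Y s \<in> borel_measurable M"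
  shows "stratonovich_limit (\<lambda>s \<omega>. X s \<omega> $ i) Y s (\<lambda>\<omega>. J \<omega> $ i)"
  unfolding stratonovich_limit_def
proof (intro allI impI)
  fix \<epsilon> \<eta> :: real assume "0 < \<epsilon>" "0 < \<eta>"
  have "\<exists>\<delta>>0. \<forall>n p. interval_partition s n p \<and> (\<forall>i<n. p (Suc i) - p i < \<delta>) \<longrightarrow>
      measure M {\<omega> \<in> space M. norm (stratonovich_sum X Y n p \<omega> - J \<omega>) > \<epsilon>} < \<eta>"
    using conjunct2[OF iffD1[OF has_stratonovich_integral_def J], rule_format, OF \<open>0 < \<epsilon>\<close> \<open>0 < \<eta>\<close>] by simp
  then obtain \<delta> where "0 < \<delta>" and \<delta>: "\<And>n p. interval_partition s n p \<and> (\<forall>i<n. p (Suc i) - p i < \<delta>) \<Longrightarrow>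
      measure M {\<omega> \<in> space M. norm (stratonovich_sum X Y n p \<omega> - J \<omega>) > \<epsilon>} < \<eta>"
    by (elim exE conjE) blast
  have [measurable]: "J \<in> borel_measurable M" using J by (simp add: has_stratonovich_integral_def)
  show "\<exists>\<delta>>0. \<forall>n p. interval_partition s n p \<and> (\<forall>i<n. p (Suc i) - p i < \<delta>) \<longrightarrow>
      off_small \<eta> (\<lambda>\<omega>. \<bar>stratonovich_sum (\<lambda>s \<omega>. X s \<omega> $ i) Y n p \<omega> - J \<omega> $ i\<bar> \<le> \<epsilon>)"
  proof (intro exI[of _ \<delta>] conjI allI impI \<open>0 < \<delta>\<close>)
    fix n p assume p: "interval_partition s n p \<and> (\<forall>i<n. p (Suc i) - p i < \<delta>)"
    have m: "X (p j) \<in> borel_measurable M" "Y (p j) \<in> borel_measurable M" if "j \<le> n" for j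
      using interval_partition_nonneg[OF conjunct1[OF p] that] by (auto intro!: borel_measurable_cart X Y)
    have [measurable]: "stratonovich_sum X Y n p \<in> borel_measurable M"
      unfolding stratonovich_sum_def[abs_def]
      by (intro borel_measurable_sum borel_measurable_scaleR borel_measurable_diff borel_measurable_add
          borel_measurable_const m) auto
    show "off_small \<eta> (\<lambda>\<omega>. \<bar>stratonovich_sum (\<lambda>s \<omega>. X s \<omega> $ i) Y n p \<omega> - J \<omega> $ i\<bar> \<le> \<epsilon>)"
    proof (rule off_smallI[of "{\<omega> \<in> space M. norm (stratonovich_sum X Y n p \<omega> - J \<omega>) > \<epsilon>}"])
      show "{\<omega> \<in> space M. norm (stratonovich_sum X Y n p \<omega> - J \<omega>) > \<epsilon>} \<in> sets M" by measurable
      show "prob {\<omega> \<in> space M. norm (stratonovich_sum X Y n p \<omega> - J \<omega>) > \<epsilon>} \<le> \<eta>" using \<delta>[OF p] by simp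
      fix \<omega> assume "\<omega> \<in> space M" "\<omega> \<notin> {\<omega> \<in> space M. norm (stratonovich_sum X Y n p \<omega> - J \<omega>) > \<epsilon>}"
      then have "norm (stratonovich_sum X Y n p \<omega> - J \<omega>) \<le> \<epsilon>" by simp
      then show "\<bar>stratonovich_sum (\<lambda>s \<omega>. X s \<omega> $ i) Y n p \<omega> - J \<omega> $ i\<bar> \<le> \<epsilon>"
        using component_le_norm_cart[of "stratonovich_sum X Y n p \<omega> - J \<omega>" i]
        by (simp add: stratonovich_sum_component)
    qed
  qed
qed

text \<open>All sums of the zero process are 0. This removes the noise from components along the
  symmetry axis.\<close>

lemma stratonovich_limit_zero:
  assumes "stratonovich_limit (\<lambda>s \<omega>. 0) y s J" "0 \<le> s"
  shows "AE \<omega> in M. J \<omega> = 0"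
proof (rule AE_zero_if_off_small)
  fix \<epsilon> \<eta> :: real assume e: "0 < \<epsilon>" "0 < \<eta>"
  \<comment> \<open>\<open>stratonovich_limit_grid\<close> expects limits at all times, so
    \<open>J\<close> is padded with 0 elsewhere; at level 0 the index 1 is the time \<open>s\<close>
    itself.\<close>
  have "stratonovich_limit (\<lambda>s \<omega>. 0) y s' (if s' = s then J else (\<lambda>\<omega>. 0))" for s'
  proof (cases "s' = s")
    case False
    have "off_small \<eta> (\<lambda>\<omega>. True)" if "0 < \<eta>" for \<eta>
      using that by (intro off_smallI[of "{}"]) auto
    then have "stratonovich_limit (\<lambda>s \<omega>. 0) y s' (\<lambda>\<omega>. 0)"
      unfolding stratonovich_limit_def stratonovich_sum_def by (auto intro: exI[of _ 1])
    with False show ?thesis by simp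
  qed (use assms(1) in simp)
  then have "\<And>s'. 0 \<le> s' \<Longrightarrow> stratonovich_limit (\<lambda>s \<omega>. 0) y s' ((\<lambda>s'. if s' = s then J else (\<lambda>\<omega>. 0)) s')" .
  from stratonovich_limit_grid[OF this \<open>0 \<le> s\<close> e, of 0]
  obtain m where m: "off_small \<eta> (\<lambda>\<omega>. \<forall>\<kappa>\<le>2 ^ 0. \<bar>trapezoid_sum s (\<lambda>s. 0) (\<lambda>s. y s \<omega>) (0 + m) (\<kappa> * 2 ^ m)
      - (if grid s 0 \<kappa> = s then J else (\<lambda>\<omega>. 0)) \<omega>\<bar> \<le> \<epsilon>)" by blast
  show "off_small \<eta> (\<lambda>\<omega>. \<bar>J \<omega>\<bar> \<le> \<epsilon>)"
  proof (rule off_small_mono[OF m order_refl])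
    fix \<omega> assume "\<forall>\<kappa>\<le>2 ^ 0. \<bar>trapezoid_sum s (\<lambda>s. 0) (\<lambda>s. y s \<omega>) (0 + m) (\<kappa> * 2 ^ m)
      - (if grid s 0 \<kappa> = s then J else (\<lambda>\<omega>. 0)) \<omega>\<bar> \<le> \<epsilon>"
    from spec[OF this, of 1] show "\<bar>J \<omega>\<bar> \<le> \<epsilon>" by (simp add: trapezoid_sum_def grid_def)
  qed
qed

end

lemma cross_antisymmetric: "(\<Sum>i\<in>UNIV. q $ i * (c \<times> p) $ i + p $ i * (c \<times> q) $ i) = 0" for p q c :: "real^3"
  by (simp add: sum_3 cross_components algebra_simps)

text \<open>The noise terms cancel here because \<open>c \<times>\<close> is antisymmetric and the trapezoidal rule is linear.\<close>

lemma inner_increment_grid: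
  fixes x y jx jy :: "real \<Rightarrow> real^3" and vx vy :: "real \<Rightarrow> 3 \<Rightarrow> real" and t :: real and n :: nat
  defines "g \<equiv> grid t n"
  assumes x: "\<And>k i. x (g k) $ i - x 0 $ i + jx (g k) $ i = vx (g k) i"
    and y: "\<And>k i. y (g k) $ i - y 0 $ i + jy (g k) $ i = vy (g k) i"
  shows "x t \<bullet> y t - x 0 \<bullet> y 0 = (\<Sum>i\<in>UNIV.
      (\<Sum>k<2 ^ n. (y (g k) $ i + y (g (Suc k)) $ i) / 2 * (vx (g (Suc k)) i - vx (g k) i))
    + (\<Sum>k<2 ^ n. (x (g k) $ i + x (g (Suc k)) $ i) / 2 * (vy (g (Suc k)) i - vy (g k) i))
    - weighted_defect t (\<lambda>s. y s $ i) (\<lambda>s. (c \<times> x s) $ i) W (\<lambda>s. jx s $ i) n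
    - weighted_defect t (\<lambda>s. x s $ i) (\<lambda>s. (c \<times> y s) $ i) W (\<lambda>s. jy s $ i) n)"
    (is "_ = ?R")
proof -
  let ?d = "\<lambda>k. W (g (Suc k)) - W (g k)"
  let ?p = "\<lambda>k. x (g k) + x (g (Suc k))" and ?q = "\<lambda>k. y (g k) + y (g (Suc k))"
  have "?R = (\<Sum>i\<in>UNIV. \<Sum>k<2 ^ n. (x (g (Suc k)) $ i * y (g (Suc k)) $ i - x (g k) $ i * y (g k) $ i)
      + ?d k / 4 * (?q k $ i * (c \<times> ?p k) $ i + ?p k $ i * (c \<times> ?q k) $ i))"
    unfolding weighted_defect_def stratonovich_defect_def g_def[symmetric]
      sum.distrib[symmetric] sum_subtractf[symmetric]
  proof (intro sum.cong refl)
    fix i k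
    have jx: "jx (g k) $ i = vx (g k) i - x (g k) $ i + x 0 $ i" for k using x[of k i] by simp
    have jy: "jy (g k) $ i = vy (g k) i - y (g k) $ i + y 0 $ i" for k using y[of k i] by simp
    show "(y (g k) $ i + y (g (Suc k)) $ i) / 2 * (vx (g (Suc k)) i - vx (g k) i)
        + (x (g k) $ i + x (g (Suc k)) $ i) / 2 * (vy (g (Suc k)) i - vy (g k) i)
        - (y (g k) $ i + y (g (Suc k)) $ i) / 2 * (jx (g (Suc k)) $ i - jx (g k) $ i
            - ?d k * (((c \<times> x (g k)) $ i + (c \<times> x (g (Suc k))) $ i) / 2))
        - (x (g k) $ i + x (g (Suc k)) $ i) / 2 * (jy (g (Suc k)) $ i - jy (g k) $ i
            - ?d k * (((c \<times> y (g k)) $ i + (c \<times> y (g (Suc k))) $ i) / 2))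
      = (x (g (Suc k)) $ i * y (g (Suc k)) $ i - x (g k) $ i * y (g k) $ i)
      + ?d k / 4 * (?q k $ i * (c \<times> ?p k) $ i + ?p k $ i * (c \<times> ?q k) $ i)"
      unfolding jx jy by (simp add: cross_add_right field_simps)
  qed
  \<comment> \<open>The noise in a single component need not cancel; the sum over \<open>i\<close>
    must be innermost for antisymmetry to act on each cell.\<close>
  also have "\<dots> = (\<Sum>k<2 ^ n. \<Sum>i\<in>UNIV. (x (g (Suc k)) $ i * y (g (Suc k)) $ i - x (g k) $ i * y (g k) $ i)
      + ?d k / 4 * (?q k $ i * (c \<times> ?p k) $ i + ?p k $ i * (c \<times> ?q k) $ i))"
    by (rule sum.swap)
  also have "\<dots> = (\<Sum>k<2 ^ n. x (g (Suc k)) \<bullet> y (g (Suc k)) - x (g k) \<bullet> y (g k))"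
  proof (intro sum.cong refl)
    fix k
    have "(\<Sum>i\<in>UNIV. (x (g (Suc k)) $ i * y (g (Suc k)) $ i - x (g k) $ i * y (g k) $ i)
        + ?d k / 4 * (?q k $ i * (c \<times> ?p k) $ i + ?p k $ i * (c \<times> ?q k) $ i))
      = (\<Sum>i\<in>UNIV. x (g (Suc k)) $ i * y (g (Suc k)) $ i - x (g k) $ i * y (g k) $ i)
        + ?d k / 4 * (\<Sum>i\<in>UNIV. ?q k $ i * (c \<times> ?p k) $ i + ?p k $ i * (c \<times> ?q k) $ i)"
      unfolding sum_distrib_left by (rule sum.distrib)
    then show "(\<Sum>i\<in>UNIV. (x (g (Suc k)) $ i * y (g (Suc k)) $ i - x (g k) $ i * y (g k) $ i)
        + ?d k / 4 * (?q k $ i * (c \<times> ?p k) $ i + ?p k $ i * (c \<times> ?q k) $ i))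
      = x (g (Suc k)) \<bullet> y (g (Suc k)) - x (g k) \<bullet> y (g k)"
      unfolding cross_antisymmetric by (simp add: inner_vec_def sum_subtractf)
  qed
  also have "\<dots> = x t \<bullet> y t - x 0 \<bullet> y 0"
    using sum_lessThan_telescope[of "\<lambda>k. x (g k) \<bullet> y (g k)" "2 ^ n"] by (simp add: g_def)
  finally show ?thesis by simp
qed

text \<open>The dyadic times are countable, so one null set suffices for all levels.\<close>

lemma AE_grid:
  fixes t :: real
  assumes "0 \<le> t" "\<And>s. 0 \<le> s \<Longrightarrow> AE \<omega> in M. Q s \<omega>"
  shows "AE \<omega> in M. \<forall>n k. Q (grid t n k) \<omega>"
  unfolding AE_all_countable by (intro allI assms(2) grid_nonneg assms(1))

context wiener_space begin

text \<open>Every level \<open>n\<close> writes the same increment of \<open>X \<bullet> Y\<close>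
  as drift sums minus weighted defects. The former converge to the integrals and the latter vanish,
  and the noise is already gone by exact cancellation on each cell.\<close>

theorem stratonovich_product_rule:
  fixes X Y \<alpha> \<beta> JX JY :: "real \<Rightarrow> 'a \<Rightarrow> real^3"
  assumes t: "0 < t"
    and X: "\<And>i. tame (\<lambda>s \<omega>. X s \<omega> $ i)" and Y: "\<And>i. tame (\<lambda>s \<omega>. Y s \<omega> $ i)"
    and \<alpha>: "\<And>i. continuous_process M (\<lambda>s \<omega>. \<alpha> s \<omega> $ i)" "\<And>i s. 0 \<le> s \<Longrightarrow> (\<lambda>\<omega>. \<alpha> s \<omega> $ i) \<in> borel_measurable M"
    and \<beta>: "\<And>i. continuous_process M (\<lambda>s \<omega>. \<beta> s \<omega> $ i)" "\<And>i s. 0 \<le> s \<Longrightarrow> (\<lambda>\<omega>. \<beta> s \<omega> $ i) \<in> borel_measurable M"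
    and JX: "\<And>s. 0 \<le> s \<Longrightarrow> has_stratonovich_integral M (\<lambda>s \<omega>. c \<times> X s \<omega>) W s (JX s)"
    and JY: "\<And>s. 0 \<le> s \<Longrightarrow> has_stratonovich_integral M (\<lambda>s \<omega>. c \<times> Y s \<omega>) W s (JY s)"
    and eqX: "\<And>s i. 0 \<le> s \<Longrightarrow> AE \<omega> in M. X s \<omega> $ i - X 0 \<omega> $ i + JX s \<omega> $ i = integral {0..s} (\<lambda>u. \<alpha> u \<omega> $ i)"
    and eqY: "\<And>s i. 0 \<le> s \<Longrightarrow> AE \<omega> in M. Y s \<omega> $ i - Y 0 \<omega> $ i + JY s \<omega> $ i = integral {0..s} (\<lambda>u. \<beta> u \<omega> $ i)"
  shows "AE \<omega> in M. X t \<omega> \<bullet> Y t \<omega> - X 0 \<omega> \<bullet> Y 0 \<omega> = integral {0..t} (\<lambda>s. Y s \<omega> \<bullet> \<alpha> s \<omega> + X s \<omega> \<bullet> \<beta> s \<omega>)"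
proof -
  have cross_tame: "tame (\<lambda>s \<omega>. (c \<times> Z s \<omega>) $ i)" if Z: "\<And>i. tame (\<lambda>s \<omega>. Z s \<omega> $ i)" for Z i
  proof -
    have *: "tame (\<lambda>s \<omega>. a * Z s \<omega> $ j + b * Z s \<omega> $ k)" for a b j k by (intro tame_add tame_scale Z)
    have "i = 1 \<or> i = 2 \<or> i = 3" by (rule exhaust_3)
    then show ?thesis
      using *[of "c $ 2" 3 "- c $ 3" 2] *[of "c $ 3" 1 "- c $ 1" 3] *[of "c $ 1" 2 "- c $ 2" 1]
      by (auto simp: cross_components algebra_simps)
  qed
  have Wm: "W s \<in> borel_measurable M" if "0 \<le> s" for s using W_measurable[OF that] by (rule measurable_F_M)
  have limit: "stratonovich_limit (\<lambda>s \<omega>. (c \<times> Z s \<omega>) $ i) W s (\<lambda>\<omega>. J \<omega> $ i)"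
    if "\<And>i. tame (\<lambda>s \<omega>. Z s \<omega> $ i)" "has_stratonovich_integral M (\<lambda>s \<omega>. c \<times> Z s \<omega>) W s J" for Z J s i
    using that(2) tame_measurable[OF cross_tame[OF that(1)]] Wm by (rule stratonovich_limit_component)
  let ?g = "\<lambda>n. grid t n"
  let ?DX = "\<lambda>i n \<omega>. weighted_defect t (\<lambda>s. Y s \<omega> $ i) (\<lambda>s. (c \<times> X s \<omega>) $ i) (\<lambda>s. W s \<omega>) (\<lambda>s. JX s \<omega> $ i) n"
  let ?DY = "\<lambda>i n \<omega>. weighted_defect t (\<lambda>s. X s \<omega> $ i) (\<lambda>s. (c \<times> Y s \<omega>) $ i) (\<lambda>s. W s \<omega>) (\<lambda>s. JY s \<omega> $ i) n"
  let ?VX = "\<lambda>s i \<omega>. integral {0..s} (\<lambda>u. \<alpha> u \<omega> $ i)"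
  let ?VY = "\<lambda>s i \<omega>. integral {0..s} (\<lambda>u. \<beta> u \<omega> $ i)"
  let ?RX = "\<lambda>i n \<omega>. \<Sum>k<2 ^ n. (Y (?g n k) \<omega> $ i + Y (?g n (Suc k)) \<omega> $ i) / 2 * (?VX (?g n (Suc k)) i \<omega> - ?VX (?g n k) i \<omega>)"
  let ?RY = "\<lambda>i n \<omega>. \<Sum>k<2 ^ n. (X (?g n k) \<omega> $ i + X (?g n (Suc k)) \<omega> $ i) / 2 * (?VY (?g n (Suc k)) i \<omega> - ?VY (?g n k) i \<omega>)"
  let ?IX = "\<lambda>i \<omega>. integral {0..t} (\<lambda>s. Y s \<omega> $ i * \<alpha> s \<omega> $ i)"
  let ?IY = "\<lambda>i \<omega>. integral {0..t} (\<lambda>s. X s \<omega> $ i * \<beta> s \<omega> $ i)"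
  have DX: "vanishes (?DX i)" for i
    by (rule weighted_defect_vanishes[OF Y cross_tame[OF X] t]) (rule limit[OF X JX])
  have DY: "vanishes (?DY i)" for i
    by (rule weighted_defect_vanishes[OF X cross_tame[OF Y] t]) (rule limit[OF Y JY])
  have RX: "vanishes (\<lambda>n \<omega>. ?RX i n \<omega> - ?IX i \<omega>)" for i
    using Y[of i] tame_measurable[OF Y[of i]]
    by (intro weighted_increments_integral_vanishes \<alpha> t) (auto simp: tame_def)
  have RY: "vanishes (\<lambda>n \<omega>. ?RY i n \<omega> - ?IY i \<omega>)" for i
    using X[of i] tame_measurable[OF X[of i]]
    by (intro weighted_increments_integral_vanishes \<beta> t) (auto simp: tame_def)
  have vanish: "vanishes (\<lambda>n \<omega>. \<Sum>i\<in>UNIV. (?RX i n \<omega> - ?IX i \<omega>) + (?RY i n \<omega> - ?IY i \<omega>) + - ?DX i n \<omega> + - ?DY i n \<omega>)"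
    by (intro vanishes_sum vanishes_add vanishes_minus DX DY RX RY finite)
  have "AE \<omega> in M. \<forall>i. \<forall>n k. X (?g n k) \<omega> $ i - X 0 \<omega> $ i + JX (?g n k) \<omega> $ i = ?VX (?g n k) i \<omega>"
    by (subst AE_all_countable) (intro allI AE_grid eqX, use t in auto)
  moreover have "AE \<omega> in M. \<forall>i. \<forall>n k. Y (?g n k) \<omega> $ i - Y 0 \<omega> $ i + JY (?g n k) \<omega> $ i = ?VY (?g n k) i \<omega>"
    by (subst AE_all_countable) (intro allI AE_grid eqY, use t in auto)
  ultimately have grid_eq: "AE \<omega> in M. \<forall>n. X t \<omega> \<bullet> Y t \<omega> - X 0 \<omega> \<bullet> Y 0 \<omega> =
      (\<Sum>i\<in>UNIV. ?RX i n \<omega> + ?RY i n \<omega> - ?DX i n \<omega> - ?DY i n \<omega>)"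
  proof eventually_elim
    case (elim \<omega>)
    show ?case
    proof
      fix n
      show "X t \<omega> \<bullet> Y t \<omega> - X 0 \<omega> \<bullet> Y 0 \<omega> = (\<Sum>i\<in>UNIV. ?RX i n \<omega> + ?RY i n \<omega> - ?DX i n \<omega> - ?DY i n \<omega>)"
        by (rule inner_increment_grid[where x="\<lambda>s. X s \<omega>" and y="\<lambda>s. Y s \<omega>" and jx="\<lambda>s. JX s \<omega>" and jy="\<lambda>s. JY s \<omega>"
              and vx="\<lambda>s i. ?VX s i \<omega>" and vy="\<lambda>s i. ?VY s i \<omega>"]) (use elim in blast)+
    qed
  qed
  \<comment> \<open>The expression does not depend on \<open>n\<close>; by \<open>grid_eq\<close> it
    is almost surely the error of level \<open>n\<close>.\<close>
  have "vanishes (\<lambda>n \<omega>. X t \<omega> \<bullet> Y t \<omega> - X 0 \<omega> \<bullet> Y 0 \<omega> - (\<Sum>i\<in>UNIV. ?IX i \<omega> + ?IY i \<omega>))"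
  proof (rule vanishes_cong_AE[OF _ vanish])
    fix n
    show "AE \<omega> in M. (\<Sum>i\<in>UNIV. (?RX i n \<omega> - ?IX i \<omega>) + (?RY i n \<omega> - ?IY i \<omega>) + - ?DX i n \<omega> + - ?DY i n \<omega>)
        = X t \<omega> \<bullet> Y t \<omega> - X 0 \<omega> \<bullet> Y 0 \<omega> - (\<Sum>i\<in>UNIV. ?IX i \<omega> + ?IY i \<omega>)"
      using grid_eq
    proof eventually_elim
      case (elim \<omega>)
      show ?case
        unfolding elim[rule_format, of n] sum_subtractf[symmetric]
        by (intro sum.cong refl) simp
    qed
  qed
  then have "AE \<omega> in M. X t \<omega> \<bullet> Y t \<omega> - X 0 \<omega> \<bullet> Y 0 \<omega> - (\<Sum>i\<in>UNIV. ?IX i \<omega> + ?IY i \<omega>) = 0"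
    by (rule vanishes_const)
  moreover have cont: "AE \<omega> in M. \<forall>i. continuous_on {0..} (\<lambda>s. X s \<omega> $ i) \<and> continuous_on {0..} (\<lambda>s. Y s \<omega> $ i)
      \<and> continuous_on {0..} (\<lambda>s. \<alpha> s \<omega> $ i) \<and> continuous_on {0..} (\<lambda>s. \<beta> s \<omega> $ i)"
    unfolding AE_all_countable using X Y \<alpha>(1) \<beta>(1) by (auto simp: tame_def continuous_process_def)
  ultimately show ?thesis
  proof eventually_elim
    case (elim \<omega>)
    have sub: "{0..t} \<subseteq> {0..}" by auto
    have "integral {0..t} (\<lambda>s. Y s \<omega> \<bullet> \<alpha> s \<omega> + X s \<omega> \<bullet> \<beta> s \<omega>)
        = integral {0..t} (\<lambda>s. \<Sum>i\<in>UNIV. Y s \<omega> $ i * \<alpha> s \<omega> $ i + X s \<omega> $ i * \<beta> s \<omega> $ i)"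
      by (simp add: inner_vec_def sum.distrib)
    also have "\<dots> = (\<Sum>i\<in>UNIV. ?IX i \<omega> + ?IY i \<omega>)"
    proof -
      have int: "(\<lambda>s. Y s \<omega> $ i * \<alpha> s \<omega> $ i) integrable_on {0..t}" "(\<lambda>s. X s \<omega> $ i * \<beta> s \<omega> $ i) integrable_on {0..t}" for i
        using elim(2) by (auto intro!: integrable_continuous_interval continuous_on_mult continuous_on_subset[OF _ sub])
      show ?thesis
        by (subst integral_sum) (auto intro!: integrable_add int simp: integral_add[OF int])
    qed
    finally show ?case using elim(1) by simp
  qed
qed

end

text \<open>Almost sure equality at each time leaves a null set that may depend on the time. The
  rational times share one, and continuity of the path extends the equality to all times.\<close>

lemma conserved_from_fixed_times:
  fixes z :: "real \<Rightarrow> 'a \<Rightarrow> real"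
  assumes c: "AE \<omega> in M. continuous_on {0..} (\<lambda>t. z t \<omega>)" and eq: "\<And>t. 0 < t \<Longrightarrow> AE \<omega> in M. z t \<omega> = z 0 \<omega>"
  shows "AE \<omega> in M. \<forall>t\<ge>0. z t \<omega> = z 0 \<omega>"
proof -
  have eq': "AE \<omega> in M. z q \<omega> = z 0 \<omega>" if "q \<in> {0..} \<inter> \<rat>" for q
    using eq[of q] that by (cases "q = 0") auto
  have "AE \<omega> in M. \<forall>q\<in>{0..} \<inter> \<rat>. z q \<omega> = z 0 \<omega>"
    by (subst AE_ball_countable) (auto intro: countable_rat countable_Int2 eq')
  with c show ?thesis
  proof eventually_elim
    case (elim \<omega>)
    show ?case
    proof (intro allI impI)
      fix t :: real assume "0 \<le> t"
      \<comment> \<open>An integer endpoint is rational, so equality is known there, as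
        \<open>bound_from_rationals\<close> demands of its endpoint.\<close>
      obtain N :: nat where N: "t \<le> real N" using real_arch_simple by blast
      have "\<bar>z t \<omega> - z 0 \<omega>\<bar> \<le> 0"
      proof (rule bound_from_rationals[where t="real N" and f="\<lambda>s. z s \<omega> - z 0 \<omega>"])
        show "continuous_on {0..real N} (\<lambda>s. z s \<omega> - z 0 \<omega>)"
          by (intro continuous_intros continuous_on_subset[OF elim(1)]) auto
        show "\<bar>z q \<omega> - z 0 \<omega>\<bar> \<le> 0" if "q \<in> insert (real N) ({0..real N} \<inter> \<rat>)" for q
        proof -
          have "q \<in> {0..} \<inter> \<rat>" using that by auto
          with elim(2) have "z q \<omega> = z 0 \<omega>" by (rule bspec)
          then show ?thesis by simp
        qed
      qed (use \<open>0 \<le> t\<close> N in auto)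
      then show "z t \<omega> = z 0 \<omega>" by simp
    qed
  qed
qed

section \<open>The Lagrange top\<close>

lemma matrix_inv_eqI:
  fixes A B :: "real^'n^'n"
  assumes "A ** B = mat 1" "B ** A = mat 1"
  shows "matrix_inv A = B"
proof -
  have "A ** matrix_inv A = mat 1 \<and> matrix_inv A ** A = mat 1"
    unfolding matrix_inv_def by (rule someI[of _ B]) (use assms in simp)
  then have "matrix_inv A = (matrix_inv A ** A) ** B"
    by (metis assms(1) matrix_mul_assoc matrix_mul_rid)
  with \<open>A ** matrix_inv A = mat 1 \<and> matrix_inv A ** A = mat 1\<close> show ?thesis by simp
qed

lemma angular_velocity_lagrange:
  assumes "I1 \<noteq> 0" "I3 \<noteq> 0"
  shows "angular_velocity (lagrange_inertia I1 I3) v = vector [v $ 1 / I1, v $ 2 / I1, v $ 3 / I3]"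
proof -
  have "matrix_inv (lagrange_inertia I1 I3) = (\<chi> i j. if i = j then (vector [1 / I1, 1 / I1, 1 / I3] :: real^3) $ i else 0)"
    using assms by (intro matrix_inv_eqI)
      (simp_all add: lagrange_inertia_def matrix_matrix_mult_def mat_def vec_eq_iff forall_3 sum_3)
  then show ?thesis
    by (simp add: angular_velocity_def matrix_vector_mult_def vec_eq_iff forall_3 sum_3)
qed

lemma lagrange_axis_components [simp]:
  "lagrange_axis k $ 1 = 0" "lagrange_axis k $ 2 = 0" "lagrange_axis k $ 3 = k"
  by (simp_all add: lagrange_axis_def)

theorem mainTheorem10:
  fixes M :: "'a measure" and F :: "real \<Rightarrow> 'a measure" and W :: "real \<Rightarrow> 'a \<Rightarrow> real"
    and P G :: "real \<Rightarrow> 'a \<Rightarrow> real^3"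
    and I\<^sub>1 I\<^sub>3 m g c\<^sub>3 :: real
  assumes "0 < I\<^sub>1" and "0 < I\<^sub>3"
    and "filtered_prob_space M F"
    and "wiener_process M F W"
    and "stochastic_heavy_top_solution M F W (lagrange_inertia I\<^sub>1 I\<^sub>3) m g
           (lagrange_axis c\<^sub>3) (lagrange_axis c\<^sub>3) P G"
  shows "conserved M P G (\<lambda>p q. p \<bullet> lagrange_axis c\<^sub>3) \<and>
         conserved M P G (heavy_top_energy (lagrange_inertia I\<^sub>1 I\<^sub>3) m g (lagrange_axis c\<^sub>3)) \<and>
         conserved M P G (\<lambda>p q. (norm q)\<^sup>2) \<and>
         conserved M P G (\<lambda>p q. p \<bullet> q)"
proof -
  have "prob_space M" using assms(3) by (simp add: filtered_prob_space_def)
  then interpret wiener_space M F W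
    by (intro wiener_space.intro filtered_space.intro filtered_space_axioms.intro wiener_space_axioms.intro assms(3,4))
  let ?K = "lagrange_inertia I\<^sub>1 I\<^sub>3" and ?c = "lagrange_axis c\<^sub>3"
  \<comment> \<open>\<open>a\<close> and \<open>b\<close> are the drifts of \<open>P\<close> and
    \<open>G\<close> after being moved to the right side of the equations, hence the signs.\<close>
  define a where "a s \<omega> = (m * g) *\<^sub>R (G s \<omega> \<times> ?c) - angular_velocity ?K (P s \<omega>) \<times> P s \<omega>" for s \<omega>
  define b where "b s \<omega> = - (angular_velocity ?K (P s \<omega>) \<times> G s \<omega>)" for s \<omega>
  have ang: "angular_velocity ?K v = vector [v $ 1 / I\<^sub>1, v $ 2 / I\<^sub>1, v $ 3 / I\<^sub>3]" for v
    using assms(1,2) by (intro angular_velocity_lagrange) auto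
  have a_comp: "a s \<omega> $ 1 = m * g * (G s \<omega> $ 2 * c\<^sub>3) - (P s \<omega> $ 2 / I\<^sub>1 * P s \<omega> $ 3 - P s \<omega> $ 3 / I\<^sub>3 * P s \<omega> $ 2)"
      "a s \<omega> $ 2 = - (m * g * (G s \<omega> $ 1 * c\<^sub>3)) - (P s \<omega> $ 3 / I\<^sub>3 * P s \<omega> $ 1 - P s \<omega> $ 1 / I\<^sub>1 * P s \<omega> $ 3)"
      "a s \<omega> $ 3 = 0" for s \<omega>
    by (simp_all add: a_def ang cross_components)
  have b_comp: "b s \<omega> $ 1 = P s \<omega> $ 3 / I\<^sub>3 * G s \<omega> $ 2 - P s \<omega> $ 2 / I\<^sub>1 * G s \<omega> $ 3"
      "b s \<omega> $ 2 = P s \<omega> $ 1 / I\<^sub>1 * G s \<omega> $ 3 - P s \<omega> $ 3 / I\<^sub>3 * G s \<omega> $ 1"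
      "b s \<omega> $ 3 = P s \<omega> $ 2 / I\<^sub>1 * G s \<omega> $ 1 - P s \<omega> $ 1 / I\<^sub>1 * G s \<omega> $ 2" for s \<omega>
    by (simp_all add: b_def ang cross_components)
  note sol = assms(5)[unfolded stochastic_heavy_top_solution_def]
  have P: "tame (\<lambda>s \<omega>. P s \<omega> $ i)" and G: "tame (\<lambda>s \<omega>. G s \<omega> $ i)" for i
    using sol by (auto intro: tame_semimartingale)
  note pm = tame_measurable[OF P] and qm = tame_measurable[OF G]
  have cont: "AE \<omega> in M. (\<forall>i. continuous_on {0..} (\<lambda>s. P s \<omega> $ i)) \<and> (\<forall>i. continuous_on {0..} (\<lambda>s. G s \<omega> $ i))"
    unfolding AE_conj_iff AE_all_countable using P G by (auto simp: tame_def continuous_process_def)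
  have cont_ab: "AE \<omega> in M. (\<forall>i. continuous_on {0..} (\<lambda>s. a s \<omega> $ i)) \<and> (\<forall>i. continuous_on {0..} (\<lambda>s. b s \<omega> $ i))"
    using cont
  proof eventually_elim
    case (elim \<omega>)
    then have p: "continuous_on {0..} (\<lambda>s. P s \<omega> $ i)" and q: "continuous_on {0..} (\<lambda>s. G s \<omega> $ i)" for i
      by blast+
    show ?case
      unfolding forall_3 a_comp b_comp using assms(1,2)
      by (intro conjI continuous_on_diff continuous_on_mult continuous_on_minus continuous_on_divide continuous_on_const p q) auto
  qed
  then have a: "continuous_process M (\<lambda>s \<omega>. a s \<omega> $ i)" and b: "continuous_process M (\<lambda>s \<omega>. b s \<omega> $ i)" for i
    unfolding continuous_process_def by (auto elim: eventually_mono)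
  have "\<forall>i. (\<lambda>\<omega>. a s \<omega> $ i) \<in> borel_measurable M" "\<forall>i. (\<lambda>\<omega>. b s \<omega> $ i) \<in> borel_measurable M" if "0 \<le> s" for s
    unfolding forall_3 a_comp b_comp
    by (intro conjI borel_measurable_diff borel_measurable_times borel_measurable_uminus borel_measurable_divide
        borel_measurable_const pm[OF that] qm[OF that])+
  then have am: "(\<lambda>\<omega>. a s \<omega> $ i) \<in> borel_measurable M" and bm: "(\<lambda>\<omega>. b s \<omega> $ i) \<in> borel_measurable M"
    if "0 \<le> s" for s i using that by auto
  have cont_vec: "continuous_on S f" if "\<And>i. continuous_on S (\<lambda>s. f s $ i)" for S and f :: "real \<Rightarrow> real^3"
    using continuous_on_vec_lambda[of S "\<lambda>i s. f s $ i"] that by simp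
  have comp_int: "integral {0..s} (\<lambda>u. f u $ i) = integral {0..s} f $ i"
    if "\<And>i. continuous_on {0..} (\<lambda>s. f s $ i)" for f :: "real \<Rightarrow> real^3" and s i
  proof -
    have "continuous_on {0..s} f" by (intro cont_vec continuous_on_subset[OF that]) auto
    then have "f integrable_on {0..s}" by (rule integrable_continuous_interval)
    from integral_linear[OF this bounded_linear_vec_nth[of i]] show ?thesis by (simp add: o_def)
  qed
  define A where "A s \<omega> = angular_velocity ?K (P s \<omega>) \<times> P s \<omega>" for s \<omega>
  define B where "B s \<omega> = angular_velocity ?K (P s \<omega>) \<times> G s \<omega>" for s \<omega>
  define C where "C s \<omega> = (m * g) *\<^sub>R (G s \<omega> \<times> ?c)" for s \<omega>
  have ABC: "AE \<omega> in M. \<forall>s\<ge>0. continuous_on {0..s} (\<lambda>u. A u \<omega>) \<and> continuous_on {0..s} (\<lambda>u. C u \<omega>)"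
    using cont
  proof eventually_elim
    case (elim \<omega>)
    show ?case
    proof (intro allI impI)
      fix s :: real assume "0 \<le> s"
      then have sub: "{0..s} \<subseteq> {0..}" by auto
      have p: "continuous_on {0..s} (\<lambda>u. P u \<omega>)" and q: "continuous_on {0..s} (\<lambda>u. G u \<omega>)"
        using elim by (auto intro!: cont_vec intro: continuous_on_subset[OF _ sub])
      have "continuous_on {0..s} (\<lambda>u. angular_velocity ?K (P u \<omega>))"
        unfolding angular_velocity_def by (rule bounded_linear.continuous_on[OF matrix_vector_mul_bounded_linear p])
      then show "continuous_on {0..s} (\<lambda>u. A u \<omega>) \<and> continuous_on {0..s} (\<lambda>u. C u \<omega>)"
        unfolding A_def C_def by (intro conjI continuous_on_scaleR continuous_on_cross continuous_on_const p q)
    qed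
  qed
  \<comment> \<open>The integrals are chosen time by time, with no relation between different times.
    The condition on \<open>s\<close> stands inside the existential so that choice applies to all
    reals.\<close>
  have "\<forall>s. \<exists>J. 0 \<le> s \<longrightarrow> has_stratonovich_integral M (\<lambda>s \<omega>. ?c \<times> P s \<omega>) W s J \<and>
      (AE \<omega> in M. P s \<omega> - P 0 \<omega> + integral {0..s} (\<lambda>u. A u \<omega>) + J \<omega> - integral {0..s} (\<lambda>u. C u \<omega>) = 0)"
    using sol unfolding A_def C_def by blast
  from choice[OF this] obtain JP where JP: "\<And>s. 0 \<le> s \<Longrightarrow> has_stratonovich_integral M (\<lambda>s \<omega>. ?c \<times> P s \<omega>) W s (JP s)"
    and eqP: "\<And>s. 0 \<le> s \<Longrightarrow> AE \<omega> in M. P s \<omega> - P 0 \<omega> + integral {0..s} (\<lambda>u. A u \<omega>) + JP s \<omega> - integral {0..s} (\<lambda>u. C u \<omega>) = 0"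
    by blast
  have "\<forall>s. \<exists>J. 0 \<le> s \<longrightarrow> has_stratonovich_integral M (\<lambda>s \<omega>. ?c \<times> G s \<omega>) W s J \<and>
      (AE \<omega> in M. G s \<omega> - G 0 \<omega> + integral {0..s} (\<lambda>u. B u \<omega>) + J \<omega> = 0)"
    using sol unfolding B_def by blast
  from choice[OF this] obtain JG where JG: "\<And>s. 0 \<le> s \<Longrightarrow> has_stratonovich_integral M (\<lambda>s \<omega>. ?c \<times> G s \<omega>) W s (JG s)"
    and eqG: "\<And>s. 0 \<le> s \<Longrightarrow> AE \<omega> in M. G s \<omega> - G 0 \<omega> + integral {0..s} (\<lambda>u. B u \<omega>) + JG s \<omega> = 0"
    by blast
  have eqP': "AE \<omega> in M. P s \<omega> $ i - P 0 \<omega> $ i + JP s \<omega> $ i = integral {0..s} (\<lambda>u. a u \<omega> $ i)" if "0 \<le> s" for s i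
    using eqP[OF that] cont_ab ABC
  proof eventually_elim
    case (elim \<omega>)
    have eq: "integral {0..s} (\<lambda>u. a u \<omega>) = integral {0..s} (\<lambda>u. C u \<omega>) - integral {0..s} (\<lambda>u. A u \<omega>)"
      unfolding a_def A_def[symmetric] C_def[symmetric] using elim(3) that
      by (intro Henstock_Kurzweil_Integration.integral_diff integrable_continuous_interval) auto
    have "P s \<omega> - P 0 \<omega> + JP s \<omega> = integral {0..s} (\<lambda>u. a u \<omega>)"
      unfolding eq using elim(1) by (simp add: algebra_simps)
    then have "(P s \<omega> - P 0 \<omega> + JP s \<omega>) $ i = integral {0..s} (\<lambda>u. a u \<omega>) $ i" by (rule arg_cong)
    then show ?case using elim(2) by (simp add: comp_int)
  qed
  have eqG': "AE \<omega> in M. G s \<omega> $ i - G 0 \<omega> $ i + JG s \<omega> $ i = integral {0..s} (\<lambda>u. b u \<omega> $ i)" if "0 \<le> s" for s i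
    using eqG[OF that] cont_ab
  proof eventually_elim
    case (elim \<omega>)
    have eq: "integral {0..s} (\<lambda>u. b u \<omega>) = - integral {0..s} (\<lambda>u. B u \<omega>)"
      unfolding b_def B_def[symmetric] by (rule Henstock_Kurzweil_Integration.integral_neg)
    have "G s \<omega> - G 0 \<omega> + JG s \<omega> = integral {0..s} (\<lambda>u. b u \<omega>)"
      unfolding eq using elim(1) by (simp add: eq_neg_iff_add_eq_0 algebra_simps)
    then have "(G s \<omega> - G 0 \<omega> + JG s \<omega>) $ i = integral {0..s} (\<lambda>u. b u \<omega>) $ i" by (rule arg_cong)
    then show ?case using elim(2) by (simp add: comp_int)
  qed
  \<comment> \<open>The amplitude points along the third axis, so the third component of its cross
    product with anything is 0.\<close>
  have J3: "AE \<omega> in M. J \<omega> $ 3 = 0"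
    if "\<And>i. tame (\<lambda>s \<omega>. Z s \<omega> $ i)" "has_stratonovich_integral M (\<lambda>s \<omega>. ?c \<times> Z s \<omega>) W s J" "0 \<le> s" for Z J s
  proof (rule stratonovich_limit_zero[OF _ that(3)])
    have zm: "(\<lambda>\<omega>. (?c \<times> Z s \<omega>) $ i) \<in> borel_measurable M" if "0 \<le> s" for s i
    proof -
      note zi = tame_measurable[OF \<open>\<And>i. tame (\<lambda>s \<omega>. Z s \<omega> $ i)\<close> that]
      have "\<forall>i. (\<lambda>\<omega>. (?c \<times> Z s \<omega>) $ i) \<in> borel_measurable M"
        unfolding forall_3 cross_components
        by (intro conjI borel_measurable_diff borel_measurable_times borel_measurable_const zi)+
      then show ?thesis by blast
    qed
    have Wm: "W s \<in> borel_measurable M" if "0 \<le> s" for s using W_measurable[OF that] by (rule measurable_F_M)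
    show "stratonovich_limit (\<lambda>s \<omega>. 0) W s (\<lambda>\<omega>. J \<omega> $ 3)"
      using stratonovich_limit_component[OF that(2) zm Wm, of 3] by (simp add: cross_components)
  qed
  note product = stratonovich_product_rule
  \<comment> \<open>The drift vanishes as well: the gravity torque is orthogonal to the axis, and
    equal moments \<open>I\<^sub>1\<close> cancel the gyroscopic term in this component.\<close>
  have P3: "AE \<omega> in M. P t \<omega> $ 3 = P 0 \<omega> $ 3" if "0 < t" for t
    using eqP'[of t 3] J3[OF P JP, of t] that by (auto simp: a_comp elim!: eventually_rev_mp)
  have G3: "AE \<omega> in M. G t \<omega> $ 3 - G 0 \<omega> $ 3 = integral {0..t} (\<lambda>u. b u \<omega> $ 3)" if "0 < t" for t
    using eqG'[of t 3] J3[OF G JG, of t] that by (auto elim!: eventually_rev_mp)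
  have GG: "AE \<omega> in M. G t \<omega> \<bullet> G t \<omega> = G 0 \<omega> \<bullet> G 0 \<omega>" if "0 < t" for t
  proof -
    have "G s \<omega> \<bullet> b s \<omega> + G s \<omega> \<bullet> b s \<omega> = 0" for s \<omega>
      unfolding b_def by (simp add: dot_cross_self)
    then show ?thesis
      using product[OF that G G b bm b bm JG JG eqG' eqG'] by (auto elim: eventually_mono)
  qed
  have PG: "AE \<omega> in M. P t \<omega> \<bullet> G t \<omega> = P 0 \<omega> \<bullet> G 0 \<omega>" if "0 < t" for t
  proof -
    have "G s \<omega> \<bullet> a s \<omega> + P s \<omega> \<bullet> b s \<omega> = 0" for s \<omega>
      by (simp add: inner_vec_def sum_3 a_comp b_comp algebra_simps)
    then show ?thesis
      using product[OF that P G a am b bm JP JG eqP' eqG'] by (auto elim: eventually_mono)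
  qed
  \<comment> \<open>The gyroscopic drift is orthogonal to \<open>P\<close>. What remains is the
    gravity torque, and \<open>P \<bullet> (G \<times> ?c)\<close> is
    \<open>- c\<^sub>3 * I\<^sub>1\<close> times the drift of the third component of
    \<open>G\<close>.\<close>
  have PP: "AE \<omega> in M. P t \<omega> \<bullet> P t \<omega> - P 0 \<omega> \<bullet> P 0 \<omega> = (- 2 * m * g * c\<^sub>3 * I\<^sub>1) * integral {0..t} (\<lambda>u. b u \<omega> $ 3)"
    if "0 < t" for t
  proof -
    have "P s \<omega> \<bullet> a s \<omega> + P s \<omega> \<bullet> a s \<omega> = (- 2 * m * g * c\<^sub>3 * I\<^sub>1) * b s \<omega> $ 3" for s \<omega>
      using assms(1) by (simp add: inner_vec_def sum_3 a_comp b_comp field_simps)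
    then show ?thesis
      using product[OF that P P a am a am JP JP eqP' eqP'] by (simp only: Henstock_Kurzweil_Integration.integral_mult_right)
  qed
  \<comment> \<open>The energy in terms of \<open>P \<bullet> P\<close> and third components only,
    that is, of quantities whose equations carry no noise; separate squares of the first two
    components of \<open>P\<close> do not have this property.\<close>
  define E where "E s \<omega> = (P s \<omega> \<bullet> P s \<omega> - (P s \<omega> $ 3)\<^sup>2) / (2 * I\<^sub>1) + (P s \<omega> $ 3)\<^sup>2 / (2 * I\<^sub>3) + m * g * c\<^sub>3 * G s \<omega> $ 3"
    for s \<omega>
  have energy: "heavy_top_energy ?K m g ?c (P s \<omega>) (G s \<omega>) = E s \<omega>" for s \<omega>
    unfolding heavy_top_energy_def E_def angular_velocity_def[symmetric] ang
    using assms(1,2) by (simp add: inner_vec_def sum_3 power2_eq_square field_simps)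
  have EE: "AE \<omega> in M. E t \<omega> = E 0 \<omega>" if "0 < t" for t
    using PP[OF that] G3[OF that] P3[OF that]
  proof eventually_elim
    case (elim \<omega>)
    have "P t \<omega> \<bullet> P t \<omega> = P 0 \<omega> \<bullet> P 0 \<omega> - 2 * m * g * c\<^sub>3 * I\<^sub>1 * (G t \<omega> $ 3 - G 0 \<omega> $ 3)"
      using elim(1,2) by simp
    then show ?case using assms(1) unfolding E_def elim(3) by (simp add: field_simps)
  qed
  have cont': "AE \<omega> in M. continuous_on {0..} (\<lambda>s. P s \<omega>) \<and> continuous_on {0..} (\<lambda>s. G s \<omega>)"
    using cont by eventually_elim (auto intro: cont_vec)
  have "conserved M P G (\<lambda>p q. p \<bullet> ?c)"
    unfolding conserved_def
  proof (rule conserved_from_fixed_times)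
    show "AE \<omega> in M. continuous_on {0..} (\<lambda>t. P t \<omega> \<bullet> ?c)"
      using cont' by eventually_elim (auto intro: continuous_intros)
    show "AE \<omega> in M. P t \<omega> \<bullet> ?c = P 0 \<omega> \<bullet> ?c" if "0 < t" for t
      using P3[OF that] by eventually_elim (simp add: inner_vec_def sum_3)
  qed
  moreover have "conserved M P G (heavy_top_energy ?K m g ?c)"
    unfolding conserved_def energy
  proof (rule conserved_from_fixed_times)
    show "AE \<omega> in M. continuous_on {0..} (\<lambda>t. E t \<omega>)"
      using cont' unfolding E_def by eventually_elim (use assms(1,2) in \<open>auto intro!: continuous_intros\<close>)
  qed (rule EE)
  moreover have "conserved M P G (\<lambda>p q. (norm q)\<^sup>2)"
    unfolding conserved_def power2_norm_eq_inner
  proof (rule conserved_from_fixed_times)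
    show "AE \<omega> in M. continuous_on {0..} (\<lambda>t. G t \<omega> \<bullet> G t \<omega>)"
      using cont' by eventually_elim (auto intro: continuous_intros)
  qed (rule GG)
  moreover have "conserved M P G (\<lambda>p q. p \<bullet> q)"
    unfolding conserved_def
  proof (rule conserved_from_fixed_times)
    show "AE \<omega> in M. continuous_on {0..} (\<lambda>t. P t \<omega> \<bullet> G t \<omega>)"
      using cont' by eventually_elim (auto intro: continuous_intros)
  qed (rule PG)
  ultimately show ?thesis by blast
qed

end
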